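(* Let $X$ be a Lévy process on $\mathbb Z$ that is killed at the end of an independent exponential time, with potential density $U=\{U_{j,k}\}_{j,k\in\mathbb Z}$. Let $f=\{f_k\}_{k\in\mathbb Z}$ be a finite excessive function for $X$, and let $\widetilde U=\{\widetilde U_{j,k}\}_{j,k\in\mathbb Z}$ where $$\widetilde U_{j,k}=U_{j,k}+f_{-k},\qquad j,k\in\mathbb Z.$$ Then for any $\alpha>0$, $\widetilde U$ is the kernel of an $\alpha$-permanental sequence $\widetilde X_\alpha=\{\widetilde X_{\alpha,n}\}_{n\in\mathbb Z}$, and if $\lim_{k\to\infty}f_{-k}=0$, then $$\limsup_{n\to\infty}\frac{\widetilde X_{\alpha,n}}{\log n}=U_{0,0}\quad\text{a.s.}$$ Furthermore, if $g=Uh$ for a positive sequence $h=\{h_k\}_{k\in\mathbb Z}$, then $g\in c_0^+(\mathbb Z)$ if and only if $h\in c_0^+(\mathbb Z)$.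
   Context: The Lévy process is a continuous time process with stationary independent increments and values in $\mathbb Z$, with transition functions $\widehat p_t(j,k)=\widehat p_t(k-j)$, not necessarily symmetric; $X$ is this process killed at an independent exponential time with mean $1/\beta$, $\beta>0$, so that $X$ has transition functions $p_t(j,k)=e^{-\beta t}\widehat p_t(j,k)$ and potential density $U_{j,k}=\int_0^\infty p_t(j,k)\,dt$. A non-negative function $f$ on $\mathbb Z$ is excessive for $X$ if $\sum_kp_t(j,k)f_k\uparrow f_j$ as $t\downarrow0$ for all $j\in\mathbb Z$. $(Uh)_j=\sum_{k\in\mathbb Z}U_{j,k}h_k$. $c_0^+(\mathbb Z)$ is the set of non-negative sequences on $\mathbb Z$ tending to $0$ as $|k|\to\infty$. Permanental sequences: for $\alpha>0$ and a matrix $K=\{K_{j,k}\}_{j,k\in\mathbb Z}$, an $\alpha$-permanental sequence with kernel $K$ is a family $\{Z_j\}_{j\in\mathbb Z}$ of non-negative random variables such that for all $n$, all distinct $i_1,\dots,i_n\in\mathbb Z$ and all $s_1,\dots,s_n>0$, $E\exp(-\sum_{m=1}^n s_mZ_{i_m})=\det(I+K'S)^{-\alpha}$, where $K'=\{K_{i_p,i_q}\}_{p,q=1}^n$ and $S=\mathrm{diag}(s_1,\dots,s_n)$. *)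

theory Defs
  imports "HOL-Probability.Probability" "Jordan_Normal_Form.Determinant"
begin

definition levy_process :: "'a measure \<Rightarrow> (real \<Rightarrow> 'a \<Rightarrow> int) \<Rightarrow> bool" where
  "levy_process M X \<longleftrightarrow>
     prob_space M \<and>
     (\<forall>t\<ge>0. X t \<in> measurable M (count_space UNIV)) \<and>
     (AE \<omega> in M. X 0 \<omega> = 0) \<and>
     (\<forall>(t :: nat \<Rightarrow> real) n. 0 \<le> t 0 \<and> incseq t \<longrightarrow>
        prob_space.indep_vars M (\<lambda>_. count_space UNIV)
          (\<lambda>i \<omega>. X (t (Suc i)) \<omega> - X (t i) \<omega>) {..<n}) \<and>
     (\<forall>s t. 0 \<le> s \<and> s \<le> t \<longrightarrow>
        distr M (count_space UNIV) (\<lambda>\<omega>. X t \<omega> - X s \<omega>) =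
        distr M (count_space UNIV) (X (t - s))) \<and>
     (\<forall>s\<ge>0. \<forall>\<epsilon>>0.
        ((\<lambda>t. measure M {\<omega> \<in> space M. real_of_int \<bar>X t \<omega> - X s \<omega>\<bar> > \<epsilon>}) \<longlongrightarrow> 0)
          (at s within {0..}))"

definition independent_exponential_time ::
    "'a measure \<Rightarrow> (real \<Rightarrow> 'a \<Rightarrow> int) \<Rightarrow> real \<Rightarrow> ('a \<Rightarrow> real) \<Rightarrow> bool" where
  "independent_exponential_time M X \<beta> \<xi> \<longleftrightarrow>
     distributed M lborel \<xi> (exponential_density \<beta>) \<and>
     prob_space.indep_set M
       (sets (vimage_algebra (space M) (\<lambda>\<omega>. \<lambda>t\<in>{0..}. X t \<omega>) (PiM {0..} (\<lambda>_. count_space UNIV))))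
       (sets (vimage_algebra (space M) \<xi> borel))"

text \<open>The process started at \<open>j\<close>; \<open>None\<close> is the cemetery state.\<close>

definition killed :: "(real \<Rightarrow> 'a \<Rightarrow> int) \<Rightarrow> ('a \<Rightarrow> real) \<Rightarrow> int \<Rightarrow> real \<Rightarrow> 'a \<Rightarrow> int option" where
  "killed X \<xi> j t \<omega> = (if t < \<xi> \<omega> then Some (j + X t \<omega>) else None)"

definition transition ::
    "'a measure \<Rightarrow> (real \<Rightarrow> 'a \<Rightarrow> int) \<Rightarrow> ('a \<Rightarrow> real) \<Rightarrow> real \<Rightarrow> int \<Rightarrow> int \<Rightarrow> real" where
  "transition M X \<xi> t j k = measure M {\<omega> \<in> space M. killed X \<xi> j t \<omega> = Some k}"

lemma transition_eq:
  assumes X: "levy_process M X" and \<xi>: "independent_exponential_time M X \<beta> \<xi>"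
    and "0 < \<beta>" "0 \<le> t"
  shows "transition M X \<xi> t j k = exp (- \<beta> * t) * measure M {\<omega> \<in> space M. X t \<omega> = k - j}"
proof -
  interpret prob_space M using X by (simp add: levy_process_def)
  let ?Q = "PiM {0..} (\<lambda>_. count_space UNIV) :: (real \<Rightarrow> int) measure"
  let ?F = "\<lambda>\<omega>. \<lambda>t\<in>{0..}. X t \<omega>"
  have D: "distributed M lborel \<xi> (exponential_density \<beta>)"
    using \<xi> by (simp add: independent_exponential_time_def)
  have A: "?F -` {x \<in> space ?Q. x t = k - j} \<inter> space M
      \<in> sets (vimage_algebra (space M) ?F ?Q)"
  proof (rule in_vimage_algebra)
    have "(\<lambda>x. x t) -` {k - j} \<inter> space ?Q \<in> sets ?Q"
      by (rule measurable_sets[OF measurable_component_singleton]) (use assms in auto)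
    also have "(\<lambda>x. x t) -` {k - j} \<inter> space ?Q = {x \<in> space ?Q. x t = k - j}" by auto
    finally show "{x \<in> space ?Q. x t = k - j} \<in> sets ?Q" .
  qed
  have B: "\<xi> -` {t<..} \<inter> space M \<in> sets (vimage_algebra (space M) \<xi> borel)"
    by (rule in_vimage_algebra) auto
  have A': "?F -` {x \<in> space ?Q. x t = k - j} \<inter> space M = {\<omega> \<in> space M. X t \<omega> = k - j}"
    using assms by (auto simp: space_PiM)
  have "transition M X \<xi> t j k = prob ({\<omega> \<in> space M. X t \<omega> = k - j} \<inter> (\<xi> -` {t<..} \<inter> space M))"
    unfolding transition_def killed_def
    by (rule arg_cong[where f=prob]) (auto split: if_splits)
  also have "\<dots> = prob {\<omega> \<in> space M. X t \<omega> = k - j} * prob (\<xi> -` {t<..} \<inter> space M)"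
    using \<xi> A B unfolding independent_exponential_time_def indep_set_def[symmetric] A'[symmetric]
    by (auto simp: indep_sets2_eq)
  also have "\<xi> -` {t<..} \<inter> space M = {\<omega> \<in> space M. t < \<xi> \<omega>}" by auto
  also have "prob {\<omega> \<in> space M. t < \<xi> \<omega>} = exp (- t * \<beta>)"
    using exponential_distributedD_gt[OF D] assms by simp
  finally show ?thesis by (simp add: mult.commute)
qed

definition potential_density :: "(real \<Rightarrow> int \<Rightarrow> int \<Rightarrow> real) \<Rightarrow> int \<Rightarrow> int \<Rightarrow> real" where
  "potential_density p j k = (LINT t:{0..}|lborel. p t j k)"

text \<open>
  Sums over \<open>\<int>\<close> of non-negative terms are taken in \<^typ>\<open>ennreal\<close>, as integrals over the counting
  measure, so that a divergent sum has the value \<open>\<infinity>\<close>.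
\<close>

definition kernel_apply :: "(int \<Rightarrow> int \<Rightarrow> real) \<Rightarrow> (int \<Rightarrow> ennreal) \<Rightarrow> int \<Rightarrow> ennreal" where
  "kernel_apply K h j = (\<integral>\<^sup>+ k. ennreal (K j k) * h k \<partial>count_space UNIV)"

definition excessive :: "(real \<Rightarrow> int \<Rightarrow> int \<Rightarrow> real) \<Rightarrow> (int \<Rightarrow> ennreal) \<Rightarrow> bool" where
  "excessive p f \<longleftrightarrow>
     (\<forall>j. (\<forall>s t. 0 < s \<and> s \<le> t \<longrightarrow> kernel_apply (p t) f j \<le> kernel_apply (p s) f j) \<and>
          ((\<lambda>t. kernel_apply (p t) f j) \<longlongrightarrow> f j) (at_right 0))"

definition c0_plus :: "(int \<Rightarrow> ennreal) set" where
  "c0_plus = {g. (\<forall>k. g k < \<infinity>) \<and> (g \<longlongrightarrow> 0) (filtercomap abs at_top)}"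

text \<open>
  The real power \<open>powr\<close> is meant for a positive base. No positivity of the determinant needs to be
  required: it is continuous in \<open>s\<close>, it tends to \<open>1\<close> as \<open>s\<close> tends to \<open>0\<close>, and it never vanishes
  because the expectation is positive whereas \<open>0 powr (- \<alpha>) = 0\<close>.
\<close>

definition permanental_sequence ::
    "'b measure \<Rightarrow> (int \<Rightarrow> 'b \<Rightarrow> real) \<Rightarrow> real \<Rightarrow> (int \<Rightarrow> int \<Rightarrow> real) \<Rightarrow> bool" where
  "permanental_sequence N Z \<alpha> K \<longleftrightarrow>
     prob_space N \<and>
     (\<forall>j. Z j \<in> borel_measurable N \<and> (\<forall>\<omega>\<in>space N. 0 \<le> Z j \<omega>)) \<and>
     (\<forall>n (i :: nat \<Rightarrow> int) (s :: nat \<Rightarrow> real). inj_on i {..<n} \<and> (\<forall>m<n. 0 < s m) \<longrightarrow>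
        prob_space.expectation N (\<lambda>\<omega>. exp (- (\<Sum>m<n. s m * Z (i m) \<omega>))) =
        Determinant.det (1\<^sub>m n + Matrix.mat n n (\<lambda>(p, q). K (i p) (i q)) * mat_diag n s)
          powr (- \<alpha>))"

end

theory Submission
  imports Defs "HOL-Real_Asymp.Real_Asymp"
begin

text \<open>
  For distinct points the matrix of \<open>U\<close> is invertible and, by the maximum principle for the convolution
  potential, its inverse is an M-matrix with non-negative row sums. Since \<open>f\<close> is excessive, the rank
  one perturbation \<open>U'\<close> has the same property. For a kernel \<open>K\<close> with inverse M-matrix \<open>A\<close>, Gaussian
  elimination shows that \<open>det (1 + K S)\<close> to the power \<open>- \<alpha>\<close> is the Laplace transform of a mixture of
  products of gamma distributions with shapes \<open>\<alpha> + n\<close> and rates \<open>A i i\<close>. Uniqueness of Laplace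
  transforms and Kolmogorov's extension theorem give existence.

  For the upper limit, each \<open>X n\<close> is gamma distributed with a scale tending to \<open>U 0 0\<close>, which gives the
  upper bound by the first Borel-Cantelli lemma. For the lower bound, the mixture stochastically dominates
  independent gamma variables with shape \<open>\<alpha>\<close> and rates \<open>A i i\<close>. Along the points \<open>L, 2 L, 3 L, \<dots>\<close> these
  rates are at most \<open>1 / (U 0 0 - \<eta>)\<close>, where \<open>\<eta>\<close> bounds the potential density outside \<open>(- L, L)\<close>
  and is small for large \<open>L\<close>.
\<close>

section \<open>Determinants and power series with non-negative coefficients\<close>

text \<open>The upper limit is asserted for every sequence with this kernel, on any probability
  space, so all joint estimates must pass through finite-dimensional Laplace transforms.
  \<open>levy_process\<close> provides stochastic continuity but no regular paths. The maximum
  principle is therefore not derived from hitting times; it comes from a single small time step,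
  during which the process most likely stays where it is. The reflection in \<open>f (- k)\<close>
  is what fits excessiveness: the perturbing row vector meets the inverse matrix from the left,
  hence the transposed kernel, and transposing a convolution kernel reflects the points. The second
  Borel-Cantelli lemma cannot be used for lack of independence. Instead, the probability that
  finitely many values all stay low is bounded by a product. Thinning to the multiples of
  \<open>L\<close> costs only a factor \<open>L\<close> in a harmonic series, which still
  diverges.\<close>

lemma det_gaussian_elimination:
  fixes m :: "nat \<Rightarrow> nat \<Rightarrow> real"
  assumes d: "m n n \<noteq> 0"
  shows "Determinant.det (Matrix.mat (Suc n) (Suc n) (\<lambda>(i, j). m i j)) =
    m n n * Determinant.det (Matrix.mat n n (\<lambda>(i, j). m i j - m i n * m n j / m n n))"
proof -
  \<comment> \<open>Right multiplication by the unipotent \<open>E\<close> subtracts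
    \<open>m n j / m n n\<close> times column \<open>n\<close> from column \<open>j\<close>. This
    clears row \<open>n\<close> to the left of the diagonal and leaves the Schur complement.\<close>
  define E :: "real mat" where "E = Matrix.mat (Suc n) (Suc n)
    (\<lambda>(i, j). if i = j then 1 else if i = n then - m n j / m n n else 0)"
  define A where "A = Matrix.mat (Suc n) (Suc n) (\<lambda>(i, j). m i j)"
  have E[simp]: "E \<in> carrier_mat (Suc n) (Suc n)" and A[simp]: "A \<in> carrier_mat (Suc n) (Suc n)"
    by (auto simp: E_def A_def)
  have dE: "Determinant.det E = 1"
  proof -
    have "Determinant.det E = prod_list (diag_mat E)"
      by (rule det_lower_triangular[of "Suc n"]) (auto simp: E_def)
    also have "\<dots> = 1" unfolding prod_list_diag_prod by (intro prod.neutral) (auto simp: E_def)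
    finally show ?thesis .
  qed
  define B where "B = A * E"
  have B[simp]: "B \<in> carrier_mat (Suc n) (Suc n)" unfolding B_def by (rule mult_carrier_mat[OF A E])
  have Bij: "B $$ (i, j) = (if j = n then m i n else m i j - m i n * m n j / m n n)"
    if "i \<le> n" "j \<le> n" for i j
  proof -
    have "B $$ (i, j) = (\<Sum>k = 0..<Suc n. m i k * (if k = j then 1 else if k = n then - m n j / m n n else 0))"
      using that unfolding B_def by (auto simp: A_def E_def scalar_prod_def intro!: sum.cong)
    also have "\<dots> = (\<Sum>k = 0..<Suc n. (if k = j then m i k else 0) +
        (if k = n then (if j = n then 0 else - m i n * m n j / m n n) else 0))"
      using that by (intro sum.cong) auto
    also have "\<dots> = (if j = n then m i n else m i j - m i n * m n j / m n n)"
      using that by (subst sum.distrib, subst sum.delta, simp, subst sum.delta) auto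
    finally show ?thesis .
  qed
  have "Determinant.det A = Determinant.det B"
    unfolding B_def by (simp add: det_mult[OF A E] dE)
  also have "\<dots> = (\<Sum>j<Suc n. B $$ (n, j) * cofactor B n j)"
    by (rule laplace_expansion_row) auto
  also have "\<dots> = (\<Sum>j\<in>{n}. B $$ (n, j) * cofactor B n j)"
    using d by (intro sum.mono_neutral_right) (auto simp: Bij)
  also have "\<dots> = m n n * Determinant.det (mat_delete B n n)"
    by (simp add: Bij cofactor_def)
  also have "mat_delete B n n = Matrix.mat n n (\<lambda>(i, j). m i j - m i n * m n j / m n n)"
    by (rule eq_matI) (auto simp: mat_delete_def Bij carrier_matD[OF B])
  finally show ?thesis unfolding A_def .
qed

text \<open>Multiplication of \<open>?M\<close> by the unipotent \<open>?L\<close> makes it block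
  triangular from either side, and the two orders leave the two determinants. With incidence
  matrices this later compares permanental determinants over different index sets.\<close>

lemma sylvester_det:
  fixes A B :: "real mat"
  assumes A: "A \<in> carrier_mat n m" and B: "B \<in> carrier_mat m n"
  shows "Determinant.det (1\<^sub>m n + A * B) = Determinant.det (1\<^sub>m m + B * A)"
proof -
  let ?M = "four_block_mat (1\<^sub>m n) (- A) B (1\<^sub>m m)"
  let ?L = "four_block_mat (1\<^sub>m n) A (0\<^sub>m m n) (1\<^sub>m m)"
  have M: "?M \<in> carrier_mat (n + m) (n + m)" and L: "?L \<in> carrier_mat (n + m) (n + m)" by auto
  have dL: "Determinant.det ?L = 1"
    by (subst det_four_block_mat_lower_left_zero[OF one_carrier_mat A refl one_carrier_mat]) simp
  have "?L * ?M = four_block_mat (1\<^sub>m n + A * B) (0\<^sub>m n m) B (1\<^sub>m m)"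
    using A B by (subst mult_four_block_mat[where ?n2.0 = m and ?nr1.0 = n and ?nr2.0 = m and ?nc1.0 = n and ?nc2.0 = m and ?n1.0 = n]) (auto simp: uminus_l_inv_mat)
  then have 1: "Determinant.det ?M = Determinant.det (1\<^sub>m n + A * B)"
    using det_mult[OF L M] dL det_four_block_mat_upper_right_zero[of "1\<^sub>m n + A * B" n "0\<^sub>m n m" m B "1\<^sub>m m"] A B by simp
  have "?M * ?L = four_block_mat (1\<^sub>m n) (0\<^sub>m n m) B (1\<^sub>m m + B * A)"
    using A B by (subst mult_four_block_mat[where ?n2.0 = m and ?nr1.0 = n and ?nr2.0 = m and ?nc1.0 = n and ?nc2.0 = m and ?n1.0 = n]) (auto simp: comm_add_mat[of "B * A" m m])
  then have 2: "Determinant.det ?M = Determinant.det (1\<^sub>m m + B * A)"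
    using det_mult[OF M L] dL det_four_block_mat_upper_right_zero[of "1\<^sub>m n" n "0\<^sub>m n m" m B "1\<^sub>m m + B * A"] A B by simp
  show ?thesis using 1 2 by simp
qed

text \<open>A power series with non-negative coefficients that converges on the closed unit cube.
  One \<open>nat\<close> enumerates the monomials, repetitions allowed, so that sums and products
  are mere re-enumerations by \<open>prod_decode\<close>; coefficients in \<open>ennreal\<close>
  make every rearrangement free.\<close>

definition pseries :: "nat \<Rightarrow> ((nat \<Rightarrow> real) \<Rightarrow> real) \<Rightarrow> bool" where
  "pseries N \<psi> \<longleftrightarrow> (\<exists>(c :: nat \<Rightarrow> ennreal) (e :: nat \<Rightarrow> nat \<Rightarrow> nat).
     \<forall>r. (\<forall>i<N. 0 \<le> r i \<and> r i \<le> 1) \<longrightarrow>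
       0 \<le> \<psi> r \<and> ennreal (\<psi> r) = (\<Sum>k. c k * ennreal (\<Prod>i<N. r i ^ e k i)))"

lemma pseriesI:
  assumes "\<And>r. (\<And>i. i < N \<Longrightarrow> 0 \<le> r i) \<Longrightarrow> (\<And>i. i < N \<Longrightarrow> r i \<le> 1) \<Longrightarrow>
    0 \<le> \<psi> r \<and> ennreal (\<psi> r) = (\<Sum>k. c k * ennreal (\<Prod>i<N. r i ^ e k i))"
  shows "pseries N \<psi>"
  using assms unfolding pseries_def by blast

lemma pseries_nonneg:
  "pseries N \<psi> \<Longrightarrow> (\<And>i. i < N \<Longrightarrow> 0 \<le> r i) \<Longrightarrow> (\<And>i. i < N \<Longrightarrow> r i \<le> 1) \<Longrightarrow> 0 \<le> \<psi> r"
  unfolding pseries_def by blast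

lemma pseries_cong:
  assumes \<psi>: "pseries N \<psi>" and eq: "\<And>r. \<forall>i<N. 0 \<le> r i \<and> r i \<le> 1 \<Longrightarrow> \<psi> r = \<phi> r"
  shows "pseries N \<phi>"
proof -
  obtain c e where "\<And>r. (\<forall>i<N. 0 \<le> r i \<and> r i \<le> 1) \<Longrightarrow>
       0 \<le> \<psi> r \<and> ennreal (\<psi> r) = (\<Sum>k. c k * ennreal (\<Prod>i<N. r i ^ e k i))"
    using \<psi> unfolding pseries_def by metis
  then show ?thesis using eq by (intro pseriesI[of N \<phi> c e]) auto
qed

lemma pseries_monomial:
  assumes "0 \<le> a"
  shows "pseries N (\<lambda>r. a * (\<Prod>i<N. r i ^ e i))"
proof (rule pseriesI[where c = "\<lambda>k. if k = 0 then ennreal a else 0" and e = "\<lambda>k. e"], intro conjI)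
  fix r :: "nat \<Rightarrow> real" assume r: "\<And>i. i < N \<Longrightarrow> 0 \<le> r i" "\<And>i. i < N \<Longrightarrow> r i \<le> 1"
  have p: "0 \<le> (\<Prod>i<N. r i ^ e i)" using r by (intro prod_nonneg) auto
  then show "0 \<le> a * (\<Prod>i<N. r i ^ e i)" using assms by simp
  have "(\<Sum>k. (if k = (0::nat) then ennreal a else 0) * ennreal (\<Prod>i<N. r i ^ e i)) =
    (\<Sum>k\<in>{0::nat}. (if k = 0 then ennreal a else 0) * ennreal (\<Prod>i<N. r i ^ e i))"
    by (rule suminf_finite) auto
  then show "ennreal (a * (\<Prod>i<N. r i ^ e i)) =
      (\<Sum>k. (if k = (0::nat) then ennreal a else 0) * ennreal (\<Prod>i<N. r i ^ e i))"
    using assms p by (simp add: ennreal_mult)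
qed

lemma pseries_const: "0 \<le> a \<Longrightarrow> pseries N (\<lambda>r. a)"
  using pseries_monomial[of a N "\<lambda>_. 0"] by simp

lemma pseries_scaled_var:
  assumes "0 \<le> a" "i < N" shows "pseries N (\<lambda>r. r i * a)"
proof -
  have "(\<Prod>j<N. r j ^ (if j = i then 1 else 0)) = r i" for r :: "nat \<Rightarrow> real"
  proof -
    have "(\<Prod>j<N. r j ^ (if j = i then 1 else 0)) = (\<Prod>j<N. if j = i then r j else 1)"
      by (intro prod.cong) auto
    also have "\<dots> = r i" using assms by (subst prod.delta) auto
    finally show ?thesis .
  qed
  then show ?thesis using pseries_monomial[of a N "\<lambda>j. if j = i then 1 else 0"] assms by (simp add: mult.commute)
qed

lemma pseries_suminf:
  assumes "\<And>m::nat. pseries N (\<psi> m)"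
    and "\<And>r. (\<And>i. i < N \<Longrightarrow> 0 \<le> r i) \<Longrightarrow> (\<And>i. i < N \<Longrightarrow> r i \<le> 1) \<Longrightarrow> (\<lambda>m. \<psi> m r) sums \<phi> r"
  shows "pseries N \<phi>"
proof -
  from assms(1) obtain c e where ce: "\<And>m r. (\<forall>i<N. 0 \<le> r i \<and> r i \<le> 1) \<Longrightarrow>
       0 \<le> \<psi> m r \<and> ennreal (\<psi> m r) = (\<Sum>k. c m k * ennreal (\<Prod>i<N. r i ^ e m k i))"
    unfolding pseries_def by metis
  show ?thesis
  proof (rule pseriesI[where c = "\<lambda>k. case prod_decode k of (m, l) \<Rightarrow> c m l"
        and e = "\<lambda>k. case prod_decode k of (m, l) \<Rightarrow> e m l"], intro conjI)
    fix r :: "nat \<Rightarrow> real" assume r: "\<And>i. i < N \<Longrightarrow> 0 \<le> r i" "\<And>i. i < N \<Longrightarrow> r i \<le> 1"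
    have s: "(\<lambda>m. \<psi> m r) sums \<phi> r" using assms(2) r by blast
    have n: "0 \<le> \<psi> m r" for m using ce r by blast
    show "0 \<le> \<phi> r" using sums_le[OF _ sums_zero s] n by blast
    have "ennreal (\<phi> r) = (\<Sum>m. ennreal (\<psi> m r))"
      using s n by (subst suminf_ennreal2) (auto simp: sums_iff)
    also have "\<dots> = (\<Sum>k. (\<lambda>(m, l). c m l * ennreal (\<Prod>i<N. r i ^ e m l i)) (prod_decode k))"
      using ce r by (intro suminf_ennreal_2dimen[symmetric]) auto
    finally show "ennreal (\<phi> r) = (\<Sum>k. (case prod_decode k of (m, l) \<Rightarrow> c m l) *
        ennreal (\<Prod>i<N. r i ^ (case prod_decode k of (m, l) \<Rightarrow> e m l) i))"
      by (simp add: case_prod_beta)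
  qed
qed

lemma pseries_add:
  assumes "pseries N \<psi>" "pseries N \<phi>" shows "pseries N (\<lambda>r. \<psi> r + \<phi> r)"
proof (rule pseries_suminf[where \<psi> = "\<lambda>m. if m = 0 then \<psi> else if m = 1 then \<phi> else (\<lambda>r. 0)"])
  fix r
  show "(\<lambda>m. (if m = 0 then \<psi> else if m = 1 then \<phi> else (\<lambda>r. 0)) r) sums (\<psi> r + \<phi> r)"
    using sums_finite[of "{0, 1::nat}" "\<lambda>m. (if m = 0 then \<psi> else if m = 1 then \<phi> else (\<lambda>r. 0)) r"] by auto
qed (use assms in \<open>auto intro: pseries_const\<close>)

lemma pseries_mult:
  assumes "pseries N \<psi>" "pseries N \<phi>" shows "pseries N (\<lambda>r. \<psi> r * \<phi> r)"
proof -
  obtain c e where 1: "\<And>r. (\<forall>i<N. 0 \<le> r i \<and> r i \<le> 1) \<Longrightarrow>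
       0 \<le> \<psi> r \<and> ennreal (\<psi> r) = (\<Sum>k. c k * ennreal (\<Prod>i<N. r i ^ e k i))"
    using assms(1) unfolding pseries_def by metis
  obtain c' e' where 2: "\<And>r. (\<forall>i<N. 0 \<le> r i \<and> r i \<le> 1) \<Longrightarrow>
       0 \<le> \<phi> r \<and> ennreal (\<phi> r) = (\<Sum>k. c' k * ennreal (\<Prod>i<N. r i ^ e' k i))"
    using assms(2) unfolding pseries_def by metis
  show ?thesis
  proof (rule pseriesI[where c = "\<lambda>k. case prod_decode k of (m, l) \<Rightarrow> c m * c' l"
        and e = "\<lambda>k. case prod_decode k of (m, l) \<Rightarrow> (\<lambda>i. e m i + e' l i)"], intro conjI)
    fix r :: "nat \<Rightarrow> real" assume r: "\<And>i. i < N \<Longrightarrow> 0 \<le> r i" "\<And>i. i < N \<Longrightarrow> r i \<le> 1"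
    then show "0 \<le> \<psi> r * \<phi> r" using 1 2 by auto
    have p: "0 \<le> (\<Prod>i<N. r i ^ f i)" for f using r by (intro prod_nonneg) auto
    have "ennreal (\<psi> r * \<phi> r) = (\<Sum>m. c m * ennreal (\<Prod>i<N. r i ^ e m i)) * (\<Sum>l. c' l * ennreal (\<Prod>i<N. r i ^ e' l i))"
      using 1 2 r by (subst ennreal_mult) auto
    also have "\<dots> = (\<Sum>m. \<Sum>l. c m * ennreal (\<Prod>i<N. r i ^ e m i) * (c' l * ennreal (\<Prod>i<N. r i ^ e' l i)))"
      unfolding ennreal_suminf_multc[symmetric] by (subst ennreal_suminf_cmult[symmetric]) (rule refl)
    also have "\<dots> = (\<Sum>m. \<Sum>l. c m * c' l * ennreal (\<Prod>i<N. r i ^ (e m i + e' l i)))"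
    proof (intro suminf_cong)
      fix m l
      have "(\<Prod>i<N. r i ^ (e m i + e' l i)) = (\<Prod>i<N. r i ^ e m i) * (\<Prod>i<N. r i ^ e' l i)"
        by (simp add: power_add prod.distrib)
      then show "c m * ennreal (\<Prod>i<N. r i ^ e m i) * (c' l * ennreal (\<Prod>i<N. r i ^ e' l i)) =
          c m * c' l * ennreal (\<Prod>i<N. r i ^ (e m i + e' l i))"
        using p by (simp only: ennreal_mult mult.assoc mult.left_commute)
    qed
    also have "\<dots> = (\<Sum>k. (\<lambda>(m, l). c m * c' l * ennreal (\<Prod>i<N. r i ^ (e m i + e' l i))) (prod_decode k))"
      by (intro suminf_ennreal_2dimen[symmetric]) auto
    finally show "ennreal (\<psi> r * \<phi> r) = (\<Sum>k. (case prod_decode k of (m, l) \<Rightarrow> c m * c' l) *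
        ennreal (\<Prod>i<N. r i ^ (case prod_decode k of (m, l) \<Rightarrow> (\<lambda>i. e m i + e' l i)) i))"
      by (simp add: case_prod_beta)
  qed
qed

lemma pseries_power: "pseries N \<psi> \<Longrightarrow> pseries N (\<lambda>r. \<psi> r ^ m)"
  by (induction m) (auto intro: pseries_const pseries_mult)

text \<open>In the binomial series of \<open>(1 - x) powr (- \<alpha>)\<close> the signs cancel and
  leave the coefficients \<open>(m + \<alpha> - 1) gchoose m\<close>, which are non-negative for
  positive \<alpha>.\<close>

lemma pseries_powr_minus:
  assumes F: "pseries N F" and "0 < \<alpha>"
    and lt: "\<And>r. (\<And>i. i < N \<Longrightarrow> 0 \<le> r i) \<Longrightarrow> (\<And>i. i < N \<Longrightarrow> r i \<le> 1) \<Longrightarrow> F r < 1"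
  shows "pseries N (\<lambda>r. (1 - F r) powr (- \<alpha>))"
proof (rule pseries_suminf[where \<psi> = "\<lambda>m r. ((real m + \<alpha> - 1) gchoose m) * F r ^ m"])
  fix m
  have "0 \<le> ((real m + \<alpha> - 1) gchoose m)"
    using \<open>0 < \<alpha>\<close> by (auto simp: gbinomial_pochhammer' intro!: divide_nonneg_nonneg pochhammer_nonneg)
  then show "pseries N (\<lambda>r. ((real m + \<alpha> - 1) gchoose m) * F r ^ m)"
    by (intro pseries_mult pseries_const pseries_power F)
next
  fix r :: "nat \<Rightarrow> real" assume r: "\<And>i. i < N \<Longrightarrow> 0 \<le> r i" "\<And>i. i < N \<Longrightarrow> r i \<le> 1"
  have "\<bar>- F r\<bar> < 1" using lt[of r] pseries_nonneg[OF F, of r] r by auto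
  then have s: "(\<lambda>m. (- \<alpha> gchoose m) * (- F r) ^ m) sums (1 - F r) powr (- \<alpha>)"
    using gen_binomial_real[of "- F r" "- \<alpha>"] by simp
  show "(\<lambda>m. ((real m + \<alpha> - 1) gchoose m) * F r ^ m) sums (1 - F r) powr (- \<alpha>)"
  proof (rule sums_cong[THEN iffD1, OF _ s])
    fix m
    have "(- \<alpha> gchoose m) * (- F r) ^ m = (- 1) ^ m * ((real m - (- \<alpha>) - 1) gchoose m) * ((- 1) ^ m * F r ^ m)"
      by (subst gbinomial_negated_upper) (simp only: power_minus[of "F r"])
    also have "\<dots> = ((- 1) ^ m * (- 1) ^ m) * (((real m - (- \<alpha>) - 1) gchoose m) * F r ^ m)"
      by (simp only: mult.assoc mult.left_commute)
    also have "(- 1 :: real) ^ m * (- 1) ^ m = 1" by (simp add: power_mult_distrib[symmetric])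
    finally show "(- \<alpha> gchoose m) * (- F r) ^ m = ((real m + \<alpha> - 1) gchoose m) * F r ^ m" by simp
  qed
qed

abbreviation one_minus_det :: "nat \<Rightarrow> (nat \<Rightarrow> nat \<Rightarrow> real) \<Rightarrow> real" where
  "one_minus_det n Q \<equiv> Determinant.det (Matrix.mat n n (\<lambda>(i, j). (if i = j then 1 else 0) - Q i j))"

text \<open>Induction by elimination of the last index: the Schur complement is again of the form
  \<open>1 - Q'\<close>, where the correction to \<open>Q\<close> is a product of series with
  non-negative coefficients. The weight \<open>v\<close> with \<open>Q v < v\<close> on the whole
  cube replaces a spectral radius condition: it forces \<open>Q n n < 1\<close>, and it is inherited
  by \<open>Q'\<close> because the eliminated coordinate is at most \<open>v n\<close>.\<close>

lemma det_powr_minus_pseries: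
  fixes Q :: "nat \<Rightarrow> nat \<Rightarrow> (nat \<Rightarrow> real) \<Rightarrow> real" and v :: "nat \<Rightarrow> real"
  assumes "0 < \<alpha>" and "\<And>i j. i < n \<Longrightarrow> j < n \<Longrightarrow> pseries N (Q i j)"
    and "\<And>i. i < n \<Longrightarrow> 0 < v i"
    and "\<And>r i. (\<And>i. i < N \<Longrightarrow> 0 \<le> r i) \<Longrightarrow> (\<And>i. i < N \<Longrightarrow> r i \<le> 1) \<Longrightarrow> i < n \<Longrightarrow> (\<Sum>j<n. Q i j r * v j) < v i"
  shows "(\<forall>r. (\<forall>i<N. 0 \<le> r i \<and> r i \<le> 1) \<longrightarrow>
      0 < one_minus_det n (\<lambda>i j. Q i j r)) \<and>
    pseries N (\<lambda>r. one_minus_det n (\<lambda>i j. Q i j r) powr (- \<alpha>))"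
  using assms(2-)
proof (induction n arbitrary: Q)
  case 0
  have "Determinant.det (Matrix.mat 0 0 f :: real mat) = 1" for f
    by (rule det_dim_zero) auto
  then show ?case by (simp add: pseries_const)
next
  case (Suc n)
  note Q = Suc.prems(1) and v = Suc.prems(2) and lt = Suc.prems(3)
  have Qnn: "Q n n r < 1" if r: "\<And>i. i < N \<Longrightarrow> 0 \<le> r i" "\<And>i. i < N \<Longrightarrow> r i \<le> 1" for r
  proof -
    have "Q n n r * v n \<le> (\<Sum>j<Suc n. Q n j r * v j)"
      using v pseries_nonneg[OF Q, of n _ r] r
      by (auto intro!: sum_nonneg mult_nonneg_nonneg simp: less_imp_le)
    also have "\<dots> < v n" using lt[of r n] r by auto
    finally show ?thesis using v[of n] by simp
  qed
  \<comment> \<open>The factor \<open>1 / (1 - Q n n)\<close> is written as a power with exponent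
    \<open>- 1\<close>, so that \<open>pseries_powr_minus\<close> also covers it.\<close>
  define Q' where "Q' = (\<lambda>i j r. Q i j r + Q i n r * Q n j r * (1 - Q n n r) powr (- 1))"
  have p1: "pseries N (\<lambda>r. (1 - Q n n r) powr (- a))" if "0 < a" for a
    using that Qnn by (intro pseries_powr_minus) (auto intro: Q)
  have Q': "pseries N (Q' i j)" if "i < n" "j < n" for i j
    unfolding Q'_def using that
    by (intro pseries_add pseries_mult p1 Q) auto
  have Q'_lt: "(\<Sum>j<n. Q' i j r * v j) < v i"
    if r: "\<And>i. i < N \<Longrightarrow> 0 \<le> r i" "\<And>i. i < N \<Longrightarrow> r i \<le> 1" and i: "i < n" for r i
  proof -
    have q: "0 < 1 - Q n n r" using Qnn[of r] r by auto
    have pw: "(1 - Q n n r) powr (- 1) = 1 / (1 - Q n n r)"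
      using q by (simp add: powr_minus_divide)
    have "(\<Sum>j<n. Q n j r * v j) \<le> (1 - Q n n r) * v n"
      using lt[of r n] r by (auto simp: algebra_simps)
    then have le: "(\<Sum>j<n. Q n j r * v j) / (1 - Q n n r) \<le> v n"
      using q by (simp add: pos_divide_le_eq mult.commute)
    have "(\<Sum>j<n. Q' i j r * v j) = (\<Sum>j<n. Q i j r * v j) + Q i n r * ((\<Sum>j<n. Q n j r * v j) / (1 - Q n n r))"
      unfolding Q'_def pw by (simp add: sum.distrib algebra_simps sum_distrib_left sum_divide_distrib)
    also have "\<dots> \<le> (\<Sum>j<n. Q i j r * v j) + Q i n r * v n"
      using pseries_nonneg[OF Q, of i n r] r i le by (intro add_left_mono mult_left_mono) auto
    also have "\<dots> < v i" using lt[of r i] r i by simp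
    finally show ?thesis .
  qed
  have IH: "(\<forall>r. (\<forall>i<N. 0 \<le> r i \<and> r i \<le> 1) \<longrightarrow>
      0 < one_minus_det n (\<lambda>i j. Q' i j r)) \<and>
    pseries N (\<lambda>r. one_minus_det n (\<lambda>i j. Q' i j r) powr (- \<alpha>))"
    using v by (intro Suc.IH Q' Q'_lt) auto
  have det: "one_minus_det (Suc n) (\<lambda>i j. Q i j r) =
     (1 - Q n n r) * one_minus_det n (\<lambda>i j. Q' i j r)"
    if r: "\<And>i. i < N \<Longrightarrow> 0 \<le> r i" "\<And>i. i < N \<Longrightarrow> r i \<le> 1" for r
  proof -
    have q: "0 < 1 - Q n n r" using Qnn[of r] r by auto
    have pw: "(1 - Q n n r) powr (- 1) = 1 / (1 - Q n n r)"
      using q by (simp add: powr_minus_divide)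
    have "Matrix.mat n n (\<lambda>(i, j). (if i = j then 1 else 0) - Q' i j r) = Matrix.mat n n (\<lambda>(i, j).
       ((if i = j then 1 else 0) - Q i j r) - ((if i = n then 1 else 0) - Q i n r) * ((if n = j then 1 else 0) - Q n j r) /
          ((if n = n then 1 else 0) - Q n n r))"
      by (rule eq_matI) (auto simp: Q'_def pw abs_of_pos[OF q] q)
    then show ?thesis
      using q det_gaussian_elimination[of "\<lambda>i j. (if i = j then 1 else 0) - Q i j r" n] by simp
  qed
  show ?case
  proof (intro conjI allI impI)
    fix r :: "nat \<Rightarrow> real" assume r: "\<forall>i<N. 0 \<le> r i \<and> r i \<le> 1"
    then show "0 < one_minus_det (Suc n) (\<lambda>i j. Q i j r)"
      using IH Qnn[of r] by (subst det) auto
  next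
    have "pseries N (\<lambda>r. (1 - Q n n r) powr (- \<alpha>) *
        one_minus_det n (\<lambda>i j. Q' i j r) powr (- \<alpha>))"
      using IH \<open>0 < \<alpha>\<close> by (intro pseries_mult p1) auto
    moreover have "(1 - Q n n r) powr (- \<alpha>) *
        one_minus_det n (\<lambda>i j. Q' i j r) powr (- \<alpha>) =
        one_minus_det (Suc n) (\<lambda>i j. Q i j r) powr (- \<alpha>)"
      if r: "\<forall>i<N. 0 \<le> r i \<and> r i \<le> 1" for r
      using IH Qnn[of r] r by (subst det) (auto intro!: powr_mult[symmetric])
    ultimately show "pseries N (\<lambda>r. one_minus_det (Suc n) (\<lambda>i j. Q i j r) powr (- \<alpha>))"
      by (rule pseries_cong) blast
  qed
qed

section \<open>Permanental determinants and inverse M-matrices\<close>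

abbreviation perm_det :: "nat \<Rightarrow> (nat \<Rightarrow> nat \<Rightarrow> real) \<Rightarrow> (nat \<Rightarrow> real) \<Rightarrow> real" where
  "perm_det n K s \<equiv> Determinant.det (1\<^sub>m n + Matrix.mat n n (\<lambda>(p, q). K p q) * mat_diag n s)"

lemma one_plus_mult_diag:
  "1\<^sub>m n + Matrix.mat n n (\<lambda>(p, q). K p q) * mat_diag n s =
    Matrix.mat n n (\<lambda>(p, q). (if p = q then 1 else 0) + K p q * (s q :: real))"
  by (subst mat_diag_mult_right[of _ n]) (auto intro!: eq_matI)

lemma det_scale_rows:
  "Determinant.det (Matrix.mat n n (\<lambda>(p, q). c p * M p q)) =
    (\<Prod>p<n. c p :: real) * Determinant.det (Matrix.mat n n (\<lambda>(p, q). M p q))"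
proof -
  let ?M = "Matrix.mat n n (\<lambda>(p, q). M p q)"
  have 1: "mat_diag n c * ?M = Matrix.mat n n (\<lambda>(p, q). c p * M p q)"
    by (subst mat_diag_mult_left[of _ _ n]) (auto intro!: eq_matI)
  have "Determinant.det (mat_diag n c) = prod_list (diag_mat (mat_diag n c))"
    by (rule det_upper_triangular[of _ n]) (auto simp: mat_diag_def)
  also have "\<dots> = (\<Prod>p<n. c p)"
    unfolding prod_list_diag_prod by (auto simp: mat_diag_def atLeast0LessThan intro!: prod.cong)
  finally show ?thesis unfolding 1[symmetric] by (subst det_mult[of _ n]) auto
qed

text \<open>Non-negativity of \<open>K\<close> takes the place of an eigenvalue condition on the
  M-matrix \<open>A\<close>: the row sums of \<open>K\<close> form a positive vector that
  \<open>A\<close> maps to the constant \<open>1\<close>.\<close>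

definition inverse_M_matrix :: "nat \<Rightarrow> (nat \<Rightarrow> nat \<Rightarrow> real) \<Rightarrow> (nat \<Rightarrow> nat \<Rightarrow> real) \<Rightarrow> bool" where
  "inverse_M_matrix n K A \<longleftrightarrow> (\<forall>i<n. \<forall>j<n. 0 \<le> K i j \<and> (\<Sum>k<n. K i k * A k j) = (if i = j then 1 else 0) \<and>
     (\<Sum>k<n. A i k * K k j) = (if i = j then 1 else 0) \<and> (i \<noteq> j \<longrightarrow> A i j \<le> 0))"

text \<open>
  The inverse \<open>A\<close> of \<open>K\<close> is an M-matrix. With \<open>D\<close> the diagonal of \<open>A\<close>, \<open>1 + K S = K (D + S) (1 - Q)\<close>
  where \<open>Q\<close> has non-negative entries that are linear in the variables \<open>d / (d + s)\<close>.
\<close>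

lemma inverse_M_matrix_series:
  assumes \<alpha>: "0 < \<alpha>" and M: "inverse_M_matrix n K A"
  shows "(\<forall>i<n. 0 < A i i) \<and> (\<exists>(c :: nat \<Rightarrow> ennreal) (e :: nat \<Rightarrow> nat \<Rightarrow> nat). (\<Sum>k. c k) = 1 \<and>
    (\<forall>s. (\<forall>i<n. 0 \<le> s i) \<longrightarrow>
      ennreal (perm_det n K s powr (- \<alpha>)) =
      (\<Prod>i<n. ennreal ((A i i / (A i i + s i)) powr \<alpha>)) *
      (\<Sum>k. c k * ennreal (\<Prod>i<n. (A i i / (A i i + s i)) ^ e k i))))" (is "_ \<and> ?series")
proof (intro conjI)
  have K: "0 \<le> K i j" and KA: "(\<Sum>k<n. K i k * A k j) = (if i = j then 1 else 0)"
    and AK: "(\<Sum>k<n. A i k * K k j) = (if i = j then 1 else 0)" and A: "i \<noteq> j \<Longrightarrow> A i j \<le> 0"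
    if "i < n" "j < n" for i j
    using M that unfolding inverse_M_matrix_def by blast+
  \<comment> \<open>This is the weight for \<open>det_powr_minus_pseries\<close>. Since
    \<open>A v = 1\<close> and the off-diagonal entries of \<open>A\<close> are not positive,
    \<open>A i i * v i\<close> is at least \<open>1\<close>, which makes both factors
    positive.\<close>
  define v where "v = (\<lambda>i. \<Sum>j<n. K i j)"
  have v0: "0 \<le> v i" if "i < n" for i unfolding v_def using K that by (intro sum_nonneg) auto
  have Av: "(\<Sum>j<n. A i j * v j) = 1" if i: "i < n" for i
  proof -
    have "(\<Sum>j<n. A i j * v j) = (\<Sum>k<n. \<Sum>j<n. A i j * K j k)"
      unfolding v_def by (subst sum.swap) (simp add: sum_distrib_left)
    also have "\<dots> = (\<Sum>k<n. if i = k then 1 else 0)" using AK i by (intro sum.cong) auto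
    also have "\<dots> = 1" using i by simp
    finally show ?thesis .
  qed
  have split: "A i i * v i = 1 + (\<Sum>j\<in>{..<n} - {i}. - A i j * v j)" if i: "i < n" for i
    using Av[OF i] i by (subst (asm) sum.remove[of _ i]) (auto simp: sum_negf)
  have dv: "1 \<le> A i i * v i" if i: "i < n" for i
  proof -
    have "0 \<le> (\<Sum>j\<in>{..<n} - {i}. - A i j * v j)"
      using A i v0 by (intro sum_nonneg mult_nonneg_nonneg) auto
    then show ?thesis using split[OF i] by simp
  qed
  have d: "0 < A i i" and v: "0 < v i" if i: "i < n" for i
  proof -
    have "0 < A i i * v i" using dv[OF i] by simp
    then show "0 < A i i" "0 < v i" using v0[OF i] by (auto simp: zero_less_mult_iff)
  qed
  show "\<forall>i<n. 0 < A i i" using d by blast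
  define Q :: "nat \<Rightarrow> nat \<Rightarrow> (nat \<Rightarrow> real) \<Rightarrow> real" where
    "Q = (\<lambda>i j r. if i = j then 0 else r i * (- A i j / A i i))"
  have Qp: "pseries n (Q i j)" if "i < n" "j < n" for i j
  proof (cases "i = j")
    case True then show ?thesis by (simp add: Q_def pseries_const)
  next
    case False
    then have "0 \<le> - A i j / A i i" using A[of i j] d[of i] that by (intro divide_nonneg_pos) auto
    then show ?thesis using False pseries_scaled_var[of "- A i j / A i i" i n] that by (simp add: Q_def)
  qed
  \<comment> \<open>The worst case is \<open>r i = 1\<close>, where the sum equals
    \<open>v i - 1 / A i i\<close>.\<close>
  have Qv: "(\<Sum>j<n. Q i j r * v j) < v i"
    if r: "\<And>i. i < n \<Longrightarrow> 0 \<le> r i" "\<And>i. i < n \<Longrightarrow> r i \<le> 1" and i: "i < n" for r i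
  proof -
    have "(\<Sum>j<n. Q i j r * v j) = (\<Sum>j\<in>{..<n} - {i}. r i * ((- A i j / A i i) * v j))"
      using i by (subst sum.remove[of _ i]) (auto simp: Q_def intro!: sum.cong)
    also have "\<dots> \<le> (\<Sum>j\<in>{..<n} - {i}. 1 * ((- A i j / A i i) * v j))"
    proof (rule sum_mono)
      fix j assume j: "j \<in> {..<n} - {i}"
      have "0 \<le> - A i j / A i i" using A[of i j] d[OF i] i j by (intro divide_nonneg_pos) auto
      then have "0 \<le> (- A i j / A i i) * v j" using v0[of j] j by (intro mult_nonneg_nonneg) auto
      then show "r i * ((- A i j / A i i) * v j) \<le> 1 * ((- A i j / A i i) * v j)"
        using r(2)[OF i] by (intro mult_right_mono) auto
    qed
    also have "\<dots> = (A i i * v i - 1) / A i i"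
      using split[OF i] by (simp add: sum_divide_distrib)
    also have "\<dots> < v i" using d[OF i] by (simp add: divide_less_eq mult.commute)
    finally show ?thesis .
  qed
  define G where "G = (\<lambda>r. one_minus_det n (\<lambda>i j. Q i j r))"
  have G: "\<And>r. \<forall>i<n. 0 \<le> r i \<and> r i \<le> 1 \<Longrightarrow> 0 < G r" "pseries n (\<lambda>r. G r powr (- \<alpha>))"
  proof -
    have "(\<forall>r. (\<forall>i<n. 0 \<le> r i \<and> r i \<le> 1) \<longrightarrow> 0 < G r) \<and> pseries n (\<lambda>r. G r powr (- \<alpha>))"
      unfolding G_def
    proof (rule det_powr_minus_pseries[where v = v, OF \<alpha>])
      fix r :: "nat \<Rightarrow> real" and i
      assume "\<And>i. i < n \<Longrightarrow> 0 \<le> r i" "\<And>i. i < n \<Longrightarrow> r i \<le> 1" "i < n"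
      then show "(\<Sum>j<n. Q i j r * v j) < v i" by (rule Qv)
    qed (fact Qp, fact v)
    then show "\<And>r. \<forall>i<n. 0 \<le> r i \<and> r i \<le> 1 \<Longrightarrow> 0 < G r" "pseries n (\<lambda>r. G r powr (- \<alpha>))"
      by blast+
  qed
  define kd where "kd = Determinant.det (Matrix.mat n n (\<lambda>(p, q). K p q))"
  define rr where "rr = (\<lambda>s i. A i i / (A i i + s i))"
  have rr: "0 \<le> rr s i" "rr s i \<le> 1" "0 < rr s i" if "\<forall>i<n. 0 \<le> s i" "i < n" for s i
  proof -
    have "0 < A i i" "0 \<le> s i" using d that by auto
    then show "0 \<le> rr s i" "rr s i \<le> 1" "0 < rr s i" by (simp_all add: rr_def)
  qed
  have det: "perm_det n K s =
      kd * ((\<Prod>i<n. A i i + s i) * G (rr s))" if s: "\<forall>i<n. 0 \<le> s i" for s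
  proof -
    let ?R = "Matrix.mat n n (\<lambda>(p, q). (A p p + s p) * ((if p = q then 1 else 0) - Q p q (rr s)))"
    have R: "(A p p + s p) * ((if p = q then 1 else 0) - Q p q (rr s)) = A p q + (if p = q then s q else 0)"
      if "p < n" "q < n" for p q
    proof -
      have "0 < A p p" "0 \<le> s p" using d s that by auto
      then show ?thesis by (auto simp: Q_def rr_def)
    qed
    have "1\<^sub>m n + Matrix.mat n n (\<lambda>(p, q). K p q) * mat_diag n s = Matrix.mat n n (\<lambda>(p, q). K p q) * ?R"
      unfolding one_plus_mult_diag
    proof (rule eq_matI)
      fix p q assume pq: "p < dim_row (Matrix.mat n n (\<lambda>(p, q). K p q) * ?R)"
        "q < dim_col (Matrix.mat n n (\<lambda>(p, q). K p q) * ?R)"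
      then have pq: "p < n" "q < n" by auto
      have "(Matrix.mat n n (\<lambda>(p, q). K p q) * ?R) $$ (p, q) =
          (\<Sum>k<n. K p k * ((A k k + s k) * ((if k = q then 1 else 0) - Q k q (rr s))))"
        using pq by (simp add: scalar_prod_def atLeast0LessThan)
      also have "\<dots> = (\<Sum>k<n. K p k * A k q + (if k = q then K p k * s q else 0))"
      proof (rule sum.cong[OF refl])
        fix k assume "k \<in> {..<n}"
        then show "K p k * ((A k k + s k) * ((if k = q then 1 else 0) - Q k q (rr s))) =
            K p k * A k q + (if k = q then K p k * s q else 0)"
          using pq by (subst R) (auto simp: distrib_left)
      qed
      also have "\<dots> = (if p = q then 1 else 0) + K p q * s q"
        using pq by (simp add: sum.distrib KA)
      finally show "Matrix.mat n n (\<lambda>(p, q). (if p = q then 1 else 0) + K p q * s q) $$ (p, q) =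
          (Matrix.mat n n (\<lambda>(p, q). K p q) * ?R) $$ (p, q)" using pq by simp
    qed auto
    then show ?thesis
      by (simp only: det_mult[OF mat_carrier mat_carrier] det_scale_rows kd_def G_def)
  qed
  \<comment> \<open>\<open>s = 0\<close> corresponds to \<open>r = 1\<close>, and there the
    permanental determinant is \<open>1\<close>. This expresses the unknown \<open>kd\<close>
    through \<open>G\<close> at \<open>1\<close>.\<close>
  have r0: "rr (\<lambda>_. 0) i = 1" if "i < n" for i using d[OF that] by (simp add: rr_def)
  have G1: "G (rr (\<lambda>_. 0)) = G (\<lambda>_. 1)"
    unfolding G_def Q_def by (rule arg_cong[where f = Determinant.det], rule eq_matI) (auto simp: r0)
  have Gpos: "0 < G (\<lambda>_. 1)" using G(1) by simp
  have "perm_det n K (\<lambda>_. 0 :: real) = 1"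
  proof -
    have "1\<^sub>m n + Matrix.mat n n (\<lambda>(p, q). K p q) * mat_diag n (\<lambda>_. 0 :: real) = 1\<^sub>m n"
      unfolding one_plus_mult_diag by (rule eq_matI) auto
    then show ?thesis by simp
  qed
  then have kd: "kd * ((\<Prod>i<n. A i i) * G (\<lambda>_. 1)) = 1" using det[of "\<lambda>_. 0"] G1 by simp
  have powr: "perm_det n K s powr (- \<alpha>) =
      (\<Prod>i<n. rr s i powr \<alpha>) * (G (rr s) powr (- \<alpha>) * G (\<lambda>_. 1) powr \<alpha>)" if s: "\<forall>i<n. 0 \<le> s i" for s
  proof -
    have Grr: "0 < G (rr s)" using rr[OF s] G(1) by auto
    have p: "0 < (\<Prod>i<n. rr s i)" using rr[OF s] by (intro prod_pos) auto
    have ne: "(\<Prod>i<n. A i i) \<noteq> 0" "(\<Prod>i<n. A i i + s i) \<noteq> 0" using d s by (force simp: add_nonneg_eq_0_iff)+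
    have "kd = 1 / ((\<Prod>i<n. A i i) * G (\<lambda>_. 1))" using kd ne Gpos by (simp add: field_simps)
    then have "kd * ((\<Prod>i<n. A i i + s i) * G (rr s)) = inverse (\<Prod>i<n. rr s i) * (G (rr s) / G (\<lambda>_. 1))"
      unfolding rr_def prod_dividef using ne by (simp add: field_simps)
    then have "(kd * ((\<Prod>i<n. A i i + s i) * G (rr s))) powr (- \<alpha>) =
        inverse (\<Prod>i<n. rr s i) powr (- \<alpha>) * (G (rr s) / G (\<lambda>_. 1)) powr (- \<alpha>)"
      using p Gpos Grr by (simp only:) (intro powr_mult; simp)
    also have "inverse (\<Prod>i<n. rr s i) powr (- \<alpha>) = (\<Prod>i<n. rr s i) powr \<alpha>"
      using p by (simp add: powr_minus inverse_powr)
    also have "\<dots> = (\<Prod>i<n. rr s i powr \<alpha>)" by (rule prod_powr_distrib)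
    also have "(G (rr s) / G (\<lambda>_. 1)) powr (- \<alpha>) = G (rr s) powr (- \<alpha>) * G (\<lambda>_. 1) powr \<alpha>"
      using Gpos Grr by (simp add: powr_mult inverse_powr powr_minus divide_inverse)
    finally show ?thesis unfolding det[OF s] .
  qed
  obtain c e where ce: "\<And>r. (\<forall>i<n. 0 \<le> r i \<and> r i \<le> 1) \<Longrightarrow>
       ennreal (G r powr (- \<alpha>)) = (\<Sum>k. c k * ennreal (\<Prod>i<n. r i ^ e k i))"
    using G(2) unfolding pseries_def by metis
  \<comment> \<open>At \<open>r = 1\<close> all monomials equal \<open>1\<close>, so the
    coefficients sum to \<open>G 1 powr (- \<alpha>)\<close>. Division by this sum turns them into
    probability weights.\<close>
  have "(\<Sum>k. c k * ennreal (G (\<lambda>_. 1) powr \<alpha>)) = (\<Sum>k. c k) * ennreal (G (\<lambda>_. 1) powr \<alpha>)"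
    by (rule ennreal_suminf_multc)
  also have "(\<Sum>k. c k) = ennreal (G (\<lambda>_. 1) powr (- \<alpha>))" using ce[of "\<lambda>_. 1"] by simp
  also have "\<dots> * ennreal (G (\<lambda>_. 1) powr \<alpha>) = 1"
    using Gpos by (simp add: powr_minus flip: ennreal_mult)
  finally have c1: "(\<Sum>k. c k * ennreal (G (\<lambda>_. 1) powr \<alpha>)) = 1" .
  show ?series
  proof (intro exI conjI allI impI)
    fix s :: "nat \<Rightarrow> real" assume s: "\<forall>i<n. 0 \<le> s i"
    have nn: "0 \<le> (\<Prod>i<n. rr s i powr \<alpha>)" by (intro prod_nonneg) auto
    have "ennreal (perm_det n K s powr (- \<alpha>)) =
        ennreal (\<Prod>i<n. rr s i powr \<alpha>) * (ennreal (G (rr s) powr (- \<alpha>)) * ennreal (G (\<lambda>_. 1) powr \<alpha>))"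
      unfolding powr[OF s] using nn by (simp add: ennreal_mult)
    also have "ennreal (\<Prod>i<n. rr s i powr \<alpha>) = (\<Prod>i<n. ennreal (rr s i powr \<alpha>))"
      by (rule prod_ennreal[symmetric]) auto
    also have "ennreal (G (rr s) powr (- \<alpha>)) * ennreal (G (\<lambda>_. 1) powr \<alpha>) =
        (\<Sum>k. c k * ennreal (\<Prod>i<n. rr s i ^ e k i) * ennreal (G (\<lambda>_. 1) powr \<alpha>))"
      using rr[OF s] by (subst ce) (auto simp: ennreal_suminf_multc)
    also have "\<dots> = (\<Sum>k. (c k * ennreal (G (\<lambda>_. 1) powr \<alpha>)) * ennreal (\<Prod>i<n. rr s i ^ e k i))"
      by (simp only: mult.assoc mult.commute[of _ "ennreal (G (\<lambda>_. 1) powr \<alpha>)"])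
    finally show "ennreal (perm_det n K s powr (- \<alpha>)) =
      (\<Prod>i<n. ennreal ((A i i / (A i i + s i)) powr \<alpha>)) *
      (\<Sum>k. (c k * ennreal (G (\<lambda>_. 1) powr \<alpha>)) * ennreal (\<Prod>i<n. (A i i / (A i i + s i)) ^ e k i))"
      unfolding rr_def .
  qed (fact c1)
qed

section \<open>Laplace transforms and gamma distributions\<close>

text \<open>Under \<open>w = exp (- x)\<close> the transforms at integers become the moments of a
  measure on the unit interval. By the Weierstrass theorem these determine the integrals of
  continuous functions, and hence the tails.\<close>

lemma laplace_transform_unique:
  fixes M N :: "real measure"
  assumes fin: "finite_measure M" "finite_measure N"
    and sets: "sets M = sets borel" "sets N = sets borel"
    and nonneg: "AE x in M. 0 \<le> x" "AE x in N. 0 \<le> x"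
    and eq: "\<And>s. 0 < s \<Longrightarrow> (\<integral>\<^sup>+x. ennreal (exp (- (s * x))) \<partial>M) = (\<integral>\<^sup>+x. ennreal (exp (- (s * x))) \<partial>N)"
  shows "M = N"
proof -
  interpret M: finite_measure M by fact
  interpret N: finite_measure N by fact
  note [measurable_cong] = sets
  have int: "integrable M' (\<lambda>x. f (exp (- x)))"
    if M': "finite_measure M'" "sets M' = sets borel" "AE x in M'. 0 \<le> x"
      and f: "f \<in> borel_measurable borel" "\<And>w. 0 \<le> w \<Longrightarrow> w \<le> 1 \<Longrightarrow> \<bar>f w\<bar> \<le> C"
    for M' :: "real measure" and f :: "real \<Rightarrow> real" and C
  proof -
    interpret M': finite_measure M' by fact
    note [measurable_cong] = M'(2) and [measurable] = f(1)
    show ?thesis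
    proof (rule M'.integrable_const_bound)
      show "AE x in M'. norm (f (exp (- x))) \<le> C" using M'(3) by eventually_elim (auto intro!: f(2))
    qed simp
  qed
  have intp: "integrable M' (\<lambda>x. exp (- x) ^ k)"
    if M': "finite_measure M'" "sets M' = sets borel" "AE x in M'. 0 \<le> x" for M' :: "real measure" and k :: nat
    using int[OF M', of "\<lambda>w. w ^ k" 1] by (auto simp: power_le_one power_abs)
  have eqs: "(LINT x|M. exp (- x) ^ k) = (LINT x|N. exp (- x) ^ k)" if "0 < k" for k :: nat
  proof -
    have *: "(LINT x|M'. exp (- x) ^ k) = enn2real (\<integral>\<^sup>+x. ennreal (exp (- (real k * x))) \<partial>M')"
      if [measurable_cong]: "sets M' = sets borel" for M' :: "real measure"
    proof -
      have "exp (- x) ^ k = exp (- (real k * x))" for x :: real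
        by (simp add: exp_of_nat_mult[symmetric])
      then show ?thesis
        by (subst integral_eq_nn_integral) auto
    qed
    show ?thesis unfolding *[OF sets(1)] *[OF sets(2)] using eq[of "real k"] that by simp
  qed
  \<comment> \<open>The hypothesis excludes \<open>s = 0\<close>, so the total mass, which is the
    moment of order zero, is recovered as a limit along \<open>s = 1 / (n + 1)\<close>.\<close>
  have lim0: "(\<lambda>n. LINT x|M'. exp (- (x / (real n + 1)))) \<longlonglongrightarrow> (LINT x|M'. 1)"
    if M': "finite_measure M'" "sets M' = sets borel" "AE x in M'. 0 \<le> x" for M' :: "real measure"
  proof (rule integral_dominated_convergence[where w = "\<lambda>_. 1"])
    interpret M': finite_measure M' by fact
    note [measurable_cong] = M'(2)
    show "integrable M' (\<lambda>_. 1 :: real)" by simp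
    show "AE x in M'. (\<lambda>n. exp (- (x / (real n + 1)))) \<longlonglongrightarrow> 1"
    proof (rule AE_I2)
      fix x :: real
      have "(\<lambda>n. x / (real n + 1)) \<longlonglongrightarrow> 0" by real_asymp
      then have "(\<lambda>n. exp (- (x / (real n + 1)))) \<longlonglongrightarrow> exp (- 0)" by (intro tendsto_intros)
      then show "(\<lambda>n. exp (- (x / (real n + 1)))) \<longlonglongrightarrow> 1" by simp
    qed
    show "AE x in M'. norm (exp (- (x / (real n + 1)))) \<le> 1" for n
      using M'(3) by eventually_elim simp
  qed (use that in auto)
  have eq0: "(LINT x|M. 1 :: real) = (LINT x|N. 1)"
  proof (rule LIMSEQ_unique[OF lim0[OF fin(1) sets(1) nonneg(1)]])
    have *: "(LINT x|M'. exp (- (x / (real n + 1)))) = enn2real (\<integral>\<^sup>+x. ennreal (exp (- (1 / (real n + 1) * x))) \<partial>M')"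
      if [measurable_cong]: "sets M' = sets borel" for n and M' :: "real measure"
      by (subst integral_eq_nn_integral) auto
    have "(LINT x|M. exp (- (x / (real n + 1)))) = (LINT x|N. exp (- (x / (real n + 1))))" for n
      unfolding *[OF sets(1)] *[OF sets(2)] using eq[of "1 / (real n + 1)"] by simp
    then show "(\<lambda>n. LINT x|M. exp (- (x / (real n + 1)))) \<longlonglongrightarrow> (LINT x|N. 1)"
      using lim0[OF fin(2) sets(2) nonneg(2)] by simp
  qed
  have eqp: "(LINT x|M. exp (- x) ^ k) = (LINT x|N. exp (- x) ^ k)" for k :: nat
    using eqs[of k] eq0 by (cases "k = 0") auto
  have poly: "(LINT x|M. g (exp (- x))) = (LINT x|N. g (exp (- x)))" if rp: "real_polynomial_function g" for g
  proof -
    obtain a n where g: "g = (\<lambda>x. \<Sum>i\<le>n. a i * x ^ i)"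
      using rp real_polynomial_function_iff_sum[of g] by blast
    have "(LINT x|M'. g (exp (- x))) = (\<Sum>i\<le>n. a i * (LINT x|M'. exp (- x) ^ i))"
      if M': "finite_measure M'" "sets M' = sets borel" "AE x in M'. 0 \<le> x" for M' :: "real measure"
      unfolding g using intp[OF M'] by (subst Bochner_Integration.integral_sum) auto
    then show ?thesis using fin sets nonneg eqp by simp
  qed
  have cont: "(LINT x|M. \<phi> (exp (- x))) = (LINT x|N. \<phi> (exp (- x)))"
    if \<phi>: "continuous_on UNIV \<phi>" for \<phi> :: "real \<Rightarrow> real"
  proof (rule ccontr)
    assume ne: "(LINT x|M. \<phi> (exp (- x))) \<noteq> (LINT x|N. \<phi> (exp (- x)))"
    define e where "e = \<bar>(LINT x|M. \<phi> (exp (- x))) - (LINT x|N. \<phi> (exp (- x)))\<bar>"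
    \<comment> \<open>The errors for the two measures add up to \<open>e / m * (m - 1)\<close>. The
      summand \<open>1\<close> in \<open>m\<close> makes this strictly smaller than
      \<open>e\<close>.\<close>
    define m where "m = measure M (space M) + measure N (space N) + 1"
    have m: "0 < m" unfolding m_def by (intro add_nonneg_pos add_nonneg_nonneg) auto
    have e: "0 < e" using ne unfolding e_def by simp
    have "continuous_on {0..1} \<phi>" using \<phi> continuous_on_subset by blast
    then obtain g where g: "real_polynomial_function g" "\<And>w. w \<in> {0..1} \<Longrightarrow> \<bar>\<phi> w - g w\<bar> < e / m"
      using Stone_Weierstrass_real_polynomial_function[of "{0..1}" \<phi> "e / m"] e m by auto
    have [measurable]: "\<phi> \<in> borel_measurable borel" using \<phi> by (rule borel_measurable_continuous_onI)
    have cg: "continuous_on UNIV g"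
      using g(1) by (simp add: continuous_on_polymonial_function real_polynomial_function_eq)
    then have [measurable]: "g \<in> borel_measurable borel" by (rule borel_measurable_continuous_onI)
    have near: "\<bar>(LINT x|M'. \<phi> (exp (- x))) - (LINT x|M'. g (exp (- x)))\<bar> \<le> e / m * measure M' (space M')"
      if M': "finite_measure M'" "sets M' = sets borel" "AE x in M'. 0 \<le> x" for M' :: "real measure"
    proof -
      interpret M': finite_measure M' by fact
      note [measurable_cong] = M'(2)
      have bnd: "\<exists>C. \<forall>w. 0 \<le> w \<longrightarrow> w \<le> 1 \<longrightarrow> \<bar>h w\<bar> \<le> C" if "continuous_on UNIV h" for h :: "real \<Rightarrow> real"
      proof -
        have "compact (h ` {0..1})"
          by (rule compact_continuous_image[OF continuous_on_subset[OF that]]) auto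
        then have "bounded (h ` {0..1})" by (rule compact_imp_bounded)
        then obtain a where "\<forall>w\<in>{0..1}. \<bar>h w\<bar> \<le> a" by (auto simp: bounded_iff)
        then show ?thesis by (intro exI[of _ a]) auto
      qed
      obtain C1 where "\<And>w. 0 \<le> w \<Longrightarrow> w \<le> 1 \<Longrightarrow> \<bar>\<phi> w\<bar> \<le> C1" using bnd[OF \<phi>] by blast
      then have i1: "integrable M' (\<lambda>x. \<phi> (exp (- x)))" by (intro int[OF M']) auto
      obtain C2 where "\<And>w. 0 \<le> w \<Longrightarrow> w \<le> 1 \<Longrightarrow> \<bar>g w\<bar> \<le> C2" using bnd[OF cg] by blast
      then have i2: "integrable M' (\<lambda>x. g (exp (- x)))" by (intro int[OF M']) auto
      have "\<bar>(LINT x|M'. \<phi> (exp (- x)) - g (exp (- x)))\<bar> \<le> (LINT x|M'. \<bar>\<phi> (exp (- x)) - g (exp (- x))\<bar>)"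
        by (rule integral_abs_bound)
      also have "\<dots> \<le> (LINT x|M'. e / m)"
      proof (rule integral_mono_AE)
        show "AE x in M'. \<bar>\<phi> (exp (- x)) - g (exp (- x))\<bar> \<le> e / m"
          using M'(3) by eventually_elim (auto intro!: less_imp_le g(2))
      qed (use i1 i2 in auto)
      finally show ?thesis using i1 i2 by (simp add: mult.commute)
    qed
    have "e \<le> e / m * measure M (space M) + e / m * measure N (space N)"
      using near[OF fin(1) sets(1) nonneg(1)] near[OF fin(2) sets(2) nonneg(2)] poly[OF g(1)]
      unfolding e_def by linarith
    also have "\<dots> = e / m * (m - 1)"
      unfolding distrib_left[symmetric] by (simp add: m_def)
    also have "\<dots> = e - e / m" using m by (simp add: field_simps)
    finally show False using e m by (simp add: field_simps)
  qed
  have meas: "measure M {c<..} = measure N {c<..}" for c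
  proof -
    \<comment> \<open>Continuous approximations of the indicator of \<open>w < exp (- c)\<close>,
      which is the event \<open>c < x\<close> in the original variable.\<close>
    define \<phi> where "\<phi> = (\<lambda>n w. min 1 (max 0 (real n * (exp (- c) - w))))"
    have lim: "(\<lambda>n. LINT x|M'. \<phi> n (exp (- x))) \<longlonglongrightarrow> measure M' {c<..}"
      if M': "finite_measure M'" "sets M' = sets borel" for M' :: "real measure"
    proof -
      interpret M': finite_measure M' by fact
      note [measurable_cong] = M'(2)
      have "(\<lambda>n. LINT x|M'. \<phi> n (exp (- x))) \<longlonglongrightarrow> (LINT x|M'. indicator {c<..} x)"
      proof (rule integral_dominated_convergence[where w = "\<lambda>_. 1"])
        show "AE x in M'. (\<lambda>n. \<phi> n (exp (- x))) \<longlonglongrightarrow> indicator {c<..} x"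
        proof (rule AE_I2)
          fix x :: real
          show "(\<lambda>n. \<phi> n (exp (- x))) \<longlonglongrightarrow> indicator {c<..} x"
          proof (cases "c < x")
            case True
            then have p: "0 < exp (- c) - exp (- x)" by simp
            then obtain n0 where n0: "1 < real n0 * (exp (- c) - exp (- x))" using reals_Archimedean3 by blast
            have "\<phi> n (exp (- x)) = 1" if "n0 \<le> n" for n
            proof -
              have "real n0 * (exp (- c) - exp (- x)) \<le> real n * (exp (- c) - exp (- x))"
                using that p by (intro mult_right_mono) auto
              then show ?thesis using n0 unfolding \<phi>_def by simp
            qed
            then have "eventually (\<lambda>n. \<phi> n (exp (- x)) = 1) sequentially"
              unfolding eventually_sequentially by blast
            then show ?thesis using True by (simp add: tendsto_eventually)
          next
            case False
            then have "real n * (exp (- c) - exp (- x)) \<le> 0" for n by (intro mult_nonneg_nonpos) auto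
            then have "\<phi> n (exp (- x)) = 0" for n unfolding \<phi>_def by (simp add: max_absorb1)
            then show ?thesis using False by simp
          qed
        qed
      qed (auto simp: \<phi>_def)
      then show ?thesis using M'(2) sets_eq_imp_space_eq[OF M'(2)] by simp
    qed
    have "(LINT x|M. \<phi> n (exp (- x))) = (LINT x|N. \<phi> n (exp (- x)))" for n
      unfolding \<phi>_def by (rule cont) (intro continuous_intros)
    then have "(\<lambda>n. LINT x|M. \<phi> n (exp (- x))) \<longlonglongrightarrow> measure N {c<..}"
      using lim[OF fin(2) sets(2)] by simp
    with lim[OF fin(1) sets(1)] show ?thesis by (rule LIMSEQ_unique)
  qed
  show "M = N"
    by (rule measure_eqI_lessThan[OF sets]) (auto simp: M.emeasure_eq_measure N.emeasure_eq_measure meas)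
qed

text \<open>The coordinates are treated one at a time. With the other exponentials absorbed into a
  density, the one-dimensional result lets the exponential of coordinate \<open>j\<close> be
  replaced by an indicator. The weights \<open>w\<close> and \<open>w'\<close> carry the indicators
  obtained so far and must therefore be general in the induction.\<close>

lemma joint_laplace_transform_unique:
  fixes X :: "'i \<Rightarrow> 'a \<Rightarrow> real" and Y :: "'i \<Rightarrow> 'b \<Rightarrow> real"
  assumes "finite J"
    and "\<And>i. i \<in> J \<Longrightarrow> X i \<in> borel_measurable M" "\<And>i. i \<in> J \<Longrightarrow> Y i \<in> borel_measurable N"
    and "\<And>i. i \<in> J \<Longrightarrow> AE x in M. 0 \<le> X i x" "\<And>i. i \<in> J \<Longrightarrow> AE x in N. 0 \<le> Y i x"
    and "w \<in> borel_measurable M" "w' \<in> borel_measurable N"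
    and "(\<integral>\<^sup>+x. w x \<partial>M) < \<infinity>" "(\<integral>\<^sup>+x. w' x \<partial>N) < \<infinity>"
    and "\<And>s. (\<And>i. i \<in> J \<Longrightarrow> 0 < s i) \<Longrightarrow>
      (\<integral>\<^sup>+x. w x * (\<Prod>i\<in>J. ennreal (exp (- (s i * X i x)))) \<partial>M) =
      (\<integral>\<^sup>+x. w' x * (\<Prod>i\<in>J. ennreal (exp (- (s i * Y i x)))) \<partial>N)"
    and "\<And>i. i \<in> J \<Longrightarrow> B i \<in> sets borel"
  shows "(\<integral>\<^sup>+x. w x * (\<Prod>i\<in>J. indicator (B i) (X i x)) \<partial>M) =
      (\<integral>\<^sup>+x. w' x * (\<Prod>i\<in>J. indicator (B i) (Y i x)) \<partial>N)"
  using assms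
proof (induction J arbitrary: w w' rule: finite_induct)
  case empty
  then show ?case by simp
next
  case (insert j J)
  note [measurable] = insert.prems(1,2)
  have [measurable]: "w \<in> borel_measurable M" "w' \<in> borel_measurable N" using insert.prems by auto
  have [measurable]: "B i \<in> sets borel" if "i \<in> insert j J" for i using insert.prems that by auto
  have le1: "(\<Prod>i\<in>J. ennreal (exp (- (s i * Z i x)))) \<le> 1" if "\<And>i. i \<in> J \<Longrightarrow> 0 < s i" "\<forall>i\<in>J. 0 \<le> Z i x"
    for s :: "'i \<Rightarrow> real" and Z :: "'i \<Rightarrow> 'c \<Rightarrow> real" and x
    using that by (intro prod_le_1) (auto intro!: mult_nonneg_nonneg less_imp_le simp: less_imp_le)
  have key: "(\<integral>\<^sup>+x. (w x * indicator (B j) (X j x)) * (\<Prod>i\<in>J. ennreal (exp (- (s i * X i x)))) \<partial>M) =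
      (\<integral>\<^sup>+x. (w' x * indicator (B j) (Y j x)) * (\<Prod>i\<in>J. ennreal (exp (- (s i * Y i x)))) \<partial>N)"
    if s: "\<And>i. i \<in> J \<Longrightarrow> 0 < s i" for s
  proof -
    let ?f = "\<lambda>x. w x * (\<Prod>i\<in>J. ennreal (exp (- (s i * X i x))))"
    let ?g = "\<lambda>x. w' x * (\<Prod>i\<in>J. ennreal (exp (- (s i * Y i x))))"
    have [measurable]: "?f \<in> borel_measurable M" "?g \<in> borel_measurable N" by measurable
    let ?M = "distr (density M ?f) borel (X j)" and ?N = "distr (density N ?g) borel (Y j)"
    have "?M = ?N"
    proof (rule laplace_transform_unique)
      have "AE x in M. \<forall>i\<in>J. 0 \<le> X i x"
        using insert.prems(3) insert.hyps(1) by (auto simp: AE_finite_all)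
      then have "(\<integral>\<^sup>+x. ?f x \<partial>M) \<le> (\<integral>\<^sup>+x. w x \<partial>M)"
        using le1[OF s] by (intro nn_integral_mono_AE) (auto elim!: eventually_mono intro!: mult_left_le)
      then show "finite_measure ?M" using insert.prems(7)
        by (intro finite_measureI) (auto simp: emeasure_distr emeasure_density less_top)
      have "AE x in N. \<forall>i\<in>J. 0 \<le> Y i x"
        using insert.prems(4) insert.hyps(1) by (auto simp: AE_finite_all)
      then have "(\<integral>\<^sup>+x. ?g x \<partial>N) \<le> (\<integral>\<^sup>+x. w' x \<partial>N)"
        using le1[OF s] by (intro nn_integral_mono_AE) (auto elim!: eventually_mono intro!: mult_left_le)
      then show "finite_measure ?N" using insert.prems(8)
        by (intro finite_measureI) (auto simp: emeasure_distr emeasure_density less_top)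
      show "AE x in ?M. 0 \<le> x" using insert.prems(3)[of j]
        by (subst AE_distr_iff) (auto simp: AE_density elim!: eventually_mono)
      show "AE x in ?N. 0 \<le> x" using insert.prems(4)[of j]
        by (subst AE_distr_iff) (auto simp: AE_density elim!: eventually_mono)
      fix t :: real assume t: "0 < t"
      have *: "(\<Prod>i\<in>insert j J. ennreal (exp (- ((s(j := t)) i * Z i x)))) =
          ennreal (exp (- (t * Z j x))) * (\<Prod>i\<in>J. ennreal (exp (- (s i * Z i x))))"
        for Z :: "'i \<Rightarrow> 'c \<Rightarrow> real" and x
        using insert.hyps by (auto intro!: arg_cong2[where f = "(*)"] prod.cong)
      have **: "(\<Prod>i\<in>insert j J. ennreal (exp (- ((s(j := t)) i * Z i x)))) =
          ennreal (exp (- (t * Z j x))) * (\<Prod>i\<in>J. ennreal (exp (- (s i * Z i x))))"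
        for Z :: "'i \<Rightarrow> 'd \<Rightarrow> real" and x
        using insert.hyps by (auto intro!: arg_cong2[where f = "(*)"] prod.cong)
      have "(\<integral>\<^sup>+x. w x * (\<Prod>i\<in>insert j J. ennreal (exp (- ((s(j := t)) i * X i x)))) \<partial>M) =
        (\<integral>\<^sup>+x. w' x * (\<Prod>i\<in>insert j J. ennreal (exp (- ((s(j := t)) i * Y i x)))) \<partial>N)"
        using s t by (intro insert.prems(9)) auto
      then show "(\<integral>\<^sup>+x. ennreal (exp (- (t * x))) \<partial>?M) = (\<integral>\<^sup>+x. ennreal (exp (- (t * x))) \<partial>?N)"
        by (simp only: * ** ) (simp add: nn_integral_distr nn_integral_density ac_simps)
    qed auto
    then have "emeasure ?M (B j) = emeasure ?N (B j)" by simp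
    then show ?thesis
      by (simp add: emeasure_distr emeasure_density ac_simps)
        (simp add: indicator_def vimage_def ac_simps cong: nn_integral_cong_simp)
  qed
  have "(\<integral>\<^sup>+x. (w x * indicator (B j) (X j x)) * (\<Prod>i\<in>J. indicator (B i) (X i x)) \<partial>M) =
      (\<integral>\<^sup>+x. (w' x * indicator (B j) (Y j x)) * (\<Prod>i\<in>J. indicator (B i) (Y i x)) \<partial>N)"
  proof (rule insert.IH)
    have "(\<integral>\<^sup>+x. w x * indicator (B j) (X j x) \<partial>M) \<le> (\<integral>\<^sup>+x. w x \<partial>M)"
      by (intro nn_integral_mono) (auto simp: indicator_def)
    then show "(\<integral>\<^sup>+x. w x * indicator (B j) (X j x) \<partial>M) < \<infinity>" using insert.prems(7) by (rule le_less_trans)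
    have "(\<integral>\<^sup>+x. w' x * indicator (B j) (Y j x) \<partial>N) \<le> (\<integral>\<^sup>+x. w' x \<partial>N)"
      by (intro nn_integral_mono) (auto simp: indicator_def)
    then show "(\<integral>\<^sup>+x. w' x * indicator (B j) (Y j x) \<partial>N) < \<infinity>" using insert.prems(8) by (rule le_less_trans)
  qed (use insert.prems key in auto)
  then show ?case using insert.hyps by (simp add: ac_simps)
qed

section \<open>Gamma distributions with real shape \<open>a\<close> and rate
  \<open>d\<close>\<close>

definition gamma_distr :: "real \<Rightarrow> real \<Rightarrow> real measure" where
  "gamma_distr a d = density lborel
    (\<lambda>x. ennreal (indicator {0..} x * (d powr a / Gamma a * (x powr (a - 1) * exp (- (d * x))))))"

lemma sets_gamma_distr[simp, measurable_cong]: "sets (gamma_distr a d) = sets borel"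
  by (simp add: gamma_distr_def)

lemma space_gamma_distr[simp]: "space (gamma_distr a d) = UNIV"
  by (simp add: gamma_distr_def)

lemma nn_integral_gamma_kernel:
  assumes a: "0 < a" and c: "0 < c"
  shows "(\<integral>\<^sup>+x. ennreal (indicator {0..} x * (x powr (a - 1) * exp (- (c * x)))) \<partial>lborel) =
    ennreal (Gamma a / c powr a)"
proof -
  have "(\<integral>\<^sup>+x. ennreal (indicator {0..} x * (x powr (a - 1) * exp (- (c * x)))) \<partial>lborel) =
      (\<integral>\<^sup>+x. ennreal (1 / c powr (a - 1)) * ennreal (indicator {0..} (c * x) * (c * x) powr (a - 1) / exp (c * x)) \<partial>lborel)"
  proof (rule nn_integral_cong)
    fix x :: real
    have "indicator {0..} x * (x powr (a - 1) * exp (- (c * x))) =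
       1 / c powr (a - 1) * (indicator {0..} (c * x) * (c * x) powr (a - 1) / exp (c * x))"
      using c by (cases "0 \<le> x") (auto simp: powr_mult exp_minus divide_simps zero_le_mult_iff)
    then show "ennreal (indicator {0..} x * (x powr (a - 1) * exp (- (c * x)))) =
       ennreal (1 / c powr (a - 1)) * ennreal (indicator {0..} (c * x) * (c * x) powr (a - 1) / exp (c * x))"
      by (subst ennreal_mult[symmetric]) auto
  qed
  also have "\<dots> = ennreal (1 / c powr (a - 1)) *
      (\<integral>\<^sup>+x. ennreal (indicator {0..} (c * x) * (c * x) powr (a - 1) / exp (c * x)) \<partial>lborel)"
    by (rule nn_integral_cmult) auto
  also have "ennreal (Gamma a) = c * (\<integral>\<^sup>+x. ennreal (indicator {0..} (c * x) * (c * x) powr (a - 1) / exp (c * x)) \<partial>lborel)"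
    unfolding Gamma_conv_nn_integral_real[OF a] using c
    by (subst nn_integral_real_affine[where c = c and t = 0]) auto
  then have "(\<integral>\<^sup>+x. ennreal (indicator {0..} (c * x) * (c * x) powr (a - 1) / exp (c * x)) \<partial>lborel) = ennreal (Gamma a / c)"
    using c a by (simp add: divide_ennreal[symmetric] Gamma_real_pos less_imp_le ennreal_mult_divide_eq mult.commute[of "ennreal c"])
  also have "ennreal (1 / c powr (a - 1)) * ennreal (Gamma a / c) = ennreal (Gamma a / c powr a)"
    using c by (subst ennreal_mult[symmetric]) (auto simp: Gamma_real_pos a less_imp_le powr_diff)
  finally show ?thesis .
qed

text \<open>Negative \<open>s\<close> above \<open>- d\<close> are included because exponential
  moments are needed for the upper tail bound.\<close>

lemma gamma_distr_laplace:
  assumes a: "0 < a" and d: "0 < d" and s: "- d < s"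
  shows "(\<integral>\<^sup>+x. ennreal (exp (- (s * x))) \<partial>gamma_distr a d) = ennreal ((d / (d + s)) powr a)"
proof -
  have G: "0 < Gamma a" using a by (rule Gamma_real_pos)
  have "(\<integral>\<^sup>+x. ennreal (exp (- (s * x))) \<partial>gamma_distr a d) =
      (\<integral>\<^sup>+x. ennreal (d powr a / Gamma a) * ennreal (indicator {0..} x * (x powr (a - 1) * exp (- ((d + s) * x)))) \<partial>lborel)"
    unfolding gamma_distr_def using G
    by (subst nn_integral_density)
      (auto simp: ennreal_mult[symmetric] algebra_simps exp_add[symmetric] indicator_def intro!: nn_integral_cong)
  also have "\<dots> = ennreal (d powr a / Gamma a) * ennreal (Gamma a / (d + s) powr a)"
    using a s by (subst nn_integral_cmult) (auto simp: nn_integral_gamma_kernel)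
  also have "\<dots> = ennreal ((d / (d + s)) powr a)"
    using G d s by (subst ennreal_mult[symmetric]) (auto simp: powr_divide)
  finally show ?thesis .
qed

lemma prob_space_gamma_distr:
  assumes "0 < a" "0 < d" shows "prob_space (gamma_distr a d)"
proof
  show "emeasure (gamma_distr a d) (space (gamma_distr a d)) = 1"
    using gamma_distr_laplace[OF assms, of 0] assms by simp
qed

lemma AE_gamma_distr_nonneg: "AE x in gamma_distr a d. 0 \<le> x"
  unfolding gamma_distr_def by (subst AE_density) (auto split: split_indicator_asm)

text \<open>The density of shape \<open>a + 1\<close> is \<open>d * x / a\<close> times that of
  shape \<open>a\<close>, so the two cross only at \<open>a / d\<close>. If \<open>c\<close> lies to
  the left, the densities are compared below \<open>c\<close>; otherwise they are compared above
  \<open>c\<close> and complements are taken.\<close>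

lemma gamma_distr_atMost_shape_Suc:
  assumes a: "0 < a" and d: "0 < d"
  shows "emeasure (gamma_distr (a + 1) d) {..c} \<le> emeasure (gamma_distr a d) {..c}"
proof -
  define g where "g = (\<lambda>a x. indicator {0..} x * (d powr a / Gamma a * (x powr (a - 1) * exp (- (d * x)))))"
  have [measurable]: "g a \<in> borel_measurable borel" for a unfolding g_def by measurable
  have em: "emeasure (gamma_distr a d) A = (\<integral>\<^sup>+x. ennreal (g a x) * indicator A x \<partial>lborel)" if "A \<in> sets borel" for A a
    unfolding gamma_distr_def g_def using that by (subst emeasure_density) auto
  have G: "0 < Gamma a" using a by (rule Gamma_real_pos)
  have step: "g (a + 1) x = g a x * (d * x / a)" for x
  proof (cases "0 < x")
    case True
    have "x powr a = x powr (a - 1) * x" using True by (simp add: powr_diff)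
    moreover have "d powr (a + 1) = d powr a * d" using d by (simp add: powr_add)
    moreover have "a \<notin> \<int>\<^sub>\<le>\<^sub>0" using a by (auto elim!: nonpos_Ints_cases)
    then have "Gamma (a + 1) = a * Gamma a" by (rule Gamma_plus1)
    ultimately show ?thesis unfolding g_def using a G by (simp add: field_simps)
  next
    case False
    then show ?thesis using a unfolding g_def by (cases "x = 0") auto
  qed
  have gnn: "0 \<le> g a x" for x unfolding g_def using G by (simp add: indicator_def)
  show ?thesis
  proof (cases "c \<le> a / d")
    case True
    show ?thesis unfolding em[OF atMost_borel]
    proof (rule nn_integral_mono)
      fix x :: real
      show "ennreal (g (a + 1) x) * indicator {..c} x \<le> ennreal (g a x) * indicator {..c} x"
      proof (cases "x \<le> c")
        case xc: True
        then have "x \<le> a / d" using True by simp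
        then have "d * x / a \<le> 1" using a d by (simp add: field_simps)
        then have "g (a + 1) x \<le> g a x" unfolding step using gnn[of x] mult_left_mono[of _ 1] by fastforce
        then show ?thesis by (auto intro!: mult_right_mono ennreal_leI)
      qed simp
    qed
  next
    case False
    interpret A: prob_space "gamma_distr a d" using a d by (rule prob_space_gamma_distr)
    interpret B: prob_space "gamma_distr (a + 1) d" using a d by (intro prob_space_gamma_distr) auto
    have "emeasure (gamma_distr a d) {c<..} \<le> emeasure (gamma_distr (a + 1) d) {c<..}"
      unfolding em[OF greaterThan_borel]
    proof (rule nn_integral_mono)
      fix x :: real
      show "ennreal (g a x) * indicator {c<..} x \<le> ennreal (g (a + 1) x) * indicator {c<..} x"
      proof (cases "c < x")
        case xc: True
        then have "a / d \<le> x" using False by simp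
        then have "1 \<le> d * x / a" using a d by (simp add: field_simps)
        then have "g a x \<le> g (a + 1) x" unfolding step using gnn[of x] mult_left_mono[of 1] by fastforce
        then show ?thesis by (auto intro!: mult_right_mono ennreal_leI)
      qed simp
    qed
    then have le: "A.prob {c<..} \<le> B.prob {c<..}"
      by (simp add: A.emeasure_eq_measure B.emeasure_eq_measure)
    have "{..c} = space (gamma_distr a d) - {c<..}" "{..c} = space (gamma_distr (a + 1) d) - {c<..}" by auto
    then have "A.prob {..c} = 1 - A.prob {c<..}" "B.prob {..c} = 1 - B.prob {c<..}"
      using A.prob_compl[of "{c<..}"] B.prob_compl[of "{c<..}"] by auto
    then show ?thesis using le by (simp add: A.emeasure_eq_measure B.emeasure_eq_measure)
  qed
qed

lemma gamma_distr_atMost_shape: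
  assumes a: "0 < a" and d: "0 < d"
  shows "emeasure (gamma_distr (a + real k) d) {..c} \<le> emeasure (gamma_distr a d) {..c}"
proof (induction k)
  case (Suc k)
  have "emeasure (gamma_distr (a + real k + 1) d) {..c} \<le> emeasure (gamma_distr (a + real k) d) {..c}"
    using a d by (intro gamma_distr_atMost_shape_Suc) auto
  then show ?case using Suc by (simp add: ac_simps)
qed simp

lemma gamma_distr_scale:
  assumes a: "0 < a" and d: "0 < d"
  shows "gamma_distr a d = distr (gamma_distr a 1) borel (\<lambda>x. x / d)"
proof (rule laplace_transform_unique)
  interpret A: prob_space "gamma_distr a d" using a d by (rule prob_space_gamma_distr)
  interpret B: prob_space "gamma_distr a 1" using a by (rule prob_space_gamma_distr) simp
  show "finite_measure (gamma_distr a d)" by (rule A.finite_measure_axioms)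
  interpret C: prob_space "distr (gamma_distr a 1) borel (\<lambda>x. x / d)" by (rule B.prob_space_distr) simp
  show "finite_measure (distr (gamma_distr a 1) borel (\<lambda>x. x / d))" by (rule C.finite_measure_axioms)
  show "AE x in gamma_distr a d. 0 \<le> x" by (rule AE_gamma_distr_nonneg)
  show "AE x in distr (gamma_distr a 1) borel (\<lambda>x. x / d). 0 \<le> x"
    using AE_gamma_distr_nonneg[of a 1] d
    by (subst AE_distr_iff) (auto elim!: eventually_mono)
  fix s :: real assume s: "0 < s"
  have "(\<integral>\<^sup>+x. ennreal (exp (- (s * x))) \<partial>distr (gamma_distr a 1) borel (\<lambda>x. x / d)) =
      (\<integral>\<^sup>+x. ennreal (exp (- (s / d * x))) \<partial>gamma_distr a 1)"
    by (subst nn_integral_distr) auto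
  also have "\<dots> = ennreal ((1 / (1 + s / d)) powr a)"
    using a d s less_trans[of "- 1" 0 "s / d"] by (subst gamma_distr_laplace) auto
  also have "1 / (1 + s / d) = d / (d + s)" using d s by (simp add: field_simps)
  also have "ennreal ((d / (d + s)) powr a) = (\<integral>\<^sup>+x. ennreal (exp (- (s * x))) \<partial>gamma_distr a d)"
    using a d s by (subst gamma_distr_laplace) auto
  finally show "(\<integral>\<^sup>+x. ennreal (exp (- (s * x))) \<partial>gamma_distr a d) =
      (\<integral>\<^sup>+x. ennreal (exp (- (s * x))) \<partial>distr (gamma_distr a 1) borel (\<lambda>x. x / d))" by simp
qed auto

text \<open>Moving the rate into the argument reduces the comparison of different rates to the
  monotonicity of one distribution function.\<close>

lemma gamma_distr_atMost_rate:
  assumes "0 < a" "0 < d"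
  shows "emeasure (gamma_distr a d) {..c} = emeasure (gamma_distr a 1) {..d * c}"
proof -
  have "(\<lambda>x. x / d) -` {..c} = {..d * c}" using assms by (auto simp: field_simps)
  then show ?thesis by (subst gamma_distr_scale[OF assms]) (simp add: emeasure_distr)
qed

text \<open>Only the mass of the interval from \<open>x\<close> to \<open>x + 1\<close> is counted,
  with \<open>t powr (a - 1)\<close> bounded below by \<open>1 / t\<close>. The loss is polynomial
  in \<open>x\<close>, whereas the later use depends only on the exponential rate.\<close>

lemma gamma_distr_tail_ge:
  assumes a: "0 < a" and x: "1 \<le> x"
  shows "exp (- (x + 1)) / ((x + 1) * Gamma a) \<le> measure (gamma_distr a 1) {x<..}"
proof -
  interpret prob_space "gamma_distr a 1" using a by (rule prob_space_gamma_distr) simp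
  have G: "0 < Gamma a" using a by (rule Gamma_real_pos)
  let ?K = "exp (- (x + 1)) / ((x + 1) * Gamma a)"
  have K: "0 \<le> ?K" using G x by simp
  have "ennreal ?K = (\<integral>\<^sup>+t. ennreal ?K * indicator {x<..x + 1} t \<partial>lborel)"
    by (subst nn_integral_cmult_indicator) auto
  also have "\<dots> \<le> (\<integral>\<^sup>+t. ennreal (indicator {0..} t * (1 powr a / Gamma a * (t powr (a - 1) * exp (- (1 * t))))) * indicator {x<..} t \<partial>lborel)"
  proof (rule nn_integral_mono)
    fix t
    have "?K \<le> 1 / Gamma a * (t powr (a - 1) * exp (- t))" if t: "x < t" "t \<le> x + 1"
    proof -
      have "1 / (x + 1) \<le> 1 / t" using t x by (intro divide_left_mono) auto
      also have "\<dots> = t powr (- 1)" using t x by (simp add: powr_minus_divide)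
      also have "\<dots> \<le> t powr (a - 1)" using t x a by (intro powr_mono) auto
      finally have "1 / (x + 1) * exp (- (x + 1)) \<le> t powr (a - 1) * exp (- t)"
        using t by (intro mult_mono) auto
      then have "1 / Gamma a * (1 / (x + 1) * exp (- (x + 1))) \<le> 1 / Gamma a * (t powr (a - 1) * exp (- t))"
        using G by (intro mult_left_mono) auto
      then show ?thesis by (simp add: mult.commute)
    qed
    then show "ennreal ?K * indicator {x<..x + 1} t \<le>
        ennreal (indicator {0..} t * (1 powr a / Gamma a * (t powr (a - 1) * exp (- (1 * t))))) * indicator {x<..} t"
      using x by (auto simp: indicator_def intro!: ennreal_leI)
  qed
  also have "\<dots> = emeasure (gamma_distr a 1) {x<..}"
    unfolding gamma_distr_def by (subst emeasure_density) auto
  finally show ?thesis by (simp add: emeasure_eq_measure)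
qed

section \<open>Permanental laws of inverse M-matrices\<close>

lemma prod_mono_ennreal:
  fixes f g :: "'i \<Rightarrow> ennreal"
  shows "(\<And>i. i \<in> A \<Longrightarrow> f i \<le> g i) \<Longrightarrow> prod f A \<le> prod g A"
  by (induction A rule: infinite_finite_induct) (auto intro!: mult_mono)

text \<open>\<open>(d / (d + s)) powr (\<alpha> + e)\<close> is the transform of a gamma law of
  shape \<open>\<alpha> + e\<close>, so each term of the series is the transform of a product of
  such laws. The last clause holds for every component of the mixture, since all shapes are at least
  \<alpha> and raising the shape lowers the distribution function.\<close>

lemma M_matrix_permanental_law:
  fixes K A :: "nat \<Rightarrow> nat \<Rightarrow> real"
  assumes \<alpha>: "0 < \<alpha>" and M: "inverse_M_matrix n K A"
  shows "(\<forall>i<n. 0 < A i i) \<and> (\<exists>\<mu>. sets \<mu> = sets (PiM {..<n} (\<lambda>_. borel)) \<and> prob_space \<mu> \<and> (\<forall>i<n. AE x in \<mu>. 0 \<le> x i) \<and>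
    (\<forall>s. (\<forall>i<n. 0 \<le> s i) \<longrightarrow> (\<integral>\<^sup>+x. (\<Prod>i<n. ennreal (exp (- (s i * x i)))) \<partial>\<mu>) =
      ennreal (perm_det n K s powr (- \<alpha>))) \<and>
    (\<forall>b. emeasure \<mu> (PiE {..<n} (\<lambda>i. {..b i})) \<le> (\<Prod>i<n. emeasure (gamma_distr \<alpha> (A i i)) {..b i})))"
proof -
  note series = inverse_M_matrix_series[OF \<alpha> M]
  then obtain c e where c1: "(\<Sum>k. c k) = (1 :: ennreal)" and ser: "\<And>s. (\<forall>i<n. 0 \<le> s i) \<Longrightarrow>
      ennreal (perm_det n K s powr (- \<alpha>)) =
      (\<Prod>i<n. ennreal ((A i i / (A i i + s i)) powr \<alpha>)) *
      (\<Sum>k. c k * ennreal (\<Prod>i<n. (A i i / (A i i + s i)) ^ e k i))"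
    by blast
  have Apos: "0 < A i i" if "i < n" for i using series that by blast
  \<comment> \<open>The value \<open>1\<close> beyond \<open>n\<close> only ensures that every index
    of the product carries a probability measure.\<close>
  define d where "d = (\<lambda>i. if i < n then A i i else 1)"
  have d: "0 < d i" for i using Apos by (auto simp: d_def)
  define \<nu> where "\<nu> = (\<lambda>k. PiM {..<n} (\<lambda>i. gamma_distr (\<alpha> + real (e k i)) (d i)))"
  have pg: "prob_space (gamma_distr (\<alpha> + real (e k i)) (d i))" for k i
    using \<alpha> d by (intro prob_space_gamma_distr) auto
  interpret product_sigma_finite "\<lambda>i. gamma_distr (\<alpha> + real (e k i)) (d i)" for k
    unfolding product_sigma_finite_def using pg prob_space_imp_sigma_finite by blast
  have sets\<nu>: "sets (\<nu> k) = sets (PiM {..<n} (\<lambda>_. borel))" for k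
    unfolding \<nu>_def by (intro sets_PiM_cong) auto
  have p\<nu>: "prob_space (\<nu> k)" for k unfolding \<nu>_def by (intro prob_space_PiM pg)
  \<comment> \<open>\<open>W\<close> has the point masses \<open>c k\<close>; the bind first draws
    \<open>k\<close> from \<open>W\<close> and then a point from the product law
    \<open>\<nu> k\<close>.\<close>
  define W where "W = density (count_space UNIV) c"
  define \<mu> where "\<mu> = W \<bind> \<nu>"
  have \<nu>m: "\<nu> \<in> measurable W (subprob_algebra (PiM {..<n} (\<lambda>_. borel)))"
    unfolding W_def using sets\<nu> p\<nu>
    by (auto simp: measurable_def space_subprob_algebra prob_space_imp_subprob_space)
  have spW: "space W = UNIV" by (simp add: W_def)
  have sets\<mu>: "sets \<mu> = sets (PiM {..<n} (\<lambda>_. borel))"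
    unfolding \<mu>_def by (rule sets_bind) (auto simp: sets\<nu> spW)
  have int: "(\<integral>\<^sup>+x. f x \<partial>\<mu>) = (\<Sum>k. c k * (\<integral>\<^sup>+x. f x \<partial>\<nu> k))"
    if "f \<in> borel_measurable (PiM {..<n} (\<lambda>_. borel))" for f
    unfolding \<mu>_def nn_integral_bind[OF that \<nu>m] unfolding W_def
    by (subst nn_integral_density) (auto simp: nn_integral_count_space_nat)
  have em: "emeasure \<mu> S = (\<Sum>k. c k * emeasure (\<nu> k) S)" if "S \<in> sets (PiM {..<n} (\<lambda>_. borel))" for S
    using int[of "indicator S"] that sets\<mu> sets\<nu> by simp
  show ?thesis
  proof (intro conjI exI[of _ \<mu>] allI impI)
    show "sets \<mu> = sets (PiM {..<n} (\<lambda>_. borel))" by (rule sets\<mu>)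
    show "prob_space \<mu>"
    proof
      have "space (\<nu> k) = space \<mu>" for k using sets\<nu>[of k] sets\<mu> by (metis sets_eq_imp_space_eq)
      then have "emeasure (\<nu> k) (space \<mu>) = 1" for k using prob_space.emeasure_space_1[OF p\<nu>[of k]] by simp
      moreover have "emeasure \<mu> (space \<mu>) = (\<Sum>k. c k * emeasure (\<nu> k) (space \<mu>))"
        by (rule em) (simp flip: sets\<mu>)
      ultimately show "emeasure \<mu> (space \<mu>) = 1" using c1 by simp
    qed
    show "0 < A i i" if "i < n" for i by (rule Apos[OF that])
    show "AE x in \<mu>. 0 \<le> x i" if i: "i < n" for i
    proof (rule AE_I')
      have iI: "i \<in> {..<n}" using i by simp
      let ?S = "{x \<in> space (PiM {..<n} (\<lambda>_. borel)). \<not> (0 :: real) \<le> x i}"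
      have S: "?S \<in> sets (PiM {..<n} (\<lambda>_. borel))" using iI by measurable
      have "emeasure (\<nu> k) ?S = 0" for k
      proof -
        have "AE x in \<nu> k. 0 \<le> x i" unfolding \<nu>_def
          by (intro AE_PiM_component[OF pg] AE_gamma_distr_nonneg iI)
        then show ?thesis
          using S sets\<nu>[of k] sets_eq_imp_space_eq[OF sets\<nu>[of k]] by (subst (asm) AE_iff_measurable[of ?S]) auto
      qed
      then show "?S \<in> null_sets \<mu>" using em[OF S] S sets\<mu> by (auto simp: null_sets_def)
      show "{x \<in> space \<mu>. \<not> 0 \<le> x i} \<subseteq> ?S" using sets_eq_imp_space_eq[OF sets\<mu>] by auto
    qed
    show "(\<integral>\<^sup>+x. (\<Prod>i<n. ennreal (exp (- (s i * x i)))) \<partial>\<mu>) =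
      ennreal (perm_det n K s powr (- \<alpha>))"
      if "\<forall>i<n. 0 \<le> s i" for s
    proof -
      have s: "\<And>i. i < n \<Longrightarrow> 0 \<le> s i" using that by blast
      have "(\<integral>\<^sup>+x. (\<Prod>i<n. ennreal (exp (- (s i * x i)))) \<partial>\<nu> k) =
        (\<Prod>i<n. ennreal ((A i i / (A i i + s i)) powr \<alpha>)) * ennreal (\<Prod>i<n. (A i i / (A i i + s i)) ^ e k i)" for k
      proof -
        have "(\<integral>\<^sup>+x. (\<Prod>i<n. ennreal (exp (- (s i * x i)))) \<partial>\<nu> k) =
          (\<Prod>i<n. \<integral>\<^sup>+x. ennreal (exp (- (s i * x))) \<partial>gamma_distr (\<alpha> + real (e k i)) (d i))"
          unfolding \<nu>_def by (rule product_nn_integral_prod) auto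
        also have "\<dots> = (\<Prod>i<n. ennreal ((A i i / (A i i + s i)) powr \<alpha>) * ennreal ((A i i / (A i i + s i)) ^ e k i))"
        proof (rule prod.cong[OF refl])
          fix i assume "i \<in> {..<n}"
          then have i: "i < n" "0 < A i i" "0 \<le> s i" "d i = A i i" using s Apos[of i] by (auto simp: d_def)
          then show "(\<integral>\<^sup>+x. ennreal (exp (- (s i * x))) \<partial>gamma_distr (\<alpha> + real (e k i)) (d i)) =
            ennreal ((A i i / (A i i + s i)) powr \<alpha>) * ennreal ((A i i / (A i i + s i)) ^ e k i)"
            using \<alpha> by (subst gamma_distr_laplace) (auto simp: powr_add powr_realpow ennreal_mult)
        qed
        also have "\<dots> = (\<Prod>i<n. ennreal ((A i i / (A i i + s i)) powr \<alpha>)) * (\<Prod>i<n. ennreal ((A i i / (A i i + s i)) ^ e k i))"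
          by (rule prod.distrib)
        also have "(\<Prod>i<n. ennreal ((A i i / (A i i + s i)) ^ e k i)) = ennreal (\<Prod>i<n. (A i i / (A i i + s i)) ^ e k i)"
        proof (rule prod_ennreal)
          fix i assume "i \<in> {..<n}"
          then have "0 \<le> A i i" "0 \<le> s i" using s Apos[of i] by auto
          then show "0 \<le> (A i i / (A i i + s i)) ^ e k i" by simp
        qed
        finally show ?thesis .
      qed
      then have "(\<integral>\<^sup>+x. (\<Prod>i<n. ennreal (exp (- (s i * x i)))) \<partial>\<mu>) =
         (\<Sum>k. (\<Prod>i<n. ennreal ((A i i / (A i i + s i)) powr \<alpha>)) * (c k * ennreal (\<Prod>i<n. (A i i / (A i i + s i)) ^ e k i)))"
        by (subst int) (auto simp: mult.left_commute)
      then show ?thesis using s by (subst ser) auto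
    qed
    show "emeasure \<mu> (PiE {..<n} (\<lambda>i. {..b i})) \<le> (\<Prod>i<n. emeasure (gamma_distr \<alpha> (A i i)) {..b i})" for b
    proof -
      have "emeasure (\<nu> k) (PiE {..<n} (\<lambda>i. {..b i})) \<le> (\<Prod>i<n. emeasure (gamma_distr \<alpha> (A i i)) {..b i})" for k
        unfolding \<nu>_def using \<alpha> Apos
        by (subst emeasure_PiM) (auto simp: d_def intro!: prod_mono_ennreal gamma_distr_atMost_shape)
      then have "emeasure \<mu> (PiE {..<n} (\<lambda>i. {..b i})) \<le>
          (\<Sum>k. c k * (\<Prod>i<n. emeasure (gamma_distr \<alpha> (A i i)) {..b i}))"
        by (subst em) (auto intro!: suminf_le mult_left_mono sets_PiM_I_finite simp del: ennreal_suminf_multc)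
      also have "\<dots> = (\<Sum>k. c k) * (\<Prod>i<n. emeasure (gamma_distr \<alpha> (A i i)) {..b i})"
        by (rule ennreal_suminf_multc)
      finally show ?thesis by (simp add: c1)
    qed
  qed
qed

text \<open>With the incidence matrix \<open>E\<close> of the two enumerations, the two products of
  kernel and diagonal are \<open>E * B\<close> and \<open>B * E\<close>, so Sylvester's identity
  applies. The statement covers both a reordering of one index set and its enlargement by points
  where \<open>s\<close> vanishes.\<close>

lemma det_one_plus_reindex:
  fixes K :: "'i \<Rightarrow> 'i \<Rightarrow> real" and i i' :: "nat \<Rightarrow> 'i"
  assumes inj: "inj_on i {..<n}" "inj_on i' {..<n'}" and sub: "i ` {..<n} \<subseteq> i' ` {..<n'}"
    and s0: "\<And>j. j \<in> i' ` {..<n'} \<Longrightarrow> j \<notin> i ` {..<n} \<Longrightarrow> s j = 0"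
  shows "perm_det n (\<lambda>p q. K (i p) (i q)) (\<lambda>m. s (i m)) =
    perm_det n' (\<lambda>p q. K (i' p) (i' q)) (\<lambda>m. s (i' m))"
proof -
  define E where "E = Matrix.mat n n' (\<lambda>(p, k). if i p = i' k then 1 else 0 :: real)"
  define B where "B = Matrix.mat n' n (\<lambda>(k, q). K (i' k) (i q) * s (i q))"
  have E: "E \<in> carrier_mat n n'" and B: "B \<in> carrier_mat n' n" by (auto simp: E_def B_def)
  have 1: "Matrix.mat n n (\<lambda>(p, q). K (i p) (i q)) * mat_diag n (\<lambda>m. s (i m)) = E * B"
  proof (rule eq_matI)
    fix p q assume "p < dim_row (E * B)" "q < dim_col (E * B)"
    then have pq: "p < n" "q < n" by (auto simp: E_def B_def)
    then obtain l where l: "l < n'" "i p = i' l" using sub by auto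
    have "(E * B) $$ (p, q) = (\<Sum>k<n'. (if i p = i' k then 1 else 0) * (K (i' k) (i q) * s (i q)))"
      using pq by (simp add: E_def B_def scalar_prod_def atLeast0LessThan)
    also have "\<dots> = (\<Sum>k<n'. if k = l then K (i' l) (i q) * s (i q) else 0)"
      using l inj(2) by (intro sum.cong) (auto dest: inj_onD)
    finally show "(Matrix.mat n n (\<lambda>(p, q). K (i p) (i q)) * mat_diag n (\<lambda>m. s (i m))) $$ (p, q) = (E * B) $$ (p, q)"
      using pq l by (subst mat_diag_mult_right[of _ n]) auto
  qed (auto simp: E_def B_def mat_diag_def)
  have 2: "Matrix.mat n' n' (\<lambda>(p, q). K (i' p) (i' q)) * mat_diag n' (\<lambda>m. s (i' m)) = B * E"
  proof (rule eq_matI)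
    fix p q assume "p < dim_row (B * E)" "q < dim_col (B * E)"
    then have pq: "p < n'" "q < n'" by (auto simp: E_def B_def)
    have "(B * E) $$ (p, q) = (\<Sum>k<n. K (i' p) (i k) * s (i k) * (if i k = i' q then 1 else 0))"
      using pq by (simp add: E_def B_def scalar_prod_def atLeast0LessThan)
    also have "\<dots> = K (i' p) (i' q) * s (i' q)"
    proof (cases "i' q \<in> i ` {..<n}")
      case True
      then obtain l where l: "l < n" "i' q = i l" by auto
      have "(\<Sum>k<n. K (i' p) (i k) * s (i k) * (if i k = i' q then 1 else 0)) =
          (\<Sum>k<n. if k = l then K (i' p) (i' q) * s (i' q) else 0)"
        using l inj(1) by (intro sum.cong) (auto dest: inj_onD)
      then show ?thesis using l by simp
    next
      case False
      then show ?thesis using s0[of "i' q"] pq by (auto intro!: sum.neutral)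
    qed
    finally show "(Matrix.mat n' n' (\<lambda>(p, q). K (i' p) (i' q)) * mat_diag n' (\<lambda>m. s (i' m))) $$ (p, q) = (B * E) $$ (p, q)"
      using pq by (subst mat_diag_mult_right[of _ n']) auto
  qed (auto simp: E_def B_def mat_diag_def)
  show ?thesis unfolding 1 2 by (rule sylvester_det[OF E B])
qed

definition permanental_law :: "real \<Rightarrow> ('i \<Rightarrow> 'i \<Rightarrow> real) \<Rightarrow> 'i set \<Rightarrow> ('i \<Rightarrow> real) measure \<Rightarrow> bool" where
  "permanental_law \<alpha> K J \<mu> \<longleftrightarrow> sets \<mu> = sets (PiM J (\<lambda>_. borel)) \<and> prob_space \<mu> \<and> (\<forall>j\<in>J. AE x in \<mu>. 0 \<le> x j) \<and>
    (\<forall>n i s. bij_betw i {..<n} J \<longrightarrow> (\<forall>j\<in>J. 0 \<le> s j) \<longrightarrow>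
      (\<integral>\<^sup>+x. (\<Prod>j\<in>J. ennreal (exp (- (s j * x j)))) \<partial>\<mu>) = ennreal (perm_det n (\<lambda>p q. K (i p) (i q)) (\<lambda>m. s (i m)) powr (- \<alpha>)))"

lemma permanental_law_exists:
  assumes \<alpha>: "0 < \<alpha>" and J: "finite J"
    and M: "\<And>n i. bij_betw i {..<n} J \<Longrightarrow> \<exists>A. inverse_M_matrix n (\<lambda>p q. K (i p) (i q)) A"
  shows "\<exists>\<mu>. permanental_law \<alpha> K J \<mu>"
proof -
  obtain i where i: "bij_betw i {..<card J} J"
    using ex_bij_betw_nat_finite[OF J] by (auto simp: atLeast0LessThan)
  define n where "n = card J"
  note i = i[folded n_def]
  obtain A where A: "inverse_M_matrix n (\<lambda>p q. K (i p) (i q)) A" using M[OF i] by blast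
  obtain \<mu> where sets\<mu>: "sets \<mu> = sets (PiM {..<n} (\<lambda>_. borel))" and p\<mu>: "prob_space \<mu>"
    and nn: "\<forall>p<n. AE x in \<mu>. 0 \<le> x p"
    and lap: "\<forall>s. (\<forall>p<n. 0 \<le> s p) \<longrightarrow> (\<integral>\<^sup>+x. (\<Prod>p<n. ennreal (exp (- (s p * x p)))) \<partial>\<mu>) =
      ennreal (perm_det n (\<lambda>p q. K (i p) (i q)) s powr (- \<alpha>))"
    using M_matrix_permanental_law[OF \<alpha> A] by blast
  interpret prob_space \<mu> by fact
  note [measurable_cong] = sets\<mu>
  define iv where "iv = the_inv_into {..<n} i"
  have iv: "iv j < n" "i (iv j) = j" if "j \<in> J" for j
    using i that f_the_inv_into_f[of i "{..<n}" j] the_inv_into_into[of i "{..<n}" j "{..<n}"]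
    unfolding iv_def bij_betw_def by auto
  have iv2: "iv (i p) = p" if "p < n" for p
    using i that unfolding iv_def bij_betw_def by (simp add: the_inv_into_f_f)
  define T where "T = (\<lambda>x :: nat \<Rightarrow> real. \<lambda>j\<in>J. x (iv j))"
  have T[measurable]: "T \<in> measurable \<mu> (PiM J (\<lambda>_. borel))"
    unfolding T_def by (rule measurable_restrict) (use iv sets\<mu> in \<open>auto intro!: measurable_component_singleton\<close>)
  have "permanental_law \<alpha> K J (distr \<mu> (PiM J (\<lambda>_. borel)) T)"
    unfolding permanental_law_def
  proof (intro conjI ballI allI impI)
    show "prob_space (distr \<mu> (PiM J (\<lambda>_. borel)) T)" by (rule prob_space_distr) simp
    show "AE x in distr \<mu> (PiM J (\<lambda>_. borel)) T. 0 \<le> x j" if "j \<in> J" for j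
      using nn[rule_format, OF iv(1)[OF that]] that by (subst AE_distr_iff[OF T]) (auto simp: T_def)
    fix n' :: nat and i' and s :: "'a \<Rightarrow> real" assume i': "bij_betw i' {..<n'} J" and s: "\<forall>j\<in>J. 0 \<le> s j"
    have "(\<integral>\<^sup>+x. (\<Prod>j\<in>J. ennreal (exp (- (s j * x j)))) \<partial>distr \<mu> (PiM J (\<lambda>_. borel)) T) =
        (\<integral>\<^sup>+x. (\<Prod>j\<in>J. ennreal (exp (- (s j * T x j)))) \<partial>\<mu>)"
      by (subst nn_integral_distr) auto
    also have "\<dots> = (\<integral>\<^sup>+x. (\<Prod>p<n. ennreal (exp (- (s (i p) * x p)))) \<partial>\<mu>)"
    proof (rule nn_integral_cong)
      fix x
      have "(\<Prod>j\<in>J. ennreal (exp (- (s j * T x j)))) = (\<Prod>p<n. ennreal (exp (- (s (i p) * T x (i p)))))"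
        by (rule prod.reindex_bij_betw[OF i, symmetric])
      then show "(\<Prod>j\<in>J. ennreal (exp (- (s j * T x j)))) = (\<Prod>p<n. ennreal (exp (- (s (i p) * x p))))"
        using i iv2 by (auto simp: T_def bij_betw_def intro!: prod.cong)
    qed
    also have "\<dots> = ennreal (perm_det n (\<lambda>p q. K (i p) (i q)) (\<lambda>p. s (i p)) powr (- \<alpha>))"
      using s i by (intro lap[rule_format]) (auto simp: bij_betw_def)
    also have "perm_det n (\<lambda>p q. K (i p) (i q)) (\<lambda>p. s (i p)) =
       perm_det n' (\<lambda>p q. K (i' p) (i' q)) (\<lambda>p. s (i' p))"
      using i i' by (intro det_one_plus_reindex) (auto simp: bij_betw_def)
    finally show "(\<integral>\<^sup>+x. (\<Prod>j\<in>J. ennreal (exp (- (s j * x j)))) \<partial>distr \<mu> (PiM J (\<lambda>_. borel)) T) =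
      ennreal (perm_det n' (\<lambda>p q. K (i' p) (i' q)) (\<lambda>m. s (i' m)) powr (- \<alpha>))" .
  qed simp
  then show ?thesis by blast
qed

text \<open>The consistency condition of Kolmogorov's theorem. Setting \<open>s\<close> to zero
  outside \<open>H\<close> removes these coordinates from the transform and, by
  \<open>det_one_plus_reindex\<close>, also from the determinant.\<close>

lemma permanental_law_restrict:
  assumes J: "finite J" "H \<subseteq> J" and \<mu>: "permanental_law \<alpha> K J \<mu>" and \<nu>: "permanental_law \<alpha> K H \<nu>"
  shows "\<nu> = distr \<mu> (PiM H (\<lambda>_. borel)) (\<lambda>x. restrict x H)"
proof -
  have H: "finite H" using J finite_subset by blast
  have sets\<mu>[measurable_cong]: "sets \<mu> = sets (PiM J (\<lambda>_. borel))"
    and sets\<nu>[measurable_cong]: "sets \<nu> = sets (PiM H (\<lambda>_. borel))"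
    and p: "prob_space \<mu>" "prob_space \<nu>" using \<mu> \<nu> by (auto simp: permanental_law_def)
  interpret \<mu>: prob_space \<mu> by fact
  interpret \<nu>: prob_space \<nu> by fact
  have R[measurable]: "(\<lambda>x. restrict x H) \<in> measurable \<mu> (PiM H (\<lambda>_. borel))"
    by (subst measurable_cong_sets[OF sets\<mu> refl]) (rule measurable_restrict_subset[OF J(2)])
  obtain i where i: "bij_betw i {..<card J} J"
    using ex_bij_betw_nat_finite[OF J(1)] by (auto simp: atLeast0LessThan)
  obtain i' where i': "bij_betw i' {..<card H} H"
    using ex_bij_betw_nat_finite[OF H] by (auto simp: atLeast0LessThan)
  have lap: "(\<integral>\<^sup>+x. 1 * (\<Prod>j\<in>H. ennreal (exp (- (s j * x j)))) \<partial>\<nu>) =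
      (\<integral>\<^sup>+x. 1 * (\<Prod>j\<in>H. ennreal (exp (- (s j * x j)))) \<partial>\<mu>)" if s: "\<And>j. j \<in> H \<Longrightarrow> 0 < s j" for s
  proof -
    define s' where "s' = (\<lambda>j. if j \<in> H then s j else 0)"
    have s': "\<forall>j\<in>J. 0 \<le> s' j" "\<forall>j\<in>H. 0 \<le> s' j" using s by (auto simp: s'_def less_imp_le)
    have "(\<Prod>j\<in>J. ennreal (exp (- (s' j * x j)))) = (\<Prod>j\<in>H. ennreal (exp (- (s j * x j))))" for x :: "'a \<Rightarrow> real"
      using J by (intro prod.mono_neutral_cong_right) (auto simp: s'_def)
    moreover have "(\<integral>\<^sup>+x. (\<Prod>j\<in>J. ennreal (exp (- (s' j * x j)))) \<partial>\<mu>) = ennreal (perm_det (card J) (\<lambda>p q. K (i p) (i q)) (\<lambda>m. s' (i m)) powr (- \<alpha>))"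
      using \<mu> i s' unfolding permanental_law_def by blast
    moreover have "(\<integral>\<^sup>+x. (\<Prod>j\<in>H. ennreal (exp (- (s' j * x j)))) \<partial>\<nu>) = ennreal (perm_det (card H) (\<lambda>p q. K (i' p) (i' q)) (\<lambda>m. s' (i' m)) powr (- \<alpha>))"
      using \<nu> i' s' unfolding permanental_law_def by blast
    moreover have "(\<integral>\<^sup>+x. (\<Prod>j\<in>H. ennreal (exp (- (s' j * x j)))) \<partial>\<nu>) = (\<integral>\<^sup>+x. (\<Prod>j\<in>H. ennreal (exp (- (s j * x j)))) \<partial>\<nu>)"
      by (intro nn_integral_cong prod.cong) (auto simp: s'_def)
    moreover have "perm_det (card H) (\<lambda>p q. K (i' p) (i' q)) (\<lambda>m. s' (i' m)) =
      perm_det (card J) (\<lambda>p q. K (i p) (i q)) (\<lambda>m. s' (i m))"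
      using i i' J by (intro det_one_plus_reindex) (auto simp: bij_betw_def s'_def)
    ultimately show ?thesis by simp
  qed
  have comp: "(\<lambda>x. x j) \<in> borel_measurable \<mu>" if "j \<in> J" for j
    using that sets\<mu> measurable_component_singleton[of j J "\<lambda>_. borel :: real measure"]
    by (simp add: measurable_cong_sets[OF sets\<mu> refl])
  have comp': "(\<lambda>x. x j) \<in> borel_measurable \<nu>" if "j \<in> H" for j
    using that sets\<nu> measurable_component_singleton[of j H "\<lambda>_. borel :: real measure"]
    by (simp add: measurable_cong_sets[OF sets\<nu> refl])
  show ?thesis
  proof (rule measure_eqI_PiM_finite[OF H])
    fix B :: "'a \<Rightarrow> real set" assume B: "\<And>j. j \<in> H \<Longrightarrow> B j \<in> sets borel"
    then have BP: "PiE H B \<in> sets (PiM H (\<lambda>_. borel))" using H by (intro sets_PiM_I_finite) auto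
    have eq: "(\<integral>\<^sup>+x. 1 * (\<Prod>j\<in>H. indicator (B j) (x j)) \<partial>\<nu>) = (\<integral>\<^sup>+x. 1 * (\<Prod>j\<in>H. indicator (B j) (x j)) \<partial>\<mu>)"
    proof (rule joint_laplace_transform_unique[OF H])
      show "AE x in \<mu>. 0 \<le> x j" "AE x in \<nu>. 0 \<le> x j" if "j \<in> H" for j
        using \<mu> \<nu> J that by (auto simp: permanental_law_def)
    qed (use B comp comp' J lap \<mu>.emeasure_space_1 \<nu>.emeasure_space_1 in auto)
    have ind: "(\<Prod>j\<in>H. indicator (B j) (x j)) = (indicator (PiE H B) (restrict x H) :: ennreal)" for x
    proof (cases "\<forall>j\<in>H. x j \<in> B j")
      case True
      then have "restrict x H \<in> PiE H B" by auto
      then show ?thesis using True by simp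
    next
      case False
      then obtain j where j: "j \<in> H" "x j \<notin> B j" by blast
      then have "restrict x H \<notin> PiE H B" by auto
      moreover have "(\<Prod>j\<in>H. indicator (B j) (x j)) = (0 :: ennreal)"
        using H j by (intro prod_zero bexI[of _ j]) auto
      ultimately show ?thesis by simp
    qed
    have "emeasure \<nu> (PiE H B) = (\<integral>\<^sup>+x. indicator (PiE H B) x \<partial>\<nu>)"
      using BP sets\<nu> by simp
    also have "\<dots> = (\<integral>\<^sup>+x. 1 * (\<Prod>j\<in>H. indicator (B j) (x j)) \<partial>\<nu>)"
    proof (rule nn_integral_cong)
      fix x assume "x \<in> space \<nu>"
      then have "restrict x H = x" using sets_eq_imp_space_eq[OF sets\<nu>] by (auto simp: space_PiM PiE_restrict)
      then show "indicator (PiE H B) x = 1 * (\<Prod>j\<in>H. indicator (B j) (x j) :: ennreal)" using ind[of x] by simp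
    qed
    also have "\<dots> = (\<integral>\<^sup>+x. indicator (PiE H B) x \<partial>distr \<mu> (PiM H (\<lambda>_. borel)) (\<lambda>x. restrict x H))"
      unfolding eq using BP by (subst nn_integral_distr) (auto simp: ind)
    also have "\<dots> = emeasure (distr \<mu> (PiM H (\<lambda>_. borel)) (\<lambda>x. restrict x H)) (PiE H B)"
      using BP by simp
    finally show "emeasure \<nu> (PiE H B) = emeasure (distr \<mu> (PiM H (\<lambda>_. borel)) (\<lambda>x. restrict x H)) (PiE H B)" .
  next
    show "range (\<lambda>_::nat. \<Pi>\<^sub>E j\<in>H. (UNIV :: real set)) \<subseteq> prod_algebra H (\<lambda>_. borel)"
      using H by (auto intro!: prod_algebraI_finite)
    show "(\<Union>i::nat. (\<Pi>\<^sub>E j\<in>H. (UNIV :: real set))) = space (PiM H (\<lambda>_. borel))" by (simp add: space_PiM)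
  qed (simp_all add: sets\<nu>)
qed

section \<open>Extension to the whole sequence by Kolmogorov's theorem\<close>

lemma permanental_sequence_exists:
  assumes \<alpha>: "0 < \<alpha>"
    and M: "\<And>n i. inj_on i {..<n} \<Longrightarrow> \<exists>A. inverse_M_matrix n (\<lambda>p q. K (i p) (i q)) A"
  shows "\<exists>(N :: (int \<Rightarrow> real) measure) Z. permanental_sequence N Z \<alpha> K"
proof -
  define P where "P = (\<lambda>J. SOME \<mu>. permanental_law \<alpha> K J \<mu>)"
  have PL: "permanental_law \<alpha> K J (P J)" if "finite J" for J
  proof -
    have "\<exists>\<mu>. permanental_law \<alpha> K J \<mu>"
      by (rule permanental_law_exists[OF \<alpha> that]) (rule M, simp add: bij_betw_def)
    then show ?thesis unfolding P_def by (rule someI_ex)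
  qed
  interpret polish_projective UNIV P
  proof (intro polish_projective.intro projective_family.intro, goal_cases)
    case (1 J H)
    then show ?case using permanental_law_restrict[OF 1(2,1) PL PL] finite_subset by blast
  next
    case (2 J)
    then show ?case using PL[of J] by (simp add: permanental_law_def)
  qed
  \<comment> \<open>The coordinates are non-negative only almost surely. Truncation gives the
    pointwise sign that \<open>permanental_sequence\<close> demands and leaves the transforms
    unchanged.\<close>
  define Z :: "int \<Rightarrow> (int \<Rightarrow> real) \<Rightarrow> real" where "Z = (\<lambda>j \<omega>. max 0 (\<omega> j))"
  have Z: "Z j \<in> borel_measurable lim" for j
    unfolding Z_def by (intro borel_measurable_max)
      (simp_all add: measurable_cong_sets[OF sets_lim refl] measurable_component_singleton)
  have dl: "distr lim (PiM J (\<lambda>_. borel)) (\<lambda>x. restrict x J) = P J" if J: "finite J" for J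
  proof (rule measure_eqI)
    show "sets (distr lim (PiM J (\<lambda>_. borel)) (\<lambda>x. restrict x J)) = sets (P J)"
      using PL[OF J] by (simp add: permanental_law_def)
    fix B assume "B \<in> sets (distr lim (PiM J (\<lambda>_. borel)) (\<lambda>x. restrict x J))"
    then have B: "B \<in> sets (PiM J (\<lambda>_. borel))" by simp
    have "emeasure (distr lim (PiM J (\<lambda>_. borel)) (\<lambda>x. restrict x J)) B = emeasure lim (emb UNIV J B)"
      using B by (subst emeasure_distr)
        (auto simp: prod_emb_def measurable_cong_sets[OF sets_lim refl] measurable_restrict_subset space_PiM)
    then show "emeasure (distr lim (PiM J (\<lambda>_. borel)) (\<lambda>x. restrict x J)) B = emeasure (P J) B"
      using emeasure_lim_emb[of J B] J B by simp
  qed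
  have "permanental_sequence lim Z \<alpha> K"
    unfolding permanental_sequence_def
  proof (intro conjI allI ballI impI)
    show "prob_space lim" by (rule P.prob_space_axioms)
    show "Z j \<in> borel_measurable lim" for j by (rule Z)
    show "0 \<le> Z j \<omega>" for j \<omega> by (simp add: Z_def)
    fix n and i :: "nat \<Rightarrow> int" and s :: "nat \<Rightarrow> real"
    assume "inj_on i {..<n} \<and> (\<forall>m<n. 0 < s m)"
    then have i: "inj_on i {..<n}" and s: "\<forall>m<n. 0 < s m" by auto
    define J where "J = i ` {..<n}"
    have J: "finite J" by (simp add: J_def)
    define s' where "s' = (\<lambda>j. s (the_inv_into {..<n} i j))"
    have s': "s' (i m) = s m" if "m < n" for m using i that by (simp add: s'_def the_inv_into_f_f)
    have s'0: "\<forall>j\<in>J. 0 \<le> s' j" using s s' by (auto simp: J_def less_imp_le)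
    have PJ: "permanental_law \<alpha> K J (P J)" by (rule PL[OF J])
    have sP: "sets (P J) = sets (PiM J (\<lambda>_. borel))" using PJ by (simp add: permanental_law_def)
    let ?T = "\<lambda>x. \<Prod>j\<in>J. ennreal (exp (- (s' j * max 0 (x j))))"
    have T: "?T \<in> borel_measurable (PiM J (\<lambda>_. borel))" by measurable
    have "ennreal (exp (- (\<Sum>m<n. s m * Z (i m) \<omega>))) = ?T (restrict \<omega> J)" for \<omega>
    proof -
      have "exp (- (\<Sum>m<n. s m * Z (i m) \<omega>)) = (\<Prod>m<n. exp (- (s' (i m) * max 0 (\<omega> (i m)))))"
        by (simp add: Z_def s' sum_negf[symmetric] exp_sum)
      also have "\<dots> = (\<Prod>j\<in>J. exp (- (s' j * max 0 (\<omega> j))))"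
        unfolding J_def by (rule prod.reindex_cong[OF i refl, symmetric]) simp
      finally show ?thesis by (simp add: prod_ennreal)
    qed
    then have "(\<integral>\<^sup>+\<omega>. ennreal (exp (- (\<Sum>m<n. s m * Z (i m) \<omega>))) \<partial>lim) = (\<integral>\<^sup>+x. ?T x \<partial>P J)"
      unfolding dl[OF J, symmetric] using T
      by (subst nn_integral_distr) (auto simp: measurable_cong_sets[OF sets_lim refl] measurable_restrict_subset)
    also have "\<dots> = (\<integral>\<^sup>+x. (\<Prod>j\<in>J. ennreal (exp (- (s' j * x j)))) \<partial>P J)"
    proof (rule nn_integral_cong_AE)
      have "AE x in P J. \<forall>j\<in>J. 0 \<le> x j"
        using PJ J by (subst AE_finite_all) (auto simp: permanental_law_def)
      then show "AE x in P J. ?T x = (\<Prod>j\<in>J. ennreal (exp (- (s' j * x j))))"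
        by eventually_elim (auto intro!: prod.cong)
    qed
    also have "\<dots> = ennreal (perm_det n (\<lambda>p q. K (i p) (i q)) (\<lambda>m. s' (i m)) powr (- \<alpha>))"
    proof -
      have "bij_betw i {..<n} J" using i by (simp add: bij_betw_def J_def)
      then show ?thesis using PJ s'0 unfolding permanental_law_def by blast
    qed
    also have "Matrix.mat n n (\<lambda>(p, q). K (i p) (i q)) * mat_diag n (\<lambda>m. s' (i m)) =
        Matrix.mat n n (\<lambda>(p, q). K (i p) (i q)) * mat_diag n s"
      by (subst (1 2) mat_diag_mult_right[of _ n]) (auto simp: s' intro!: eq_matI)
    finally have "enn2real (\<integral>\<^sup>+\<omega>. ennreal (exp (- (\<Sum>m<n. s m * Z (i m) \<omega>))) \<partial>lim) =
       perm_det n (\<lambda>p q. K (i p) (i q)) s powr (- \<alpha>)"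
      by simp
    moreover have "P.expectation (\<lambda>\<omega>. exp (- (\<Sum>m<n. s m * Z (i m) \<omega>))) =
        enn2real (\<integral>\<^sup>+\<omega>. ennreal (exp (- (\<Sum>m<n. s m * Z (i m) \<omega>))) \<partial>lim)"
      using Z by (intro integral_eq_nn_integral) auto
    ultimately show "P.expectation (\<lambda>\<omega>. exp (- (\<Sum>m<n. s m * Z (i m) \<omega>))) =
       perm_det n (\<lambda>p q. K (i p) (i q)) s powr (- \<alpha>)"
      by simp
  qed
  then show ?thesis by blast
qed

section \<open>Potential theory of convolution kernels\<close>

text \<open>
  \<open>q h\<close> is the killed transition density, \<open>u\<close> its potential density and \<open>J h\<close> the part of the
  potential collected before time \<open>h\<close>.
\<close>

locale convolution_potential =
  fixes \<beta> :: real and q J :: "real \<Rightarrow> int \<Rightarrow> real" and u :: "int \<Rightarrow> real"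
  assumes beta: "0 < \<beta>"
    and q_nonneg: "\<And>h x. 0 \<le> q h x"
    and q_integrable: "\<And>h. 0 < h \<Longrightarrow> integrable (count_space UNIV) (q h)"
    and q_mass: "\<And>h. 0 < h \<Longrightarrow> (LINT x|count_space UNIV. q h x) = exp (- \<beta> * h)"
    and u_nonneg: "\<And>x. 0 \<le> u x"
    and u_bounded: "\<And>x. u x \<le> 1 / \<beta>"
    and J_nonneg: "\<And>h x. 0 \<le> J h x"
    and u_split: "\<And>h x. 0 < h \<Longrightarrow> u x = (LINT y|count_space UNIV. q h y * u (x - y)) + J h x"
    and J_small: "\<And>\<epsilon>. 0 < \<epsilon> \<Longrightarrow> \<exists>h0>0. \<forall>h. 0 < h \<and> h < h0 \<longrightarrow>
      (\<forall>x. x \<noteq> 0 \<longrightarrow> J h x \<le> \<epsilon> * h) \<and> (1 - \<epsilon>) * h \<le> J h 0"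
begin

text \<open>The inequality half of excessiveness, in terms of real integrals. Integrability has to
  be demanded, since the integral of a non-integrable function is \<open>0\<close> and would satisfy
  the inequality for no reason.\<close>

definition supermedian :: "(int \<Rightarrow> real) \<Rightarrow> bool" where
  "supermedian w \<longleftrightarrow> (\<forall>x. 0 \<le> w x) \<and> (\<forall>h>0. \<forall>j. integrable (count_space UNIV) (\<lambda>y. q h y * w (j + y)) \<and>
      (LINT y|count_space UNIV. q h y * w (j + y)) \<le> w j)"

lemma integrable_q_bounded:
  assumes h: "0 < h" and b: "\<And>y. \<bar>z y\<bar> \<le> C"
  shows "integrable (count_space UNIV) (\<lambda>y. q h y * z y)"
proof (rule Bochner_Integration.integrable_bound)
  show "integrable (count_space UNIV) (\<lambda>y. q h y * C)" using q_integrable[OF h] by simp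
  show "AE y in count_space UNIV. norm (q h y * z y) \<le> norm (q h y * C)"
    using q_nonneg b by (auto simp: abs_mult intro!: mult_left_mono order.trans[OF b abs_ge_self])
qed simp

lemma supermedian_const: "0 \<le> c \<Longrightarrow> supermedian (\<lambda>_. c)"
proof -
  assume c: "0 \<le> c"
  have "exp (- (\<beta> * h)) * c \<le> c" if "0 < h" for h
    using c beta that mult_right_mono[of "exp (- (\<beta> * h))" 1 c] by simp
  then show ?thesis
    using c q_mass integrable_q_bounded[of _ "\<lambda>_. c" c] unfolding supermedian_def by auto
qed

text \<open>The potential of a signed charge \<open>x r\<close> placed at the points
  \<open>i r\<close>; \<open>u (i r - j)\<close> is the potential density from \<open>j\<close> to
  \<open>i r\<close>.\<close>

definition pot :: "nat \<Rightarrow> (nat \<Rightarrow> int) \<Rightarrow> (nat \<Rightarrow> real) \<Rightarrow> int \<Rightarrow> real" where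
  "pot n i x j = (\<Sum>r<n. u (i r - j) * x r)"

lemma pot_bounded: "\<bar>pot n i x j\<bar> \<le> (\<Sum>r<n. \<bar>x r\<bar>) / \<beta>"
proof -
  have "\<bar>pot n i x j\<bar> \<le> (\<Sum>r<n. \<bar>u (i r - j) * x r\<bar>)" unfolding pot_def by (rule sum_abs)
  also have "\<dots> \<le> (\<Sum>r<n. 1 / \<beta> * \<bar>x r\<bar>)"
    using u_nonneg u_bounded by (intro sum_mono) (auto simp: abs_mult intro!: mult_right_mono simp del: times_divide_eq_left)
  finally show ?thesis by (simp add: sum_divide_distrib)
qed

lemma pot_integrable: "0 < h \<Longrightarrow> integrable (count_space UNIV) (\<lambda>y. q h y * pot n i x (j + y))"
  by (rule integrable_q_bounded[OF _ pot_bounded])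

text \<open>The Markov property at the fixed time \<open>h\<close>. For small \<open>h\<close> the
  last sum is governed by the charge sitting at \<open>j\<close> itself, which is how information on
  single charges is extracted.\<close>

lemma pot_split:
  assumes h: "0 < h"
  shows "pot n i x j = (LINT y|count_space UNIV. q h y * pot n i x (j + y)) + (\<Sum>r<n. J h (i r - j) * x r)"
proof -
  have int: "integrable (count_space UNIV) (\<lambda>y. q h y * u (k - y))" for k
    using u_nonneg u_bounded by (intro integrable_q_bounded[OF h, of _ "1 / \<beta>"]) auto
  have "(LINT y|count_space UNIV. q h y * pot n i x (j + y)) =
      (LINT y|count_space UNIV. (\<Sum>r<n. (q h y * u (i r - j - y)) * x r))"
    unfolding pot_def by (simp add: sum_distrib_left algebra_simps)
  also have "\<dots> = (\<Sum>r<n. (LINT y|count_space UNIV. q h y * u (i r - j - y)) * x r)"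
    using int by (subst Bochner_Integration.integral_sum) auto
  finally show ?thesis
    unfolding pot_def by (subst u_split[OF h]) (simp add: algebra_simps sum.distrib)
qed

text \<open>
  The maximum principle: at a point where \<open>pot n i x - w\<close> is positive the charge is not positive, so
  there this function is bounded by its average after the (strictly contracting) time \<open>h\<close>, up to an
  error \<open>o(h)\<close> that is uniform on \<open>\<int>\<close>.
\<close>

lemma domination:
  assumes w: "supermedian w" and le: "\<And>p. p < n \<Longrightarrow> 0 < x p \<Longrightarrow> pot n i x (i p) \<le> w (i p)"
  shows "pot n i x j \<le> w j"
proof (rule ccontr)
  assume neg: "\<not> pot n i x j \<le> w j"
  define z where "z = (\<lambda>j. pot n i x j - w j)"
  define C where "C = (\<Sum>r<n. \<bar>x r\<bar>)"
  \<comment> \<open>The supremum need not be attained, so the one-step bound is proved at every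
    point where \<open>z\<close> is positive and then passed to the supremum.\<close>
  define s where "s = (SUP j. z j)"
  have C0: "0 \<le> C" unfolding C_def by (intro sum_nonneg) auto
  have "z j \<le> C / \<beta>" for j
  proof -
    have "0 \<le> w j" using w unfolding supermedian_def by blast
    then show ?thesis using abs_le_D1[OF pot_bounded[of n i x j]] unfolding z_def C_def by linarith
  qed
  then have bdd: "bdd_above (range z)" by (auto intro!: bdd_aboveI)
  have zs: "z j \<le> s" for j unfolding s_def using bdd by (intro cSUP_upper) auto
  have s: "0 < s" using neg zs[of j] unfolding z_def by simp
  \<comment> \<open>For \<open>\<beta> * h \<le> 1\<close>, killing lowers the supremum by at least
    \<open>s * \<beta> * h / 2\<close>. This choice keeps the error
    \<open>\<epsilon> * C * h\<close> below half of that loss; \<open>C + 1\<close> avoids a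
    division by zero.\<close>
  define \<epsilon> where "\<epsilon> = s * \<beta> / (4 * (C + 1))"
  have \<epsilon>: "0 < \<epsilon>" unfolding \<epsilon>_def using s beta C0 by (intro divide_pos_pos) auto
  obtain h0 where h0: "0 < h0" "\<And>h x. 0 < h \<Longrightarrow> h < h0 \<Longrightarrow> x \<noteq> 0 \<Longrightarrow> J h x \<le> \<epsilon> * h"
    using J_small[OF \<epsilon>] by blast
  define h where "h = min (h0 / 2) (1 / \<beta>)"
  have h: "0 < h" "h < h0" "\<beta> * h \<le> 1"
    using h0 beta by (auto simp: h_def min_def field_simps)
  have step: "z j \<le> exp (- \<beta> * h) * s + \<epsilon> * h * C" if "0 < z j" for j
  proof -
    \<comment> \<open>\<open>J h 0\<close> is comparable to \<open>h\<close> and not small, so it is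
      essential that a charge located at \<open>j\<close> enters with a favourable sign.\<close>
    have x: "x r \<le> 0" if "r < n" "i r = j" for r
      using le[of r] that \<open>0 < z j\<close> unfolding z_def by (cases "0 < x r") auto
    have "(\<Sum>r<n. J h (i r - j) * x r) \<le> (\<Sum>r<n. \<epsilon> * h * \<bar>x r\<bar>)"
    proof (rule sum_mono)
      fix r assume r: "r \<in> {..<n}"
      show "J h (i r - j) * x r \<le> \<epsilon> * h * \<bar>x r\<bar>"
      proof (cases "0 < x r")
        case True
        then have "i r - j \<noteq> 0" using x[of r] r by force
        then show ?thesis using h0(2)[of h "i r - j"] h True by (auto intro!: mult_right_mono)
      next
        case False
        then have "J h (i r - j) * x r \<le> 0" using J_nonneg[of h "i r - j"] by (simp add: mult_nonneg_nonpos)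
        also have "0 \<le> \<epsilon> * h * \<bar>x r\<bar>" using \<epsilon> h by simp
        finally show ?thesis .
      qed
    qed
    then have J: "(\<Sum>r<n. J h (i r - j) * x r) \<le> \<epsilon> * h * C" by (simp add: C_def sum_distrib_left)
    have intw: "integrable (count_space UNIV) (\<lambda>y. q h y * w (j + y))"
      and lew: "(LINT y|count_space UNIV. q h y * w (j + y)) \<le> w j"
      using w h unfolding supermedian_def by auto
    have "z j \<le> (LINT y|count_space UNIV. q h y * pot n i x (j + y)) - (LINT y|count_space UNIV. q h y * w (j + y)) + \<epsilon> * h * C"
      using pot_split[OF h(1), of n i x j] J lew unfolding z_def by simp
    also have "(LINT y|count_space UNIV. q h y * pot n i x (j + y)) - (LINT y|count_space UNIV. q h y * w (j + y)) =
        (LINT y|count_space UNIV. q h y * z (j + y))"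
      unfolding z_def by (subst Bochner_Integration.integral_diff[symmetric, OF pot_integrable[OF h(1)] intw]) (simp add: algebra_simps)
    also have "\<dots> \<le> (LINT y|count_space UNIV. q h y * s)"
    proof (rule integral_mono)
      show "integrable (count_space UNIV) (\<lambda>y. q h y * z (j + y))"
        using Bochner_Integration.integrable_diff[OF pot_integrable[OF h(1), of n i x j] intw]
        unfolding z_def by (simp add: algebra_simps)
    qed (use q_integrable[OF h(1)] q_nonneg zs in \<open>auto intro!: mult_left_mono\<close>)
    also have "\<dots> = exp (- \<beta> * h) * s" using q_mass[OF h(1)] by simp
    finally show ?thesis by simp
  qed
  have "s \<le> exp (- \<beta> * h) * s + \<epsilon> * h * C"
    unfolding s_def
  proof (rule cSUP_least)
    fix j show "z j \<le> exp (- \<beta> * h) * (SUP j. z j) + \<epsilon> * h * C"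
    proof (cases "0 < z j")
      case True then show ?thesis using step[OF True] unfolding s_def by simp
    next
      case False
      have "0 \<le> exp (- \<beta> * h) * s + \<epsilon> * h * C" using s \<epsilon> h C0 by simp
      then show ?thesis using False unfolding s_def by simp
    qed
  qed simp
  then have "s * (1 - exp (- \<beta> * h)) \<le> \<epsilon> * C * h" by (simp add: algebra_simps)
  moreover have "\<beta> * h / 2 \<le> 1 - exp (- \<beta> * h)"
  proof -
    have "exp (- \<beta> * h) * (1 + \<beta> * h) \<le> exp (- \<beta> * h) * exp (\<beta> * h)"
      using exp_ge_add_one_self[of "\<beta> * h"] by (intro mult_left_mono) auto
    also have "\<dots> = 1" by (simp flip: exp_add)
    finally have 1: "exp (- \<beta> * h) \<le> 1 / (1 + \<beta> * h)"
      using beta h by (simp add: pos_le_divide_eq add_pos_pos)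
    have "1 / (1 + \<beta> * h) \<le> 1 - \<beta> * h / 2"
    proof -
      have "0 \<le> \<beta> * h * (1 - \<beta> * h)" using h beta by simp
      then have "1 \<le> (1 - \<beta> * h / 2) * (1 + \<beta> * h)" by (simp add: algebra_simps)
      then show ?thesis using beta h by (simp add: pos_divide_le_eq add_pos_pos)
    qed
    then show ?thesis using 1 by linarith
  qed
  ultimately have "s * (\<beta> * h / 2) \<le> \<epsilon> * C * h" using s
    by (meson less_imp_le mult_left_mono order.trans)
  then have "s * \<beta> / 2 \<le> \<epsilon> * C" using h(1) by (simp add: field_simps)
  also have "\<epsilon> * C \<le> \<epsilon> * (C + 1)" using \<epsilon> by simp
  also have "\<dots> = s * \<beta> / 4"
  proof -
    have "C + 1 \<noteq> 0" using C0 by linarith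
    then show ?thesis unfolding \<epsilon>_def by (simp add: divide_simps)
  qed
  finally show False using s beta by simp
qed

text \<open>For small \<open>h\<close> the charge at \<open>i p\<close> is weighted by at least
  \<open>(1 - \<epsilon>) * h\<close> and every other charge by at most
  \<open>\<epsilon> * h\<close>. A positive \<open>x p\<close> would make the whole sum
  positive.\<close>

lemma charge_nonpos:
  fixes n :: nat
  assumes inj: "inj_on i {..<n}" and p: "p < n"
    and le: "\<And>h. 0 < h \<Longrightarrow> (\<Sum>r<n. J h (i r - i p) * x r) \<le> 0"
  shows "x p \<le> 0"
proof (rule ccontr)
  assume "\<not> x p \<le> 0"
  then have xp: "0 < x p" by simp
  define C where "C = (\<Sum>r<n. \<bar>x r\<bar>)"
  have C: "0 \<le> C" unfolding C_def by (intro sum_nonneg) auto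
  \<comment> \<open>The loss on the diagonal and the other terms together cost
    \<open>\<epsilon> * (x p + C)\<close>, which is less than half of \<open>x p\<close>.\<close>
  define \<epsilon> where "\<epsilon> = x p / (2 * (x p + C + 1))"
  have \<epsilon>: "0 < \<epsilon>" unfolding \<epsilon>_def using xp C by (intro divide_pos_pos) auto
  obtain h0 where h0: "0 < h0" "\<And>h. 0 < h \<and> h < h0 \<longrightarrow>
      (\<forall>x. x \<noteq> 0 \<longrightarrow> J h x \<le> \<epsilon> * h) \<and> (1 - \<epsilon>) * h \<le> J h 0"
    using J_small[OF \<epsilon>] by blast
  define h where "h = h0 / 2"
  have h: "0 < h" "h < h0" using h0 by (auto simp: h_def)
  have "(1 - \<epsilon>) * h * x p - \<epsilon> * h * C \<le> J h 0 * x p + (\<Sum>r\<in>{..<n} - {p}. J h (i r - i p) * x r)"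
  proof -
    have "(1 - \<epsilon>) * h * x p \<le> J h 0 * x p" using h0 h xp by (intro mult_right_mono) auto
    moreover have "- (\<epsilon> * h * C) \<le> (\<Sum>r\<in>{..<n} - {p}. - (\<epsilon> * h * \<bar>x r\<bar>))"
    proof -
      have "(\<Sum>r\<in>{..<n} - {p}. \<epsilon> * h * \<bar>x r\<bar>) \<le> (\<Sum>r<n. \<epsilon> * h * \<bar>x r\<bar>)"
        using \<epsilon> h by (intro sum_mono2) auto
      then show ?thesis by (simp add: sum_negf C_def sum_distrib_left)
    qed
    moreover have "(\<Sum>r\<in>{..<n} - {p}. - (\<epsilon> * h * \<bar>x r\<bar>)) \<le> (\<Sum>r\<in>{..<n} - {p}. J h (i r - i p) * x r)"
    proof (rule sum_mono)
      fix r assume r: "r \<in> {..<n} - {p}"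
      then have "i r - i p \<noteq> 0" using inj p by (auto dest: inj_onD)
      then have "J h (i r - i p) * \<bar>x r\<bar> \<le> \<epsilon> * h * \<bar>x r\<bar>" using h0 h by (intro mult_right_mono) auto
      moreover have "- (J h (i r - i p) * \<bar>x r\<bar>) \<le> J h (i r - i p) * x r"
        using mult_left_mono[OF _ J_nonneg[of h "i r - i p"], of "- \<bar>x r\<bar>" "x r"] by simp
      ultimately show "- (\<epsilon> * h * \<bar>x r\<bar>) \<le> J h (i r - i p) * x r" by linarith
    qed
    ultimately show ?thesis by linarith
  qed
  also have "\<dots> = (\<Sum>r<n. J h (i r - i p) * x r)"
    using p by (subst sum.remove[of "{..<n}" p]) auto
  also have "\<dots> \<le> 0" by (rule le[OF h(1)])
  finally have "h * (x p - \<epsilon> * (x p + C)) \<le> 0" by (simp add: algebra_simps)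
  then have "x p \<le> \<epsilon> * (x p + C)" using h by (simp add: mult_le_0_iff)
  also have "\<dots> \<le> \<epsilon> * (x p + C + 1)" using \<epsilon> by simp
  also have "\<dots> = x p / 2"
  proof -
    have "x p + C + 1 \<noteq> 0" using xp C by linarith
    then show ?thesis unfolding \<epsilon>_def by (simp add: divide_simps)
  qed
  finally show False using xp by simp
qed

lemma pot_uminus: "pot n i (\<lambda>r. - x r) j = - pot n i x j"
  by (simp add: pot_def sum_negf)

lemma pot_nonneg:
  assumes "\<And>p. p < n \<Longrightarrow> 0 \<le> pot n i x (i p)" shows "0 \<le> pot n i x j"
  using domination[of "\<lambda>_. 0" n "\<lambda>r. - x r" i j] supermedian_const[of 0] assms by (auto simp: pot_uminus)

text \<open>This makes the potential matrix invertible. By the maximum principle for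
  \<open>x\<close> and \<open>- x\<close> the potential vanishes everywhere, so the Markov splitting
  leaves a vanishing sum of charges collected before \<open>h\<close>.\<close>

lemma pot_eq_0_imp:
  assumes inj: "inj_on i {..<n}" and 0: "\<And>p. p < n \<Longrightarrow> pot n i x (i p) = 0" and p: "p < n"
  shows "x p = 0"
proof -
  have 1: "pot n i x j = 0" for j
    using pot_nonneg[of n i x j] pot_nonneg[of n i "\<lambda>r. - x r" j] 0 by (auto simp: pot_uminus)
  then have J: "(\<Sum>r<n. J h (i r - i p) * x r) = 0" if "0 < h" for h
    using pot_split[OF that, of n i x "i p"] by simp
  have "x p \<le> 0" using charge_nonpos[OF inj p, of x] J by simp
  moreover have "- x p \<le> 0" using charge_nonpos[OF inj p, of "\<lambda>r. - x r"] J by (simp add: sum_negf)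
  ultimately show ?thesis by simp
qed

text \<open>The potential lies below \<open>w\<close> everywhere and touches it at
  \<open>i p\<close>. Its average after time \<open>h\<close> is then at most
  \<open>w (i p)\<close>, so the charge collected before \<open>h\<close> cannot be negative. The
  lemma serves the row sums of the inverse, with \<open>w = 1\<close>, and the row vector of the
  perturbation.\<close>

lemma charge_nonneg:
  assumes inj: "inj_on i {..<n}" and p: "p < n" and w: "supermedian w"
    and eq: "\<And>p. p < n \<Longrightarrow> pot n i x (i p) = w (i p)"
  shows "0 \<le> x p"
proof -
  have dom: "pot n i x j \<le> w j" for j using domination[OF w] eq by simp
  have "- x p \<le> 0"
  proof (rule charge_nonpos[OF inj p])
    fix h :: real assume h: "0 < h"
    have "w (i p) = (LINT y|count_space UNIV. q h y * pot n i x (i p + y)) + (\<Sum>r<n. J h (i r - i p) * x r)"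
      using pot_split[OF h, of n i x "i p"] eq[OF p] by simp
    also have "(LINT y|count_space UNIV. q h y * pot n i x (i p + y)) \<le> (LINT y|count_space UNIV. q h y * w (i p + y))"
      using w h q_nonneg dom unfolding supermedian_def
      by (intro integral_mono pot_integrable) (auto intro!: mult_left_mono)
    also have "\<dots> \<le> w (i p)" using w h unfolding supermedian_def by blast
    finally show "(\<Sum>r<n. J h (i r - i p) * - x r) \<le> 0" by (simp add: sum_negf)
  qed
  then show ?thesis by simp
qed

text \<open>Column \<open>r\<close> of the inverse is the charge whose potential on the points is
  the indicator of \<open>i r\<close>. At another point the potential is zero while its average
  after time \<open>h\<close> is non-negative, so what is collected before \<open>h\<close> must not
  be positive.\<close>

lemma charge_offdiag:
  assumes inj: "inj_on i {..<n}" and p: "p < n" and pr: "p \<noteq> r"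
    and eq: "\<And>p. p < n \<Longrightarrow> pot n i x (i p) = (if p = r then 1 else 0)"
  shows "x p \<le> 0"
proof (rule charge_nonpos[OF inj p])
  fix h :: real assume h: "0 < h"
  have "0 \<le> pot n i x j" for j by (rule pot_nonneg) (simp add: eq)
  then have "0 \<le> (LINT y|count_space UNIV. q h y * pot n i x (i p + y))"
    using q_nonneg by (intro Bochner_Integration.integral_nonneg) auto
  then show "(\<Sum>r<n. J h (i r - i p) * x r) \<le> 0"
    using pot_split[OF h, of n i x "i p"] eq[OF p] pr by simp
qed

end

section \<open>Inverses of potential matrices and of their rank one perturbations\<close>

context convolution_potential
begin

lemma potential_matrix_inverse:
  fixes n :: nat
  assumes inj: "inj_on i {..<n}"
  shows "\<exists>B. \<forall>p<n. \<forall>q<n. (\<Sum>k<n. u (i k - i p) * B k q) = (if p = q then 1 else 0) \<and>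
    (\<Sum>k<n. B p k * u (i q - i k)) = (if p = q then 1 else 0)"
proof -
  define U where "U = Matrix.mat n n (\<lambda>(p, k). u (i k - i p))"
  have U: "U \<in> carrier_mat n n" by (simp add: U_def)
  have "Determinant.det U \<noteq> 0"
  proof
    assume "Determinant.det U = 0"
    then obtain v where v: "v \<in> carrier_vec n" "v \<noteq> 0\<^sub>v n" "U *\<^sub>v v = 0\<^sub>v n"
      using det_0_iff_vec_prod_zero[OF U] by blast
    have "pot n i (\<lambda>k. vec_index v k) (i p) = 0" if p: "p < n" for p
    proof -
      have "vec_index (U *\<^sub>v v) p = (\<Sum>k<n. u (i k - i p) * vec_index v k)"
        using v(1) p by (simp add: U_def scalar_prod_def atLeast0LessThan)
      then show ?thesis using v(3) p by (simp add: pot_def)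
    qed
    then have "vec_index v p = 0" if "p < n" for p using pot_eq_0_imp[OF inj _ that] by blast
    then have "v = 0\<^sub>v n" using v(1) by (intro eq_vecI) auto
    then show False using v(2) by simp
  qed
  then have "U \<in> Units (ring_mat TYPE(real) n ())" by (rule det_non_zero_imp_unit[OF U])
  then obtain V where V: "V \<in> carrier_mat n n" "V * U = 1\<^sub>m n" "U * V = 1\<^sub>m n"
    by (auto simp: Units_def ring_mat_def)
  show ?thesis
  proof (intro exI[of _ "\<lambda>p q. V $$ (p, q)"] allI impI conjI)
    fix p q assume pq: "p < n" "q < n"
    have "(U * V) $$ (p, q) = (\<Sum>k<n. u (i k - i p) * V $$ (k, q))"
      using V(1) pq by (simp add: U_def scalar_prod_def atLeast0LessThan)
    then show "(\<Sum>k<n. u (i k - i p) * V $$ (k, q)) = (if p = q then 1 else 0)" using V(3) pq by simp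
    have "(V * U) $$ (p, q) = (\<Sum>k<n. V $$ (p, k) * u (i q - i k))"
      using V(1) pq by (simp add: U_def scalar_prod_def atLeast0LessThan)
    then show "(\<Sum>k<n. V $$ (p, k) * u (i q - i k)) = (if p = q then 1 else 0)" using V(2) pq by simp
  qed
qed

text \<open>
  Adding \<open>w (- k)\<close> to the potential density is a rank one perturbation. The inverse remains an
  M-matrix because the row sums of the inverse \<open>B\<close> of the potential matrix and the row vector
  \<open>w (- i k) B\<close> are non-negative; the latter is a statement about \<open>w\<close> on the reflected set \<open>- i\<close>.
\<close>

lemma perturbed_potential_inverse_M_matrix:
  fixes n :: nat
  assumes w: "supermedian w" and inj: "inj_on i {..<n}"
  shows "\<exists>A. inverse_M_matrix n (\<lambda>p q. u (i q - i p) + w (- i q)) A \<and>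
    (\<forall>p \<eta>. p < n \<longrightarrow> \<eta> < u 0 \<longrightarrow> (\<forall>q<n. q \<noteq> p \<longrightarrow> u (i p - i q) \<le> \<eta>) \<longrightarrow> 0 \<le> \<eta> \<longrightarrow> A p p \<le> 1 / (u 0 - \<eta>))"
proof -
  obtain B where UB: "\<And>p q. p < n \<Longrightarrow> q < n \<Longrightarrow> (\<Sum>k<n. u (i k - i p) * B k q) = (if p = q then 1 else 0)"
    and BU: "\<And>p q. p < n \<Longrightarrow> q < n \<Longrightarrow> (\<Sum>k<n. B p k * u (i q - i k)) = (if p = q then 1 else 0)"
    using potential_matrix_inverse[OF inj] by blast
  define g where "g = (\<lambda>k. w (- i k))"
  define b where "b = (\<lambda>p. \<Sum>k<n. B p k)"
  define c where "c = (\<lambda>q. \<Sum>k<n. g k * B k q)"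
  define \<gamma> where "\<gamma> = 1 + (\<Sum>q<n. c q)"
  have w0: "0 \<le> w x" for x using w by (auto simp: supermedian_def)
  have Boff: "B p q \<le> 0" if "p < n" "q < n" "p \<noteq> q" for p q
    by (rule charge_offdiag[OF inj that(1,3)]) (use UB that in \<open>simp add: pot_def\<close>)
  have Ub: "(\<Sum>k<n. u (i k - i p) * b k) = 1" if "p < n" for p
  proof -
    have "(\<Sum>k<n. u (i k - i p) * b k) = (\<Sum>q<n. \<Sum>k<n. u (i k - i p) * B k q)"
      unfolding b_def sum_distrib_left by (rule sum.swap)
    also have "\<dots> = (\<Sum>q<n. if p = q then 1 else 0)" using UB that by (intro sum.cong) auto
    finally show ?thesis using that by simp
  qed
  have cU: "(\<Sum>k<n. c k * u (i q - i k)) = g q" if "q < n" for q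
  proof -
    have "(\<Sum>k<n. c k * u (i q - i k)) = (\<Sum>l<n. g l * (\<Sum>k<n. B l k * u (i q - i k)))"
      unfolding c_def sum_distrib_left sum_distrib_right mult.assoc by (rule sum.swap)
    also have "\<dots> = (\<Sum>l<n. if l = q then g q else 0)" using BU that by (intro sum.cong) auto
    finally show ?thesis using that by simp
  qed
  have b0: "0 \<le> b p" if "p < n" for p
    by (rule charge_nonneg[OF inj that supermedian_const[of 1]]) (use Ub in \<open>auto simp: pot_def\<close>)
  have c0: "0 \<le> c p" if "p < n" for p
  proof (rule charge_nonneg[OF _ that w])
    show "inj_on (\<lambda>k. - i k) {..<n}" using inj by (auto simp: inj_on_def)
    fix p assume p: "p < n"
    show "pot n (\<lambda>k. - i k) c (- i p) = w (- i p)"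
      using cU[OF p] by (simp add: pot_def g_def mult.commute)
  qed
  have \<gamma>: "1 \<le> \<gamma>" unfolding \<gamma>_def using sum_nonneg[of "{..<n}" c] c0 by simp
  have gb: "(\<Sum>k<n. g k * b k) = \<gamma> - 1"
  proof -
    have "(\<Sum>k<n. g k * b k) = (\<Sum>q<n. c q)"
      unfolding b_def c_def sum_distrib_left by (rule sum.swap)
    then show ?thesis by (simp add: \<gamma>_def)
  qed
  \<comment> \<open>The Sherman-Morrison formula: \<open>b\<close> is \<open>B\<close> applied to
    the constant vector \<open>1\<close>, \<open>c\<close> is \<open>g\<close> applied to
    \<open>B\<close> from the left, and \<gamma> is \<open>1\<close> plus the total of
    \<open>c\<close>. As \<open>b\<close> and \<open>c\<close> are non-negative, every entry only
    decreases.\<close>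
  define A where "A = (\<lambda>p q. B p q - b p * c q / \<gamma>)"
  have le: "A p q \<le> B p q" if "p < n" "q < n" for p q
    unfolding A_def using b0 c0 \<gamma> that by simp
  have "inverse_M_matrix n (\<lambda>p q. u (i q - i p) + w (- i q)) A"
    unfolding inverse_M_matrix_def
  proof (intro allI impI conjI)
    fix p q assume p: "p < n" and q: "q < n"
    show "0 \<le> u (i q - i p) + w (- i q)" using u_nonneg w0 by simp
    show "A p q \<le> 0" if "p \<noteq> q" using le[OF p q] Boff[OF p q that] by simp
    have "(\<Sum>k<n. (u (i k - i p) + g k) * A k q) = (\<Sum>k<n. u (i k - i p) * B k q) + (\<Sum>k<n. g k * B k q) -
        (\<Sum>k<n. u (i k - i p) * b k) * (c q / \<gamma>) - (\<Sum>k<n. g k * b k) * (c q / \<gamma>)"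
      unfolding A_def by (simp add: algebra_simps sum.distrib sum_subtractf sum_distrib_left sum_distrib_right)
    also have "\<dots> = (if p = q then 1 else 0) + c q - \<gamma> * (c q / \<gamma>)"
      unfolding UB[OF p q] Ub[OF p] gb by (simp only: left_diff_distrib) (simp add: c_def)
    also have "\<dots> = (if p = q then 1 else 0)" using \<gamma> by simp
    finally show "(\<Sum>k<n. (u (i k - i p) + w (- i k)) * A k q) = (if p = q then 1 else 0)" unfolding g_def .
    have "(\<Sum>k<n. A p k * (u (i q - i k) + g q)) = (\<Sum>k<n. B p k * u (i q - i k)) + b p * g q -
        (b p / \<gamma>) * (\<Sum>k<n. c k * u (i q - i k)) - (b p / \<gamma>) * g q * (\<Sum>k<n. c k)"
    proof -
      have "A p k * (u (i q - i k) + g q) = B p k * u (i q - i k) + B p k * g q -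
          (b p / \<gamma>) * (c k * u (i q - i k)) - (b p / \<gamma>) * g q * c k" for k
        unfolding A_def by (simp add: algebra_simps add_divide_distrib)
      then show ?thesis
        unfolding b_def by (simp only: sum.distrib sum_subtractf sum_distrib_left[symmetric] sum_distrib_right[symmetric])
    qed
    also have "\<dots> = (if p = q then 1 else 0) + b p * g q - (b p / \<gamma>) * g q * \<gamma>"
      unfolding BU[OF p q] cU[OF q] by (simp add: \<gamma>_def algebra_simps add_divide_distrib)
    also have "\<dots> = (if p = q then 1 else 0)" using \<gamma> by simp
    finally show "(\<Sum>k<n. A p k * (u (i q - i k) + w (- i q))) = (if p = q then 1 else 0)" unfolding g_def .
  qed
  moreover have "A p p \<le> 1 / (u 0 - \<eta>)"
    if p: "p < n" and \<eta>: "\<eta> < u 0" "\<forall>q<n. q \<noteq> p \<longrightarrow> u (i p - i q) \<le> \<eta>" "0 \<le> \<eta>" for p \<eta>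
  proof -
    \<comment> \<open>In the identity \<open>B U = 1\<close> at \<open>(p, p)\<close> the
      off-diagonal entries of \<open>B\<close> are not positive, so replacing \<open>u\<close> there
      by its upper bound \<eta> lowers the sum. The row sum \<open>b p\<close> is non-negative and
      can then be dropped.\<close>
    have "\<eta> * (\<Sum>k\<in>{..<n} - {p}. B p k) = (\<Sum>k\<in>{..<n} - {p}. B p k * \<eta>)"
      by (simp add: sum_distrib_left mult.commute)
    also have "\<dots> \<le> (\<Sum>k\<in>{..<n} - {p}. B p k * u (i p - i k))"
      using \<eta> Boff[OF p] by (intro sum_mono mult_left_mono_neg) auto
    also have "\<dots> = 1 - B p p * u 0" using BU[OF p p] p by (subst (asm) sum.remove[of _ p]) auto
    also have "(\<Sum>k\<in>{..<n} - {p}. B p k) = b p - B p p"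
      unfolding b_def using p by (subst (2) sum.remove[of _ p]) auto
    finally have "B p p * (u 0 - \<eta>) \<le> 1 - \<eta> * b p" by (simp add: algebra_simps)
    also have "\<dots> \<le> 1" using \<eta> b0[OF p] by simp
    finally have "B p p \<le> 1 / (u 0 - \<eta>)" using \<eta> by (simp add: pos_le_divide_eq)
    then show ?thesis using le[OF p p] by simp
  qed
  ultimately show ?thesis by blast
qed

end

section \<open>Killed Levy processes\<close>

locale levy = prob_space M for M :: "'a measure" +
  fixes X :: "real \<Rightarrow> 'a \<Rightarrow> int" and \<beta> :: real
  assumes levy: "levy_process M X" and beta: "0 < \<beta>"
begin

definition pr :: "real \<Rightarrow> int \<Rightarrow> real" where
  "pr t x = prob {\<omega> \<in> space M. X t \<omega> = x}"

definition q :: "real \<Rightarrow> int \<Rightarrow> real" where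
  "q t x = exp (- \<beta> * t) * pr t x"

definition u :: "int \<Rightarrow> real" where
  "u x = enn2real (\<integral>\<^sup>+t. ennreal (q t x) * indicator {0..} t \<partial>lborel)"

definition J :: "real \<Rightarrow> int \<Rightarrow> real" where
  "J h x = enn2real (\<integral>\<^sup>+t. ennreal (q t x) * indicator {0..<h} t \<partial>lborel)"

lemma X_measurable[measurable]: "0 \<le> t \<Longrightarrow> X t \<in> measurable M (count_space UNIV)"
  using levy by (simp add: levy_process_def)

lemma pr_nonneg: "0 \<le> pr t x" and pr_le_1: "pr t x \<le> 1"
  by (simp_all add: pr_def)

lemma increment:
  assumes "0 \<le> s" "0 \<le> t"
  shows "prob {\<omega> \<in> space M. X (s + t) \<omega> - X s \<omega> = x} = pr t x"
proof -
  have eq: "distr M (count_space UNIV) (\<lambda>\<omega>. X (s + t) \<omega> - X s \<omega>) = distr M (count_space UNIV) (X t)"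
  proof -
    have "\<forall>s t. 0 \<le> s \<and> s \<le> t \<longrightarrow>
        distr M (count_space UNIV) (\<lambda>\<omega>. X t \<omega> - X s \<omega>) = distr M (count_space UNIV) (X (t - s))"
      using levy unfolding levy_process_def by blast
    from this[rule_format, of s "s + t"] show ?thesis using assms by simp
  qed
  have [measurable]: "X (s + t) \<in> measurable M (count_space UNIV)" "X s \<in> measurable M (count_space UNIV)"
    using assms by auto
  have m: "(\<lambda>\<omega>. X (s + t) \<omega> - X s \<omega>) \<in> measurable M (count_space UNIV)" by measurable
  have "prob {\<omega> \<in> space M. X (s + t) \<omega> - X s \<omega> = x} = measure (distr M (count_space UNIV) (\<lambda>\<omega>. X (s + t) \<omega> - X s \<omega>)) {x}"
    using m by (subst measure_distr) (auto intro!: arg_cong[where f = prob])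
  also have "\<dots> = pr t x"
    unfolding eq pr_def using assms by (subst measure_distr) (auto intro!: arg_cong[where f = prob])
  finally show ?thesis .
qed

lemma X_0: "AE \<omega> in M. X 0 \<omega> = 0"
  using levy by (simp add: levy_process_def)

lemma pr_sum: "0 \<le> t \<Longrightarrow> (\<integral>\<^sup>+x. ennreal (pr t x) \<partial>count_space UNIV) = 1"
proof -
  assume t: "0 \<le> t"
  interpret D: prob_space "distr M (count_space UNIV) (X t)" using t by (intro prob_space_distr) simp
  have "(\<integral>\<^sup>+x. ennreal (pr t x) \<partial>count_space UNIV) = (\<integral>\<^sup>+x. emeasure (distr M (count_space UNIV) (X t)) {x} \<partial>count_space UNIV)"
  proof (rule nn_integral_cong)
    fix x :: int
    have "emeasure (distr M (count_space UNIV) (X t)) {x} = emeasure M {\<omega> \<in> space M. X t \<omega> = x}"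
      using t by (subst emeasure_distr) (auto intro!: arg_cong[where f = "emeasure M"])
    then show "ennreal (pr t x) = emeasure (distr M (count_space UNIV) (X t)) {x}"
      by (simp add: pr_def emeasure_eq_measure)
  qed
  also have "\<dots> = emeasure (distr M (count_space UNIV) (X t)) UNIV"
    by (rule emeasure_countable_singleton[symmetric]) auto
  also have "\<dots> = 1" using D.emeasure_space_1 by simp
  finally show ?thesis .
qed

lemma pr_add:
  assumes s: "0 \<le> s" and t: "0 \<le> t"
  shows "ennreal (pr (s + t) x) = (\<integral>\<^sup>+y. ennreal (pr s y * pr t (x - y)) \<partial>count_space UNIV)"
proof -
  \<comment> \<open>Independence of increments is formulated for infinite non-decreasing time
    sequences, so the times \<open>0\<close>, \<open>s\<close>, \<open>s + t\<close> are continued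
    by a constant.\<close>
  define \<tau> where "\<tau> = (\<lambda>i::nat. if i = 0 then 0 else if i = 1 then s else s + t)"
  have \<tau>: "incseq \<tau>" "0 \<le> \<tau> 0" using s t by (auto simp: \<tau>_def incseq_def)
  let ?D = "\<lambda>i \<omega>. X (\<tau> (Suc i)) \<omega> - X (\<tau> i) \<omega>"
  have ind: "indep_vars (\<lambda>_. count_space UNIV) ?D {..<2}"
    using levy \<tau> unfolding levy_process_def by blast
  have D0: "?D 0 = (\<lambda>\<omega>. X (0 + s) \<omega> - X 0 \<omega>)" and D1: "?D 1 = (\<lambda>\<omega>. X (s + t) \<omega> - X s \<omega>)"
    by (auto simp: \<tau>_def fun_eq_iff)
  have m: "?D 0 \<in> measurable M (count_space UNIV)" "?D 1 \<in> measurable M (count_space UNIV)"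
  proof -
    have [measurable]: "X (s + t) \<in> measurable M (count_space UNIV)" "X s \<in> measurable M (count_space UNIV)"
      "X (0 + s) \<in> measurable M (count_space UNIV)" "X 0 \<in> measurable M (count_space UNIV)"
      using s t by auto
    show "?D 0 \<in> measurable M (count_space UNIV)" "?D 1 \<in> measurable M (count_space UNIV)"
      unfolding D0 D1 by measurable
  qed
  let ?A = "\<lambda>y. {\<omega> \<in> space M. ?D 0 \<omega> = y \<and> ?D 1 \<omega> = x - y}"
  have A: "?A y \<in> sets M" for y using m by measurable
  have pA: "prob (?A y) = pr s y * pr t (x - y)" for y
  proof -
    have "prob (\<Inter>i\<in>{0, 1}. ?D i -` (if i = 0 then {y} else {x - y}) \<inter> space M) =
        (\<Prod>i\<in>{0, 1}. prob (?D i -` (if i = 0 then {y} else {x - y}) \<inter> space M))"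
      by (rule indep_varsD[OF ind]) auto
    moreover have "(\<Inter>i\<in>{0, 1}. ?D i -` (if i = 0 then {y} else {x - y}) \<inter> space M) = ?A y"
      by auto
    moreover have "?D 0 -` {y} \<inter> space M = {\<omega> \<in> space M. X (0 + s) \<omega> - X 0 \<omega> = y}"
      "?D 1 -` {x - y} \<inter> space M = {\<omega> \<in> space M. X (s + t) \<omega> - X s \<omega> = x - y}"
      unfolding D0 D1 by auto
    ultimately show ?thesis using increment[of 0 s y] increment[of s t "x - y"] s t by simp
  qed
  have "emeasure M {\<omega> \<in> space M. X (s + t) \<omega> = x} = emeasure M (\<Union>y. ?A y)"
  proof (rule emeasure_eq_AE)
    show "AE \<omega> in M. \<omega> \<in> {\<omega> \<in> space M. X (s + t) \<omega> = x} \<longleftrightarrow> \<omega> \<in> (\<Union>y. ?A y)"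
      using X_0 by eventually_elim (auto simp: \<tau>_def)
    show "{\<omega> \<in> space M. X (s + t) \<omega> = x} \<in> sets M"
      using measurable_sets[OF X_measurable, of "s + t" "{x}"] s t by (simp add: vimage_def Int_def conj_commute)
    show "(\<Union>y. ?A y) \<in> sets M" using A by (intro sets.countable_UN'') auto
  qed
  also have "\<dots> = (\<integral>\<^sup>+y. emeasure M (?A y) \<partial>count_space UNIV)"
    using A by (intro emeasure_UN_countable) (auto simp: disjoint_family_on_def)
  finally show ?thesis by (simp only: emeasure_eq_measure pA pr_def[of "s + t"])
qed

lemma pr_0_tendsto: "0 < \<epsilon> \<Longrightarrow> \<exists>t0>0. \<forall>t. 0 \<le> t \<and> t < t0 \<longrightarrow> 1 - pr t 0 \<le> \<epsilon>"
proof -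
  assume \<epsilon>: "0 < \<epsilon>"
  \<comment> \<open>On the integers a displacement above \<open>1 / 2\<close> is any non-zero
    displacement, so stochastic continuity controls the probability of having moved at all.\<close>
  have "((\<lambda>t. prob {\<omega> \<in> space M. real_of_int \<bar>X t \<omega> - X 0 \<omega>\<bar> > 1 / 2}) \<longlongrightarrow> 0) (at 0 within {0..})"
  proof -
    have "\<forall>s\<ge>0. \<forall>\<epsilon>>0. ((\<lambda>t. prob {\<omega> \<in> space M. real_of_int \<bar>X t \<omega> - X s \<omega>\<bar> > \<epsilon>}) \<longlongrightarrow> 0) (at s within {0..})"
      using levy unfolding levy_process_def by blast
    from this[rule_format, of 0 "1 / 2"] show ?thesis by simp
  qed
  then have "\<forall>\<^sub>F t in at 0 within {0..}. prob {\<omega> \<in> space M. real_of_int \<bar>X t \<omega> - X 0 \<omega>\<bar> > 1 / 2} < \<epsilon>"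
    using \<epsilon> by (auto dest: order_tendstoD)
  then obtain t0 where t0: "0 < t0" "\<And>t. 0 < t \<Longrightarrow> t < t0 \<Longrightarrow>
      prob {\<omega> \<in> space M. real_of_int \<bar>X t \<omega> - X 0 \<omega>\<bar> > 1 / 2} < \<epsilon>"
    unfolding eventually_at by (force simp: dist_real_def)
  have "1 - pr t 0 \<le> \<epsilon>" if t: "0 \<le> t" "t < t0" for t
  proof (cases "t = 0")
    case True
    have "prob {\<omega> \<in> space M. X 0 \<omega> = 0} = 1"
      using X_0 by (subst prob_eq_1) auto
    then show ?thesis using True \<epsilon> by (simp add: pr_def)
  next
    case False
    have m[measurable]: "X t \<in> measurable M (count_space UNIV)" "X 0 \<in> measurable M (count_space UNIV)"
      using t by auto
    have "1 - pr t 0 = prob {\<omega> \<in> space M. X t \<omega> \<noteq> 0}"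
      unfolding pr_def by (subst prob_compl[symmetric]) (auto intro!: arg_cong[where f = prob])
    also have "\<dots> = prob {\<omega> \<in> space M. real_of_int \<bar>X t \<omega> - X 0 \<omega>\<bar> > 1 / 2}"
    proof (rule finite_measure_eq_AE)
      show "AE \<omega> in M. \<omega> \<in> {\<omega> \<in> space M. X t \<omega> \<noteq> 0} \<longleftrightarrow>
          \<omega> \<in> {\<omega> \<in> space M. real_of_int \<bar>X t \<omega> - X 0 \<omega>\<bar> > 1 / 2}"
        using X_0
      proof eventually_elim
        fix \<omega> assume "X 0 \<omega> = 0"
        moreover have "X t \<omega> \<noteq> 0 \<longleftrightarrow> real_of_int \<bar>X t \<omega>\<bar> > 1 / 2"
        proof -
          have "X t \<omega> \<noteq> 0 \<longleftrightarrow> 1 \<le> \<bar>X t \<omega>\<bar>" by auto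
          then show ?thesis by linarith
        qed
        ultimately show "\<omega> \<in> {\<omega> \<in> space M. X t \<omega> \<noteq> 0} \<longleftrightarrow>
            \<omega> \<in> {\<omega> \<in> space M. real_of_int \<bar>X t \<omega> - X 0 \<omega>\<bar> > 1 / 2}" by simp
      qed
    qed measurable
    also have "\<dots> \<le> \<epsilon>" using t0(2)[of t] t False by simp
    finally show ?thesis .
  qed
  then show ?thesis using t0(1) by blast
qed

text \<open>The positions at \<open>s\<close> and \<open>s + t\<close> differ only if the increment
  is non-zero. The bound depends neither on \<open>s\<close> nor on \<open>x\<close>.\<close>

lemma pr_diff:
  assumes s: "0 \<le> s" and t: "0 \<le> t"
  shows "\<bar>pr (s + t) x - pr s x\<bar> \<le> 1 - pr t 0"
proof -
  let ?W = "{\<omega> \<in> space M. X (s + t) \<omega> - X s \<omega> \<noteq> 0}"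
  have m[measurable]: "X (s + t) \<in> measurable M (count_space UNIV)" "X s \<in> measurable M (count_space UNIV)"
    using s t by auto
  have W: "prob ?W = 1 - pr t 0"
    unfolding increment[OF s t, of 0, symmetric] by (subst prob_compl[symmetric]) (auto intro!: arg_cong[where f = prob])
  have "pr (s + t) x \<le> prob ({\<omega> \<in> space M. X s \<omega> = x} \<union> ?W)"
    unfolding pr_def by (intro finite_measure_mono) auto
  also have "\<dots> \<le> pr s x + prob ?W" unfolding pr_def by (intro measure_Un_le) auto
  finally have 1: "pr (s + t) x \<le> pr s x + prob ?W" .
  have "pr s x \<le> prob ({\<omega> \<in> space M. X (s + t) \<omega> = x} \<union> ?W)"
    unfolding pr_def by (intro finite_measure_mono) auto
  also have "\<dots> \<le> pr (s + t) x + prob ?W" unfolding pr_def by (intro measure_Un_le) auto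
  finally show ?thesis using 1 W by linarith
qed

text \<open>Continuity in \<open>t\<close> supplies the measurability under all time
  integrals.\<close>

lemma continuous_on_pr: "continuous_on {0..} (\<lambda>t. pr t x)"
  unfolding continuous_on_iff
proof (intro ballI allI impI)
  fix s \<epsilon> :: real assume s: "s \<in> {0..}" and \<epsilon>: "0 < \<epsilon>"
  obtain t0 where t0: "0 < t0" "\<And>t. 0 \<le> t \<Longrightarrow> t < t0 \<Longrightarrow> 1 - pr t 0 \<le> \<epsilon> / 2"
    using pr_0_tendsto[of "\<epsilon> / 2"] \<epsilon> by auto
  show "\<exists>d>0. \<forall>t\<in>{0..}. dist t s < d \<longrightarrow> dist (pr t x) (pr s x) < \<epsilon>"
  proof (intro exI[of _ t0] conjI t0 ballI impI)
    fix t :: real assume t: "t \<in> {0..}" "dist t s < t0"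
    have "\<bar>pr t x - pr s x\<bar> \<le> \<epsilon> / 2"
    proof (cases "s \<le> t")
      case True
      then show ?thesis using pr_diff[of s "t - s" x] t0(2)[of "t - s"] s t by (auto simp: dist_real_def)
    next
      case False
      then have "\<bar>pr s x - pr t x\<bar> \<le> \<epsilon> / 2"
        using pr_diff[of t "s - t" x] t0(2)[of "s - t"] s t by (auto simp: dist_real_def)
      then show ?thesis by (simp add: abs_minus_commute)
    qed
    then show "dist (pr t x) (pr s x) < \<epsilon>" using \<epsilon> by (simp add: dist_real_def)
  qed
qed

section \<open>The killed transition density and its potential\<close>

lemma q_nonneg: "0 \<le> q t x"
  by (simp add: q_def pr_nonneg)

lemma q_le: "q t x \<le> exp (- \<beta> * t)"
  unfolding q_def using pr_le_1[of t x] by (simp add: mult_left_le)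

lemma q_measurable:
  assumes [measurable]: "A \<in> sets borel" and A: "A \<subseteq> {0..}"
  shows "(\<lambda>t. ennreal (q t x) * indicator A t) \<in> borel_measurable borel"
proof -
  have "continuous_on {0..} (\<lambda>t. q t x)" unfolding q_def by (intro continuous_intros continuous_on_pr)
  then have [measurable]: "(\<lambda>t. indicator {0..} t *\<^sub>R q t x) \<in> borel_measurable borel"
    by (intro borel_measurable_continuous_on_indicator) auto
  have "(\<lambda>t. ennreal (q t x) * indicator A t) = (\<lambda>t. ennreal (indicator {0..} t *\<^sub>R q t x) * indicator A t)"
    using A by (auto simp: fun_eq_iff indicator_def)
  then show ?thesis by (simp only:) measurable
qed

lemma q_sum: "0 \<le> t \<Longrightarrow> (\<integral>\<^sup>+x. ennreal (q t x) \<partial>count_space UNIV) = ennreal (exp (- \<beta> * t))"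
  by (simp add: q_def ennreal_mult pr_nonneg nn_integral_cmult pr_sum)

lemma q_add:
  assumes "0 \<le> s" "0 \<le> t"
  shows "ennreal (q (s + t) x) = (\<integral>\<^sup>+y. ennreal (q s y) * ennreal (q t (x - y)) \<partial>count_space UNIV)"
proof -
  have "ennreal (q (s + t) x) = ennreal (exp (- \<beta> * (s + t))) * ennreal (pr (s + t) x)"
    by (simp add: q_def ennreal_mult pr_nonneg)
  also have "\<dots> = (\<integral>\<^sup>+y. ennreal (exp (- \<beta> * (s + t))) * ennreal (pr s y * pr t (x - y)) \<partial>count_space UNIV)"
    by (subst pr_add[OF assms]) (simp add: nn_integral_cmult)
  also have "\<dots> = (\<integral>\<^sup>+y. ennreal (q s y) * ennreal (q t (x - y)) \<partial>count_space UNIV)"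
  proof (rule nn_integral_cong)
    fix y
    have "exp (- \<beta> * (s + t)) * (pr s y * pr t (x - y)) = q s y * q t (x - y)"
      by (simp add: q_def exp_add[symmetric] algebra_simps)
    then show "ennreal (exp (- \<beta> * (s + t))) * ennreal (pr s y * pr t (x - y)) = ennreal (q s y) * ennreal (q t (x - y))"
      by (simp add: ennreal_mult[symmetric] pr_nonneg q_nonneg)
  qed
  finally show ?thesis .
qed

lemma nn_integral_exp: "(\<integral>\<^sup>+t. ennreal (exp (- \<beta> * t)) * indicator {0..} t \<partial>lborel) = ennreal (1 / \<beta>)"
proof -
  interpret E: prob_space "density lborel (exponential_density \<beta>)" using beta by (rule prob_space_exponential_density)
  have "1 = (\<integral>\<^sup>+t. ennreal (exponential_density \<beta> t) \<partial>lborel)"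
    using E.emeasure_space_1 by (simp add: emeasure_density)
  also have "\<dots> = (\<integral>\<^sup>+t. ennreal \<beta> * (ennreal (exp (- \<beta> * t)) * indicator {0..} t) \<partial>lborel)"
    using beta by (intro nn_integral_cong) (auto simp: exponential_density_def indicator_def ennreal_mult[symmetric] mult.commute)
  also have "\<dots> = ennreal \<beta> * (\<integral>\<^sup>+t. ennreal (exp (- \<beta> * t)) * indicator {0..} t \<partial>lborel)"
    by (rule nn_integral_cmult) auto
  finally have "ennreal (1 / \<beta>) * 1 = ennreal (1 / \<beta>) * (ennreal \<beta> * (\<integral>\<^sup>+t. ennreal (exp (- \<beta> * t)) * indicator {0..} t \<partial>lborel))"
    by simp
  also have "\<dots> = (\<integral>\<^sup>+t. ennreal (exp (- \<beta> * t)) * indicator {0..} t \<partial>lborel)"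
    using beta by (simp add: mult.assoc[symmetric] ennreal_mult[symmetric])
  finally show ?thesis by simp
qed

lemma nn_potential: "ennreal (u x) = (\<integral>\<^sup>+t. ennreal (q t x) * indicator {0..} t \<partial>lborel)"
  and u_bounded: "u x \<le> 1 / \<beta>"
proof -
  have le: "(\<integral>\<^sup>+t. ennreal (q t x) * indicator {0..} t \<partial>lborel) \<le> ennreal (1 / \<beta>)"
    unfolding nn_integral_exp[symmetric] using q_le by (intro nn_integral_mono mult_right_mono ennreal_leI) auto
  then show *: "ennreal (u x) = (\<integral>\<^sup>+t. ennreal (q t x) * indicator {0..} t \<partial>lborel)"
    unfolding u_def by (subst ennreal_enn2real) (auto simp: less_top[symmetric] top_unique)
  then show "u x \<le> 1 / \<beta>" using le beta by (metis ennreal_le_iff less_imp_le zero_less_divide_1_iff)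
qed

lemma u_nonneg: "0 \<le> u x"
  by (simp add: u_def)

lemma nn_partial_potential:
  assumes "0 \<le> h"
  shows "ennreal (J h x) = (\<integral>\<^sup>+t. ennreal (q t x) * indicator {0..<h} t \<partial>lborel)"
proof -
  have "(\<integral>\<^sup>+t. ennreal (q t x) * indicator {0..<h} t \<partial>lborel) \<le> (\<integral>\<^sup>+t. ennreal (q t x) * indicator {0..} t \<partial>lborel)"
    by (intro nn_integral_mono) (auto simp: indicator_def)
  then show ?thesis unfolding nn_potential[symmetric] J_def
    by (subst ennreal_enn2real) (auto simp: less_top[symmetric] top_unique)
qed

lemma u_sum: "(\<integral>\<^sup>+x. ennreal (u x) \<partial>count_space UNIV) = ennreal (1 / \<beta>)"
proof -
  have "(\<integral>\<^sup>+x. ennreal (u x) \<partial>count_space UNIV) =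
      (\<integral>\<^sup>+t. (\<integral>\<^sup>+x. ennreal (q t x) * indicator {0..} t \<partial>count_space UNIV) \<partial>lborel)"
    unfolding nn_potential by (rule nn_integral_count_space_nn_integral[symmetric]) (auto intro: q_measurable)
  also have "\<dots> = (\<integral>\<^sup>+t. ennreal (exp (- \<beta> * t)) * indicator {0..} t \<partial>lborel)"
    by (intro nn_integral_cong) (auto simp: nn_integral_multc q_sum split: split_indicator)
  finally show ?thesis unfolding nn_integral_exp .
qed

text \<open>The time integral is cut at \<open>h\<close>; the later part is shifted and rewritten by
  the Chapman-Kolmogorov equation, and Tonelli's theorem exchanges the sum with the
  integral.\<close>

lemma nn_u_split:
  assumes h: "0 \<le> h"
  shows "ennreal (u x) = (\<integral>\<^sup>+y. ennreal (q h y * u (x - y)) \<partial>count_space UNIV) + ennreal (J h x)"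
proof -
  have "ennreal (u x) = (\<integral>\<^sup>+t. ennreal (q t x) * indicator {h..} t + ennreal (q t x) * indicator {0..<h} t \<partial>lborel)"
    unfolding nn_potential using h by (intro nn_integral_cong) (auto simp: indicator_def)
  also have "\<dots> = (\<integral>\<^sup>+t. ennreal (q t x) * indicator {h..} t \<partial>lborel) + ennreal (J h x)"
    unfolding nn_partial_potential[OF h] using h by (intro nn_integral_add) (auto intro: q_measurable)
  also have "(\<integral>\<^sup>+t. ennreal (q t x) * indicator {h..} t \<partial>lborel) = (\<integral>\<^sup>+t. ennreal (q (h + t) x) * indicator {h..} (h + t) \<partial>lborel)"
    using h q_measurable[of "{h..}" x] by (subst nn_integral_real_affine[where c = 1 and t = h]) auto
  also have "\<dots> = (\<integral>\<^sup>+t. (\<integral>\<^sup>+y. ennreal (q h y) * (ennreal (q t (x - y)) * indicator {0..} t) \<partial>count_space UNIV) \<partial>lborel)"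
  proof (rule nn_integral_cong)
    fix t :: real
    show "ennreal (q (h + t) x) * indicator {h..} (h + t) =
        (\<integral>\<^sup>+y. ennreal (q h y) * (ennreal (q t (x - y)) * indicator {0..} t) \<partial>count_space UNIV)"
      using h by (cases "0 \<le> t") (auto simp: q_add)
  qed
  also have "\<dots> = (\<integral>\<^sup>+y. (\<integral>\<^sup>+t. ennreal (q h y) * (ennreal (q t (x - y)) * indicator {0..} t) \<partial>lborel) \<partial>count_space UNIV)"
    by (rule nn_integral_count_space_nn_integral) (auto intro!: borel_measurable_times_ennreal q_measurable)
  also have "\<dots> = (\<integral>\<^sup>+y. ennreal (q h y * u (x - y)) \<partial>count_space UNIV)"
  proof (rule nn_integral_cong)
    fix y
    have "(\<integral>\<^sup>+t. ennreal (q h y) * (ennreal (q t (x - y)) * indicator {0..} t) \<partial>lborel) = ennreal (q h y) * ennreal (u (x - y))"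
      unfolding nn_potential using q_measurable[of "{0..}"] by (intro nn_integral_cmult) auto
    then show "(\<integral>\<^sup>+t. ennreal (q h y) * (ennreal (q t (x - y)) * indicator {0..} t) \<partial>lborel) = ennreal (q h y * u (x - y))"
      by (simp add: ennreal_mult q_nonneg u_nonneg)
  qed
  finally show ?thesis .
qed

text \<open>Until a short time \<open>h\<close> the process most likely still sits at
  \<open>0\<close> and is alive, so the expected time spent there is nearly \<open>h\<close>. The
  bound for the other points is uniform because each of these events lies in the complement of
  \<open>X t = 0\<close>.\<close>

lemma J_small:
  assumes "0 < \<epsilon>"
  shows "\<exists>h0>0. \<forall>h. 0 < h \<and> h < h0 \<longrightarrow> (\<forall>x. x \<noteq> 0 \<longrightarrow> J h x \<le> \<epsilon> * h) \<and> (1 - \<epsilon>) * h \<le> J h 0"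
proof -
  obtain t0 where t0: "0 < t0" "\<And>t. 0 \<le> t \<Longrightarrow> t < t0 \<Longrightarrow> 1 - pr t 0 \<le> \<epsilon> / 2"
    using pr_0_tendsto[of "\<epsilon> / 2"] assms by auto
  \<comment> \<open>\<open>t0\<close> limits the probability of having moved and
    \<open>\<epsilon> / (2 * \<beta>)\<close> that of having been killed, each by
    \<open>\<epsilon> / 2\<close>.\<close>
  define h0 where "h0 = min t0 (\<epsilon> / (2 * \<beta>))"
  have h0: "0 < h0" using t0 assms beta by (simp add: h0_def)
  have ind: "(\<integral>\<^sup>+t. ennreal c * indicator {0..<h} t \<partial>lborel) = ennreal (c * h)" if "0 \<le> c" "0 < h" for c h :: real
    using that by (subst nn_integral_cmult_indicator) (auto simp: ennreal_mult)
  have "J h x \<le> \<epsilon> * h" if h: "0 < h" "h < h0" and x: "x \<noteq> 0" for h x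
  proof -
    have "q t x \<le> \<epsilon>" if t: "0 \<le> t" "t < h" for t
    proof -
      have "{\<omega> \<in> space M. X t \<omega> = x} \<subseteq> space M - {\<omega> \<in> space M. X t \<omega> = 0}" using x by auto
      then have "pr t x \<le> prob (space M - {\<omega> \<in> space M. X t \<omega> = 0})"
        unfolding pr_def using t by (intro finite_measure_mono) auto
      also have "\<dots> = 1 - pr t 0" unfolding pr_def using t by (intro prob_compl) auto
      also have "\<dots> \<le> \<epsilon> / 2" using t0(2)[of t] t h by (auto simp: h0_def)
      finally have "pr t x \<le> \<epsilon>" using assms by simp
      moreover have "q t x \<le> pr t x"
        unfolding q_def using pr_nonneg[of t x] beta t by (intro mult_left_le_one_le) auto
      ultimately show ?thesis by simp
    qed
    then have "(\<integral>\<^sup>+t. ennreal (q t x) * indicator {0..<h} t \<partial>lborel) \<le> (\<integral>\<^sup>+t. ennreal \<epsilon> * indicator {0..<h} t \<partial>lborel)"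
      by (intro nn_integral_mono) (auto simp: indicator_def intro!: ennreal_leI)
    then have "ennreal (J h x) \<le> ennreal (\<epsilon> * h)"
      using h assms by (simp add: nn_partial_potential ind)
    then show ?thesis using h assms by (subst (asm) ennreal_le_iff) auto
  qed
  moreover have "(1 - \<epsilon>) * h \<le> J h 0" if h: "0 < h" "h < h0" for h
  proof (cases "\<epsilon> \<le> 1")
    case True
    have "1 - \<epsilon> \<le> q t 0" if t: "0 \<le> t" "t < h" for t
    proof -
      have "\<beta> * t \<le> \<beta> * (\<epsilon> / (2 * \<beta>))" using t h beta by (intro mult_left_mono) (auto simp: h0_def)
      then have "\<beta> * t \<le> \<epsilon> / 2" using beta by simp
      then have "1 - \<epsilon> / 2 \<le> exp (- \<beta> * t)" using exp_ge_add_one_self[of "- \<beta> * t"] by simp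
      moreover have "1 - \<epsilon> / 2 \<le> pr t 0" using t0(2)[of t] t h by (auto simp: h0_def)
      ultimately have "(1 - \<epsilon> / 2) * (1 - \<epsilon> / 2) \<le> q t 0"
        unfolding q_def using True assms by (intro mult_mono) auto
      moreover have "1 - \<epsilon> \<le> (1 - \<epsilon> / 2) * (1 - \<epsilon> / 2)" by (simp add: algebra_simps)
      ultimately show ?thesis by simp
    qed
    then have "(\<integral>\<^sup>+t. ennreal (1 - \<epsilon>) * indicator {0..<h} t \<partial>lborel) \<le> (\<integral>\<^sup>+t. ennreal (q t 0) * indicator {0..<h} t \<partial>lborel)"
      by (intro nn_integral_mono) (auto simp: indicator_def intro!: ennreal_leI)
    then have "ennreal ((1 - \<epsilon>) * h) \<le> ennreal (J h 0)"
      using h True by (simp add: nn_partial_potential ind)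
    then show ?thesis by (subst (asm) ennreal_le_iff) (auto simp: J_def)
  next
    case False
    then have "(1 - \<epsilon>) * h \<le> 0" using h by (intro mult_nonpos_nonneg) auto
    also have "0 \<le> J h 0" by (simp add: J_def)
    finally show ?thesis .
  qed
  ultimately show ?thesis using h0 by blast
qed

sublocale convolution_potential \<beta> q J u
proof
  show "0 \<le> q h x" for h x by (rule q_nonneg)
  show int: "integrable (count_space UNIV) (q h)" if "0 < h" for h
    using q_sum[of h] that q_nonneg by (intro integrableI_nonneg) auto
  show "(LINT x|count_space UNIV. q h x) = exp (- \<beta> * h)" if "0 < h" for h
    using q_sum[of h] that q_nonneg by (subst integral_eq_nn_integral) auto
  show "u x = (LINT y|count_space UNIV. q h y * u (x - y)) + J h x" if "0 < h" for h x
  proof -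
    have *: "(LINT y|count_space UNIV. q h y * u (x - y)) = enn2real (\<integral>\<^sup>+y. ennreal (q h y * u (x - y)) \<partial>count_space UNIV)"
      using q_nonneg u_nonneg by (intro integral_eq_nn_integral) auto
    have split: "ennreal (u x) = (\<integral>\<^sup>+y. ennreal (q h y * u (x - y)) \<partial>count_space UNIV) + ennreal (J h x)"
      using that by (intro nn_u_split) auto
    then have "(\<integral>\<^sup>+y. ennreal (q h y * u (x - y)) \<partial>count_space UNIV) < \<infinity>"
      by (metis ennreal_add_eq_top ennreal_neq_top infinity_ennreal_def less_top)
    then have "ennreal (u x) = ennreal (LINT y|count_space UNIV. q h y * u (x - y)) + ennreal (J h x)"
      unfolding * split by simp
    also have "\<dots> = ennreal ((LINT y|count_space UNIV. q h y * u (x - y)) + J h x)"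
      unfolding * by (rule ennreal_plus[symmetric]) (auto simp: J_def)
    finally show ?thesis
      by (subst (asm) ennreal_inj) (auto simp: u_nonneg * J_def)
  qed
  show "u x \<le> 1 / \<beta>" for x by (rule u_bounded)
  show "\<exists>h0>0. \<forall>h. 0 < h \<and> h < h0 \<longrightarrow> (\<forall>x. x \<noteq> 0 \<longrightarrow> J h x \<le> \<epsilon> * h) \<and> (1 - \<epsilon>) * h \<le> J h 0"
    if "0 < \<epsilon>" for \<epsilon> by (rule J_small[OF that])
qed (auto simp: beta u_nonneg J_def)

lemma u_0_pos: "0 < u 0"
proof -
  obtain h0 where h0: "0 < h0" "\<And>h. 0 < h \<Longrightarrow> h < h0 \<Longrightarrow> (1 - 1 / 2) * h \<le> J h 0"
    using J_small[of "1 / 2"] by auto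
  define h where "h = h0 / 2"
  have h: "0 < h" "h < h0" using h0(1) by (auto simp: h_def)
  have "0 \<le> (LINT y|count_space UNIV. q h y * u (0 - y))"
    using q_nonneg u_nonneg by (intro Bochner_Integration.integral_nonneg) auto
  then show ?thesis using u_split[OF h(1), of 0] h0(2)[OF h] h(1) by simp
qed

text \<open>The total mass of \<open>u\<close> is \<open>1 / \<beta>\<close>, so only finitely many
  values can exceed \<eta>.\<close>

lemma u_vanishes_at_infinity:
  assumes "0 < \<eta>" shows "\<exists>L. \<forall>x. L \<le> \<bar>x\<bar> \<longrightarrow> u x \<le> \<eta>"
proof -
  let ?S = "{x. \<eta> < u x}"
  have "finite ?S"
  proof (rule ccontr)
    assume inf: "infinite ?S"
    have "(\<integral>\<^sup>+x. ennreal \<eta> * indicator ?S x \<partial>count_space UNIV) \<le> (\<integral>\<^sup>+x. ennreal (u x) \<partial>count_space UNIV)"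
      by (intro nn_integral_mono) (auto simp: indicator_def intro!: ennreal_leI)
    moreover have "(\<integral>\<^sup>+x. ennreal \<eta> * indicator ?S x \<partial>count_space UNIV) = \<infinity>"
      using inf assms by (subst nn_integral_cmult_indicator) (auto simp: emeasure_count_space_infinite ennreal_mult_top)
    ultimately show False unfolding u_sum by (simp add: top_unique)
  qed
  then obtain L where L: "\<And>x. x \<in> ?S \<Longrightarrow> \<bar>x\<bar> \<le> L"
    using finite_imageI[of ?S abs] bdd_above_finite[of "abs ` ?S"] unfolding bdd_above_def by blast
  have "\<forall>x. L + 1 \<le> \<bar>x\<bar> \<longrightarrow> u x \<le> \<eta>"
  proof (intro allI impI)
    fix x assume "L + 1 \<le> \<bar>x\<bar>"
    then show "u x \<le> \<eta>" using L[of x] by (cases "\<eta> < u x") auto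
  qed
  then show ?thesis by blast
qed

section \<open>Identification with the killed process and its excessive functions\<close>

lemma transition_eq_q:
  assumes "independent_exponential_time M X \<beta> \<xi>" "0 \<le> t"
  shows "transition M X \<xi> t j k = q t (k - j)"
  using transition_eq[OF levy assms(1) beta assms(2)] by (simp add: q_def pr_def)

lemma potential_density_eq_u:
  assumes "independent_exponential_time M X \<beta> \<xi>"
  shows "potential_density (transition M X \<xi>) j k = u (k - j)"
proof -
  have "potential_density (transition M X \<xi>) j k = (LINT t|lborel. indicator {0..} t * q t (k - j))"
    unfolding potential_density_def set_lebesgue_integral_def
    using transition_eq_q[OF assms] by (intro Bochner_Integration.integral_cong) (auto simp: indicator_def)
  also have "\<dots> = enn2real (\<integral>\<^sup>+t. ennreal (indicator {0..} t * q t (k - j)) \<partial>lborel)"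
  proof (rule integral_eq_nn_integral)
    have "continuous_on {0..} (\<lambda>t. q t (k - j))" unfolding q_def by (intro continuous_intros continuous_on_pr)
    then have "(\<lambda>t. indicator {0..} t *\<^sub>R q t (k - j)) \<in> borel_measurable borel"
      by (intro borel_measurable_continuous_on_indicator) auto
    then show "(\<lambda>t. indicator {0..} t * q t (k - j)) \<in> borel_measurable lborel" by simp
  qed (auto simp: q_nonneg)
  also have "(\<integral>\<^sup>+t. ennreal (indicator {0..} t * q t (k - j)) \<partial>lborel) = ennreal (u (k - j))"
    unfolding nn_potential by (intro nn_integral_cong) (auto simp: indicator_def)
  finally show ?thesis by (simp add: u_nonneg)
qed

lemma kernel_apply_shift:
  "kernel_apply (\<lambda>j k. v (k - j)) h j = (\<integral>\<^sup>+y. ennreal (v y) * h (j + y) \<partial>count_space UNIV)"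
proof -
  have "bij_betw (\<lambda>y. j + y) UNIV (UNIV :: int set)" by (rule bij_betw_byWitness[of _ "\<lambda>k. k - j"]) auto
  from nn_integral_bij_count_space[OF this, of "\<lambda>k. ennreal (v (k - j)) * h k"]
  show ?thesis by (simp add: kernel_apply_def)
qed

text \<open>The transition operators applied to \<open>f\<close> increase as time decreases, so the
  value at time \<open>h\<close> is at most the limit at \<open>0\<close>, which is
  \<open>f\<close>.\<close>

lemma excessive_imp_supermedian:
  assumes \<xi>: "independent_exponential_time M X \<beta> \<xi>" and f: "\<forall>k. 0 \<le> f k"
    and ex: "excessive (transition M X \<xi>) (\<lambda>k. ennreal (f k))"
  shows "supermedian f"
  unfolding supermedian_def
proof (intro conjI allI impI)
  show "0 \<le> f x" for x using f by blast
  fix h :: real and j assume h: "0 < h"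
  have "kernel_apply (transition M X \<xi> h) (\<lambda>k. ennreal (f k)) j \<le> ennreal (f j)"
  proof (rule tendsto_lowerbound)
    show "((\<lambda>t. kernel_apply (transition M X \<xi> t) (\<lambda>k. ennreal (f k)) j) \<longlongrightarrow> ennreal (f j)) (at_right 0)"
      using ex by (simp add: excessive_def)
    show "\<forall>\<^sub>F t in at_right 0. kernel_apply (transition M X \<xi> h) (\<lambda>k. ennreal (f k)) j \<le>
        kernel_apply (transition M X \<xi> t) (\<lambda>k. ennreal (f k)) j"
      using eventually_at_right_less[of "0::real"] eventually_at_right_real[OF h]
      by eventually_elim (use ex in \<open>auto simp: excessive_def\<close>)
  qed simp
  also have "kernel_apply (transition M X \<xi> h) (\<lambda>k. ennreal (f k)) j = kernel_apply (\<lambda>j k. q h (k - j)) (\<lambda>k. ennreal (f k)) j"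
    unfolding kernel_apply_def using transition_eq_q[OF \<xi>] h by simp
  also have "\<dots> = (\<integral>\<^sup>+y. ennreal (q h y * f (j + y)) \<partial>count_space UNIV)"
    unfolding kernel_apply_shift using f by (simp add: ennreal_mult q_nonneg)
  finally have le: "(\<integral>\<^sup>+y. ennreal (q h y * f (j + y)) \<partial>count_space UNIV) \<le> ennreal (f j)" .
  have nn: "0 \<le> q h y * f (j + y)" for y using q_nonneg f by simp
  show "integrable (count_space UNIV) (\<lambda>y. q h y * f (j + y))"
    using le nn by (intro integrableI_nonneg) (auto simp: less_top[symmetric] top_unique)
  have "(LINT y|count_space UNIV. q h y * f (j + y)) = enn2real (\<integral>\<^sup>+y. ennreal (q h y * f (j + y)) \<partial>count_space UNIV)"
    using nn by (intro integral_eq_nn_integral) auto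
  also have "\<dots> \<le> enn2real (ennreal (f j))" using le by (intro enn2real_mono) auto
  finally show "(LINT y|count_space UNIV. q h y * f (j + y)) \<le> f j" using f by simp
qed

end

section \<open>The upper limit of the permanental sequence\<close>

lemma permanental_expectation:
  assumes "permanental_sequence N Z \<alpha> K" "inj_on i {..<n}" "\<And>m. m < n \<Longrightarrow> 0 < s m"
  shows "(LINT \<omega>|N. exp (- (\<Sum>m<n. s m * Z (i m) \<omega>))) =
    perm_det n (\<lambda>p q. K (i p) (i q)) s powr (- \<alpha>)"
  using assms unfolding permanental_sequence_def by blast

text \<open>The one-point determinant is \<open>1 + K j j * s\<close>, so \<open>K j j\<close> is
  the scale of a gamma law of shape \<alpha>.\<close>

lemma permanental_marginal:
  assumes P: "permanental_sequence N Z \<alpha> K" and \<alpha>: "0 < \<alpha>" and K: "0 < K j j"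
  shows "distr N borel (Z j) = gamma_distr \<alpha> (1 / K j j)"
proof (rule laplace_transform_unique)
  interpret prob_space N using P by (simp add: permanental_sequence_def)
  have Z[measurable]: "Z j \<in> borel_measurable N" and nn: "\<And>\<omega>. \<omega> \<in> space N \<Longrightarrow> 0 \<le> Z j \<omega>"
    using P by (auto simp: permanental_sequence_def)
  interpret D: prob_space "distr N borel (Z j)" by (rule prob_space_distr) simp
  interpret G: prob_space "gamma_distr \<alpha> (1 / K j j)" using \<alpha> K by (intro prob_space_gamma_distr) auto
  show "finite_measure (distr N borel (Z j))" by (rule D.finite_measure_axioms)
  show "finite_measure (gamma_distr \<alpha> (1 / K j j))" by (rule G.finite_measure_axioms)
  show "AE x in distr N borel (Z j). 0 \<le> x" using nn by (subst AE_distr_iff) auto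
  show "AE x in gamma_distr \<alpha> (1 / K j j). 0 \<le> x" by (rule AE_gamma_distr_nonneg)
  fix s :: real assume s: "0 < s"
  have "expectation (\<lambda>\<omega>. exp (- (\<Sum>m<(1::nat). s * Z j \<omega>))) =
      perm_det 1 (\<lambda>p q. K j j) (\<lambda>_. s) powr (- \<alpha>)"
    by (rule permanental_expectation[OF P, where i = "\<lambda>_. j" and n = 1 and s = "\<lambda>_. s"]) (use s in \<open>auto simp: inj_on_def\<close>)
  then have E: "expectation (\<lambda>\<omega>. exp (- (s * Z j \<omega>))) = (1 + K j j * s) powr (- \<alpha>)"
    unfolding one_plus_mult_diag by (subst (asm) det_single) auto
  have "(\<integral>\<^sup>+x. ennreal (exp (- (s * x))) \<partial>distr N borel (Z j)) = (\<integral>\<^sup>+\<omega>. ennreal (exp (- (s * Z j \<omega>))) \<partial>N)"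
    by (subst nn_integral_distr) auto
  also have "\<dots> = ennreal (expectation (\<lambda>\<omega>. exp (- (s * Z j \<omega>))))"
  proof (rule nn_integral_eq_integral)
    show "integrable N (\<lambda>\<omega>. exp (- (s * Z j \<omega>)))"
      using nn s by (intro integrable_const_bound[where B = 1]) auto
  qed auto
  also have "(1 + K j j * s) powr (- \<alpha>) = (1 / K j j / (1 / K j j + s)) powr \<alpha>"
  proof -
    have "1 / K j j / (1 / K j j + s) = inverse (1 + K j j * s)" using K s by (simp add: field_simps)
    then show ?thesis by (simp add: powr_minus inverse_powr)
  qed
  then have "ennreal (expectation (\<lambda>\<omega>. exp (- (s * Z j \<omega>)))) = (\<integral>\<^sup>+x. ennreal (exp (- (s * x))) \<partial>gamma_distr \<alpha> (1 / K j j))"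
    unfolding E using \<alpha> K s less_trans[of "- (1 / K j j)" 0 s] by (subst gamma_distr_laplace) auto
  finally show "(\<integral>\<^sup>+x. ennreal (exp (- (s * x))) \<partial>distr N borel (Z j)) =
    (\<integral>\<^sup>+x. ennreal (exp (- (s * x))) \<partial>gamma_distr \<alpha> (1 / K j j))" .
qed auto

text \<open>The finite-dimensional laws of any sequence with kernel \<open>K\<close> agree with the
  gamma mixture by uniqueness of the transforms, so the box estimate of the mixture carries
  over.\<close>

lemma permanental_box_le:
  assumes P: "permanental_sequence N Z \<alpha> K" and \<alpha>: "0 < \<alpha>" and inj: "inj_on i {..<n}"
    and M: "inverse_M_matrix n (\<lambda>p q. K (i p) (i q)) A"
  shows "emeasure N {\<omega> \<in> space N. \<forall>p<n. Z (i p) \<omega> \<le> b p} \<le> (\<Prod>p<n. emeasure (gamma_distr \<alpha> (A p p)) {..b p})"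
proof -
  interpret prob_space N using P by (simp add: permanental_sequence_def)
  have Z[measurable]: "Z j \<in> borel_measurable N" and nn: "\<And>\<omega>. \<omega> \<in> space N \<Longrightarrow> 0 \<le> Z j \<omega>" for j
    using P by (auto simp: permanental_sequence_def)
  obtain \<mu> where sets\<mu>: "sets \<mu> = sets (PiM {..<n} (\<lambda>_. borel))" and p\<mu>: "prob_space \<mu>"
    and nn\<mu>: "\<forall>p<n. AE x in \<mu>. 0 \<le> x p"
    and lap: "\<forall>s. (\<forall>p<n. 0 \<le> s p) \<longrightarrow> (\<integral>\<^sup>+x. (\<Prod>p<n. ennreal (exp (- (s p * x p)))) \<partial>\<mu>) =
      ennreal (perm_det n (\<lambda>p q. K (i p) (i q)) s powr (- \<alpha>))"
    and box: "\<forall>b. emeasure \<mu> (PiE {..<n} (\<lambda>p. {..b p})) \<le> (\<Prod>p<n. emeasure (gamma_distr \<alpha> (A p p)) {..b p})"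
    using M_matrix_permanental_law[OF \<alpha> M] by blast
  interpret \<mu>: prob_space \<mu> by fact
  have comp: "(\<lambda>x. x p) \<in> borel_measurable \<mu>" if "p \<in> {..<n}" for p
    using measurable_component_singleton[OF that, of "\<lambda>_. borel :: real measure"]
    by (simp add: measurable_cong_sets[OF sets\<mu> refl])
  have eq: "(\<integral>\<^sup>+\<omega>. 1 * (\<Prod>p\<in>{..<n}. indicator {..b p} (Z (i p) \<omega>)) \<partial>N) =
      (\<integral>\<^sup>+x. 1 * (\<Prod>p\<in>{..<n}. indicator {..b p} (x p)) \<partial>\<mu>)"
  proof (rule joint_laplace_transform_unique)
    fix s :: "nat \<Rightarrow> real" assume s: "\<And>p. p \<in> {..<n} \<Longrightarrow> 0 < s p"
    have "(\<integral>\<^sup>+\<omega>. 1 * (\<Prod>p\<in>{..<n}. ennreal (exp (- (s p * Z (i p) \<omega>)))) \<partial>N) =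
        (\<integral>\<^sup>+\<omega>. ennreal (exp (- (\<Sum>p<n. s p * Z (i p) \<omega>))) \<partial>N)"
      by (intro nn_integral_cong) (simp add: prod_ennreal exp_sum sum_negf[symmetric])
    also have "\<dots> = ennreal (expectation (\<lambda>\<omega>. exp (- (\<Sum>p<n. s p * Z (i p) \<omega>))))"
    proof (rule nn_integral_eq_integral)
      show "integrable N (\<lambda>\<omega>. exp (- (\<Sum>p<n. s p * Z (i p) \<omega>)))"
      proof (rule integrable_const_bound[where B = 1])
        have "0 \<le> (\<Sum>p<n. s p * Z (i p) \<omega>)" if "\<omega> \<in> space N" for \<omega>
          using nn that s by (intro sum_nonneg mult_nonneg_nonneg) (auto intro: less_imp_le)
        then show "AE \<omega> in N. norm (exp (- (\<Sum>p<n. s p * Z (i p) \<omega>))) \<le> 1" by (intro AE_I2) simp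
      qed simp
    qed auto
    also have "expectation (\<lambda>\<omega>. exp (- (\<Sum>p<n. s p * Z (i p) \<omega>))) =
        perm_det n (\<lambda>p q. K (i p) (i q)) s powr (- \<alpha>)"
      using s by (intro permanental_expectation[OF P inj]) auto
    also have "ennreal \<dots> = (\<integral>\<^sup>+x. 1 * (\<Prod>p\<in>{..<n}. ennreal (exp (- (s p * x p)))) \<partial>\<mu>)"
      using lap s by (simp add: less_imp_le)
    finally show "(\<integral>\<^sup>+\<omega>. 1 * (\<Prod>p\<in>{..<n}. ennreal (exp (- (s p * Z (i p) \<omega>)))) \<partial>N) =
        (\<integral>\<^sup>+x. 1 * (\<Prod>p\<in>{..<n}. ennreal (exp (- (s p * x p)))) \<partial>\<mu>)" .
  qed (use nn nn\<mu> comp emeasure_space_1 \<mu>.emeasure_space_1 in auto)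
  have ind: "(\<Prod>p\<in>{..<n}. indicator {..b p} (x p)) = (if \<forall>p<n. x p \<le> b p then 1 else 0 :: ennreal)" for x
  proof (cases "\<forall>p<n. x p \<le> b p")
    case False
    then obtain p where p: "p < n" "\<not> x p \<le> b p" by blast
    then have "(\<Prod>p\<in>{..<n}. indicator {..b p} (x p)) = (0 :: ennreal)"
      by (intro prod_zero bexI[of _ p]) auto
    then show ?thesis using False by simp
  qed auto
  have S: "{\<omega> \<in> space N. \<forall>p<n. Z (i p) \<omega> \<le> b p} \<in> sets N" by measurable
  have "emeasure N {\<omega> \<in> space N. \<forall>p<n. Z (i p) \<omega> \<le> b p} = (\<integral>\<^sup>+\<omega>. 1 * (\<Prod>p\<in>{..<n}. indicator {..b p} (Z (i p) \<omega>)) \<partial>N)"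
    unfolding ind nn_integral_indicator[OF S, symmetric] by (intro nn_integral_cong) (auto simp: indicator_def)
  also have "\<dots> = (\<integral>\<^sup>+x. indicator (PiE {..<n} (\<lambda>p. {..b p})) x \<partial>\<mu>)"
    unfolding eq unfolding ind using sets_eq_imp_space_eq[OF sets\<mu>]
    by (intro nn_integral_cong) (auto simp: indicator_def space_PiM PiE_def)
  also have "\<dots> = emeasure \<mu> (PiE {..<n} (\<lambda>p. {..b p}))"
    using sets\<mu> by (intro nn_integral_indicator) (auto intro!: sets_PiM_I_finite)
  also have "\<dots> \<le> (\<Prod>p<n. emeasure (gamma_distr \<alpha> (A p p)) {..b p})" using box by blast
  finally show ?thesis .
qed

text \<open>The exponential Chebyshev inequality, with the Laplace transform taken at
  \<open>- \<theta>\<close>.\<close>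

lemma gamma_distr_tail_le:
  assumes a: "0 < a" and \<theta>: "0 < \<theta>" "\<theta> < d"
  shows "measure (gamma_distr a d) {x<..} \<le> exp (- (\<theta> * x)) * (d / (d - \<theta>)) powr a"
proof -
  interpret prob_space "gamma_distr a d" using a \<theta> by (intro prob_space_gamma_distr) auto
  have "emeasure (gamma_distr a d) {x<..} = (\<integral>\<^sup>+t. indicator {x<..} t \<partial>gamma_distr a d)" by simp
  also have "\<dots> \<le> (\<integral>\<^sup>+t. ennreal (exp (- (\<theta> * x))) * ennreal (exp (- (- \<theta> * t))) \<partial>gamma_distr a d)"
    using \<theta> by (intro nn_integral_mono) (auto simp: indicator_def ennreal_mult[symmetric] exp_add[symmetric])
  also have "\<dots> = ennreal (exp (- (\<theta> * x))) * ennreal ((d / (d + - \<theta>)) powr a)"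
    using a \<theta> by (subst nn_integral_cmult) (simp_all only: gamma_distr_laplace[of a d "- \<theta>"] neg_less_iff_less, auto)
  finally have "ennreal (prob {x<..}) \<le> ennreal (exp (- (\<theta> * x)) * (d / (d - \<theta>)) powr a)"
    by (simp add: emeasure_eq_measure ennreal_mult)
  then show ?thesis by (subst (asm) ennreal_le_iff) auto
qed

text \<open>The substitute for the second Borel-Cantelli lemma: by
  \<open>1 - t \<le> exp (- t)\<close> a positive lower bound of all the products would bound the
  partial sums of \<open>t\<close>.\<close>

lemma prod_le_imp_nonpos:
  fixes t :: "nat \<Rightarrow> real"
  assumes t: "\<And>p. 0 \<le> t p" "\<And>p. t p \<le> 1" and ns: "\<not> summable t" and le: "\<And>n. P \<le> (\<Prod>p<n. 1 - t p)"
  shows "P \<le> 0"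
proof (rule ccontr)
  assume "\<not> P \<le> 0"
  then have P: "0 < P" by simp
  have "(\<Sum>p<n. t p) \<le> - ln P" for n
  proof -
    have "P \<le> (\<Prod>p<n. exp (- t p))"
      using t exp_ge_add_one_self[of "- t p" for p]
      by (intro order.trans[OF le[of n]] prod_mono) (auto simp: add.commute)
    also have "\<dots> = exp (- (\<Sum>p<n. t p))" by (simp add: exp_sum sum_negf[symmetric])
    finally have "ln P \<le> ln (exp (- (\<Sum>p<n. t p)))" using P by (subst ln_le_cancel_iff) auto
    then show ?thesis by simp
  qed
  then have "summable t" using t by (intro summableI_nonneg_bounded) auto
  then show False using ns by blast
qed

text \<open>The tail at \<open>\<rho> * ln m\<close> is of order \<open>m powr (- \<rho>)\<close> up
  to logarithmic factors. As \<open>\<rho> < 1\<close> it eventually exceeds \<open>1 / m\<close>,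
  and the harmonic series diverges along the multiples of \<open>L\<close>.\<close>

lemma not_summable_gamma_tails:
  assumes a: "0 < a" and \<rho>: "0 < \<rho>" "\<rho> < 1" and L: "0 < (L :: nat)"
  shows "\<not> summable (\<lambda>p. measure (gamma_distr a 1) {\<rho> * ln (real ((k + p + 1) * L))<..})"
proof
  assume s: "summable (\<lambda>p. measure (gamma_distr a 1) {\<rho> * ln (real ((k + p + 1) * L))<..})"
  define G where "G = Gamma a"
  have G: "0 < G" unfolding G_def using a by (rule Gamma_real_pos)
  have "filterlim (\<lambda>m::real. exp (- (\<rho> * ln m + 1)) * m / ((\<rho> * ln m + 1) * G)) at_top at_top"
    using \<rho> G by real_asymp
  then have "eventually (\<lambda>m. 1 \<le> exp (- (\<rho> * ln m + 1)) * m / ((\<rho> * ln m + 1) * G)) at_top"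
    by (simp add: filterlim_at_top)
  moreover have "filterlim (\<lambda>m::real. \<rho> * ln m) at_top at_top" using \<rho> by real_asymp
  then have "eventually (\<lambda>m. 1 \<le> \<rho> * ln m) at_top" by (simp add: filterlim_at_top)
  ultimately have ev: "eventually (\<lambda>m. 1 / m \<le> measure (gamma_distr a 1) {\<rho> * ln m<..}) at_top"
    using eventually_gt_at_top[of 0]
  proof eventually_elim
    case (elim m)
    have "1 / m \<le> exp (- (\<rho> * ln m + 1)) / ((\<rho> * ln m + 1) * G)"
      using elim by (simp add: field_simps)
    also have "\<dots> \<le> measure (gamma_distr a 1) {\<rho> * ln m<..}"
      unfolding G_def using elim by (intro gamma_distr_tail_ge a)
    finally show ?case .
  qed
  have "filterlim (\<lambda>p. real ((k + p + 1) * L)) at_top sequentially"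
  proof (rule filterlim_at_top_mono[OF filterlim_real_sequentially])
    have "real p \<le> real ((k + p + 1) * L)" for p
    proof -
      have "p * 1 \<le> (k + p + 1) * L" using L by (intro mult_le_mono) auto
      then show ?thesis unfolding of_nat_le_iff by simp
    qed
    then show "\<forall>\<^sub>F p in sequentially. real p \<le> real ((k + p + 1) * L)" by simp
  qed
  from eventually_compose_filterlim[OF ev this]
  have "\<forall>\<^sub>F p in sequentially. norm (1 / real ((k + p + 1) * L)) \<le> measure (gamma_distr a 1) {\<rho> * ln (real ((k + p + 1) * L))<..}"
    by simp
  then have "summable (\<lambda>p. 1 / real ((k + p + 1) * L))" using s by (rule summable_comparison_test_ev)
  then have "summable (\<lambda>p. real L * (1 / real ((k + p + 1) * L)))" by (rule summable_mult)
  also have "(\<lambda>p. real L * (1 / real ((k + p + 1) * L))) = (\<lambda>p. inverse (real (p + (k + 1))))"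
  proof
    fix p
    have "real ((k + p + 1) * L) = real (p + (k + 1)) * real L" by (simp add: algebra_simps)
    then show "real L * (1 / real ((k + p + 1) * L)) = inverse (real (p + (k + 1)))"
      using L by (simp only:) (simp add: inverse_eq_divide del: of_nat_add)
  qed
  finally have "summable (\<lambda>n. inverse (real n))" by (subst (asm) summable_iff_shift)
  then show False using not_summable_harmonic[where 'a = real] by simp
qed

section \<open>Almost sure bounds, the upper limit, and potentials vanishing at infinity\<close>

context levy
begin

lemma permanental_limsup_le:
  assumes P: "permanental_sequence N Z \<alpha> K" and \<alpha>: "0 < \<alpha>"
    and K: "\<And>j k. K j k = u (k - j) + f (- k)" and f0: "\<And>k. 0 \<le> f k"
    and flim: "((\<lambda>k. f (- k)) \<longlongrightarrow> 0) at_top" and c: "u 0 < c"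
  shows "AE \<omega> in N. \<forall>\<^sub>F n in sequentially. Z (int n) \<omega> \<le> c * ln (real n)"
proof -
  interpret N: prob_space N using P by (simp add: permanental_sequence_def)
  have Z[measurable]: "Z j \<in> borel_measurable N" for j using P by (auto simp: permanental_sequence_def)
  have Kpos: "0 < K j j" for j using u_0_pos f0[of "- j"] by (simp add: K)
  \<comment> \<open>Two levels between \<open>u 0\<close> and \<open>c\<close> are needed.
    Eventually the scale is below \<open>c1\<close>, so the tail bound with exponent
    \<open>1 / c2\<close> has a constant uniform in \<open>n\<close>, and \<open>c2 < c\<close>
    makes \<open>real n powr (- (c / c2))\<close> summable.\<close>
  define c1 where "c1 = (2 * u 0 + c) / 3"
  define c2 where "c2 = (u 0 + 2 * c) / 3"
  have cc: "u 0 < c1" "c1 < c2" "c2 < c" "0 < c2" using c u_0_pos by (auto simp: c1_def c2_def)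
  let ?A = "\<lambda>n. {\<omega> \<in> space N. c * ln (real n) < Z (int n) \<omega>}"
  define C where "C = (1 / (1 - c1 / c2)) powr \<alpha>"
  have small: "\<forall>\<^sub>F n in sequentially. f (- int n) < c1 - u 0"
  proof -
    have "\<forall>\<^sub>F k in at_top. f (- k) < c1 - u 0"
      by (rule order_tendstoD(2)[OF flim]) (use cc in simp)
    then show ?thesis using eventually_compose_filterlim[OF _ filterlim_int_sequentially] by blast
  qed
  have bnd: "\<forall>\<^sub>F n in sequentially. norm (measure N (?A n)) \<le> real n powr (- (c / c2)) * C"
    using small eventually_gt_at_top[of 0]
  proof eventually_elim
    case (elim n)
    define \<kappa> where "\<kappa> = K (int n) (int n)"
    have \<kappa>: "0 < \<kappa>" "\<kappa> < c1" using Kpos elim by (auto simp: \<kappa>_def K)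
    have d: "1 / c2 < 1 / \<kappa>" using \<kappa> cc by (intro divide_strict_left_mono) auto
    have "measure N (?A n) = measure (distr N borel (Z (int n))) {c * ln (real n)<..}"
      by (subst measure_distr) (auto intro!: arg_cong[where f = "measure N"])
    also have "\<dots> = measure (gamma_distr \<alpha> (1 / \<kappa>)) {c * ln (real n)<..}"
      using permanental_marginal[where K = K, OF P \<alpha> Kpos] by (simp add: \<kappa>_def)
    also have "\<dots> \<le> exp (- (1 / c2 * (c * ln (real n)))) * (1 / \<kappa> / (1 / \<kappa> - 1 / c2)) powr \<alpha>"
      using \<alpha> cc d by (intro gamma_distr_tail_le) auto
    also have "exp (- (1 / c2 * (c * ln (real n)))) = real n powr (- (c / c2))"
      using elim by (simp add: powr_def)
    also have "1 / \<kappa> / (1 / \<kappa> - 1 / c2) = 1 / (1 - \<kappa> / c2)"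
    proof -
      have "1 / \<kappa> - 1 / c2 \<noteq> 0" "\<kappa> \<noteq> c2" using d \<kappa> cc by auto
      then show ?thesis using \<kappa> cc by (simp add: field_simps)
    qed
    also have "(1 / (1 - \<kappa> / c2)) powr \<alpha> \<le> C"
    proof -
      have "\<kappa> / c2 < 1" "c1 / c2 < 1" "\<kappa> / c2 \<le> c1 / c2" using \<kappa> cc by (auto simp: divide_right_mono)
      then show ?thesis unfolding C_def using \<alpha>
        by (intro powr_mono2 divide_left_mono mult_pos_pos) auto
    qed
    finally show ?case by (simp add: mult_left_mono)
  qed
  have "summable (\<lambda>n. real n powr (- (c / c2)) * C)"
    using cc by (intro summable_mult2) (simp add: summable_real_powr_iff)
  then have "summable (\<lambda>n. measure N (?A n))" using bnd by (rule summable_comparison_test_ev[rotated])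
  then have "AE \<omega> in N. \<forall>\<^sub>F n in sequentially. \<omega> \<in> space N - ?A n"
    by (intro borel_cantelli_AE1) (auto simp: less_top[symmetric])
  then show ?thesis by eventually_elim (auto elim!: eventually_mono)
qed

lemma permanental_limsup_ge:
  assumes P: "permanental_sequence N Z \<alpha> K" and \<alpha>: "0 < \<alpha>"
    and K: "\<And>j k. K j k = u (k - j) + f (- k)" and f: "supermedian f"
    and c: "0 < c" "c < u 0"
  shows "AE \<omega> in N. \<forall>k. \<exists>n\<ge>k. c * ln (real n) < Z (int n) \<omega>"
proof -
  interpret N: prob_space N using P by (simp add: permanental_sequence_def)
  interpret G: prob_space "gamma_distr \<alpha> 1" using \<alpha> by (intro prob_space_gamma_distr) auto
  have Z[measurable]: "Z j \<in> borel_measurable N" for j using P by (auto simp: permanental_sequence_def)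
  \<comment> \<open>Half of the gap between \<open>c\<close> and \<open>u 0\<close>, so that
    \<open>D\<close>, the bound for the rates \<open>A p p\<close>, still satisfies
    \<open>D * c < 1\<close>. This product is the exponent \<rho> for which the gamma tails are not
    summable.\<close>
  define \<eta> where "\<eta> = (u 0 - c) / 2"
  define D where "D = 1 / (u 0 - \<eta>)"
  have \<eta>: "0 < \<eta>" "\<eta> < u 0" "c < u 0 - \<eta>" using c by (auto simp: \<eta>_def field_simps)
  define \<rho> where "\<rho> = D * c"
  have \<rho>: "0 < \<rho>" "\<rho> < 1" using \<eta> c by (auto simp: \<rho>_def D_def)
  obtain L0 where L0: "\<And>x. L0 \<le> \<bar>x\<bar> \<Longrightarrow> u x \<le> \<eta>" using u_vanishes_at_infinity[OF \<eta>(1)] by blast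
  define L where "L = nat (max 1 L0)"
  have L: "0 < L" "L0 \<le> int L" by (auto simp: L_def)
  have null: "AE \<omega> in N. \<exists>p. c * ln (real ((k + p + 1) * L)) < Z (int ((k + p + 1) * L)) \<omega>" for k
  proof -
    \<comment> \<open>The offset \<open>k\<close> places all points beyond \<open>k\<close>. The
      \<open>+ 1\<close> keeps them positive, so that the levels \<open>b\<close> are non-negative,
      as is needed when \<open>A p p\<close> is replaced by its upper bound
      \<open>D\<close>.\<close>
    define i where "i = (\<lambda>p. int ((k + p + 1) * L))"
    define b where "b = (\<lambda>p. c * ln (real ((k + p + 1) * L)))"
    define t where "t = (\<lambda>p. G.prob {\<rho> * ln (real ((k + p + 1) * L))<..})"
    have inj: "inj_on i {..<n}" for n using L by (auto simp: inj_on_def i_def)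
    have dist: "L0 \<le> \<bar>i p - i q\<bar>" if "q \<noteq> p" for p q
    proof -
      have "i p - i q = (int p - int q) * int L" by (simp add: i_def algebra_simps)
      then have "\<bar>i p - i q\<bar> = \<bar>int p - int q\<bar> * int L" by (simp add: abs_mult)
      moreover have "1 * int L \<le> \<bar>int p - int q\<bar> * int L" using that by (intro mult_right_mono) auto
      ultimately show ?thesis using L(2) by simp
    qed
    have b0: "0 \<le> b p" for p
    proof -
      have "1 \<le> (k + p + 1) * L" using L(1) by simp
      then have "1 \<le> real ((k + p + 1) * L)" by (simp only: real_of_nat_ge_one_iff)
      then show ?thesis unfolding b_def using c by (intro mult_nonneg_nonneg) auto
    qed
    let ?E = "{\<omega> \<in> space N. \<forall>p. Z (i p) \<omega> \<le> b p}"
    have E: "?E \<in> sets N" by measurable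
    have "measure N ?E \<le> (\<Prod>p<n. 1 - t p)" for n
    proof -
      obtain A where A: "inverse_M_matrix n (\<lambda>p q. u (i q - i p) + f (- i q)) A"
        and Adiag: "\<forall>p \<eta>. p < n \<longrightarrow> \<eta> < u 0 \<longrightarrow> (\<forall>q<n. q \<noteq> p \<longrightarrow> u (i p - i q) \<le> \<eta>) \<longrightarrow> 0 \<le> \<eta> \<longrightarrow> A p p \<le> 1 / (u 0 - \<eta>)"
        using perturbed_potential_inverse_M_matrix[OF f inj[of n]] by blast
      have A': "inverse_M_matrix n (\<lambda>p q. K (i p) (i q)) A" using A by (simp add: K)
      have Apos: "0 < A p p" if "p < n" for p using M_matrix_permanental_law[OF \<alpha> A'] that by blast
      have Ale: "A p p \<le> D" if "p < n" for p
        unfolding D_def using Adiag that \<eta> L0 dist by auto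
      have "emeasure N ?E \<le> emeasure N {\<omega> \<in> space N. \<forall>p<n. Z (i p) \<omega> \<le> b p}"
        by (intro emeasure_mono) auto
      also have "\<dots> \<le> (\<Prod>p<n. emeasure (gamma_distr \<alpha> (A p p)) {..b p})"
        by (rule permanental_box_le[OF P \<alpha> inj A'])
      also have "\<dots> \<le> (\<Prod>p<n. ennreal (1 - t p))"
      proof (rule prod_mono_ennreal)
        fix p assume "p \<in> {..<n}"
        then have p: "p < n" by simp
        have "emeasure (gamma_distr \<alpha> (A p p)) {..b p} = emeasure (gamma_distr \<alpha> 1) {..A p p * b p}"
          by (rule gamma_distr_atMost_rate[OF \<alpha> Apos[OF p]])
        also have "\<dots> \<le> emeasure (gamma_distr \<alpha> 1) {..D * b p}"
          using mult_right_mono[OF Ale[OF p] b0[of p]] by (intro emeasure_mono) auto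
        also have "\<dots> = ennreal (1 - t p)"
        proof -
          have "{..D * b p} = space (gamma_distr \<alpha> 1) - {\<rho> * ln (real ((k + p + 1) * L))<..}"
            by (auto simp: b_def \<rho>_def mult.assoc)
          then have "G.prob {..D * b p} = 1 - t p" unfolding t_def by (simp only:) (rule G.prob_compl, simp)
          then show ?thesis by (simp add: G.emeasure_eq_measure)
        qed
        finally show "emeasure (gamma_distr \<alpha> (A p p)) {..b p} \<le> ennreal (1 - t p)" .
      qed
      also have "\<dots> = ennreal (\<Prod>p<n. 1 - t p)" by (rule prod_ennreal) (simp add: t_def)
      finally have "ennreal (measure N ?E) \<le> ennreal (\<Prod>p<n. 1 - t p)" by (simp add: N.emeasure_eq_measure)
      then show ?thesis by (subst (asm) ennreal_le_iff) (auto intro!: prod_nonneg simp: t_def)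
    qed
    \<comment> \<open>\<open>?E\<close> lies in every finite box, so its probability is below all
      partial products.\<close>
    then have "measure N ?E \<le> 0"
      by (rule prod_le_imp_nonpos[rotated 3])
        (use not_summable_gamma_tails[OF \<alpha> \<rho> L(1), of k] in \<open>auto simp: t_def\<close>)
    then have "measure N ?E = 0" using measure_nonneg[of N ?E] by linarith
    then have "?E \<in> null_sets N" using E by (auto simp: N.emeasure_eq_measure)
    then have "AE \<omega> in N. \<omega> \<notin> ?E" by (rule AE_not_in)
    then show ?thesis
      using AE_space by eventually_elim (auto simp: i_def b_def not_le)
  qed
  have "AE \<omega> in N. \<forall>k. \<exists>p. c * ln (real ((k + p + 1) * L)) < Z (int ((k + p + 1) * L)) \<omega>"
    by (rule AE_all_countable[THEN iffD2, OF allI]) (rule null)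
  then show ?thesis
  proof eventually_elim
    case (elim \<omega>)
    show ?case
    proof
      fix k
      obtain p where p: "c * ln (real ((k + p + 1) * L)) < Z (int ((k + p + 1) * L)) \<omega>" using elim by blast
      have "k * 1 \<le> (k + p + 1) * L" using L(1) by (intro mult_le_mono) auto
      then show "\<exists>n\<ge>k. c * ln (real n) < Z (int n) \<omega>" using p by (intro exI[of _ "(k + p + 1) * L"]) simp
    qed
  qed
qed

lemma permanental_limsup:
  assumes P: "permanental_sequence N Z \<alpha> K" and \<alpha>: "0 < \<alpha>"
    and K: "\<And>j k. K j k = u (k - j) + f (- k)" and f: "supermedian f"
    and flim: "((\<lambda>k. f (- k)) \<longlongrightarrow> 0) at_top"
  shows "AE \<omega> in N. limsup (\<lambda>n. ereal (Z (int n) \<omega> / ln (real n))) = ereal (u 0)"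
proof -
  have "AE \<omega> in N. \<forall>\<^sub>F n in sequentially. Z (int n) \<omega> \<le> (u 0 + 1 / (real m + 1)) * ln (real n)" for m :: nat
    using f by (intro permanental_limsup_le[OF P \<alpha> K _ flim]) (auto simp: supermedian_def)
  then have up: "AE \<omega> in N. \<forall>m. \<forall>\<^sub>F n in sequentially. Z (int n) \<omega> \<le> (u 0 + 1 / (real m + 1)) * ln (real n)"
    by (rule AE_all_countable[THEN iffD2, OF allI])
  \<comment> \<open>Countably many constants suffice, so the exceptional null sets can be united.
    The \<open>2\<close> keeps the constant positive for \<open>m = 0\<close>.\<close>
  have "AE \<omega> in N. \<forall>k. \<exists>n\<ge>k. (u 0 - u 0 / (real m + 2)) * ln (real n) < Z (int n) \<omega>" for m :: nat
  proof (rule permanental_limsup_ge[OF P \<alpha> K f])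
    have "u 0 * 1 < u 0 * (real m + 2)" using u_0_pos by (intro mult_strict_left_mono) auto
    then show "0 < u 0 - u 0 / (real m + 2)" by (simp add: pos_divide_less_eq)
    show "u 0 - u 0 / (real m + 2) < u 0" using u_0_pos by simp
  qed
  then have "AE \<omega> in N. \<forall>m k. \<exists>n\<ge>k. (u 0 - u 0 / (real m + 2)) * ln (real n) < Z (int n) \<omega>"
    by (rule AE_all_countable[THEN iffD2, OF allI])
  with up show ?thesis
  proof eventually_elim
    case (elim \<omega>)
    let ?l = "limsup (\<lambda>n. ereal (Z (int n) \<omega> / ln (real n)))"
    have 1: "?l \<le> ereal (u 0 + 1 / (real m + 1))" for m
    proof (rule Limsup_bounded)
      show "\<forall>\<^sub>F n in sequentially. ereal (Z (int n) \<omega> / ln (real n)) \<le> ereal (u 0 + 1 / (real m + 1))"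
        using elim(1)[rule_format, of m] eventually_gt_at_top[of 1]
        by eventually_elim (simp add: pos_divide_le_eq)
    qed
    have 2: "ereal (u 0 - u 0 / (real m + 2)) \<le> ?l" for m
    proof (rule ccontr)
      assume "\<not> ereal (u 0 - u 0 / (real m + 2)) \<le> ?l"
      then have "\<forall>\<^sub>F n in sequentially. ereal (Z (int n) \<omega> / ln (real n)) < ereal (u 0 - u 0 / (real m + 2))"
        by (intro Limsup_lessD) auto
      then obtain k where k: "\<And>n. k \<le> n \<Longrightarrow> Z (int n) \<omega> / ln (real n) < u 0 - u 0 / (real m + 2)"
        by (auto simp: eventually_sequentially)
      \<comment> \<open>From \<open>2\<close> on the logarithm is positive, so the inequality can be
        divided by it.\<close>
      obtain n where n: "max k 2 \<le> n" "(u 0 - u 0 / (real m + 2)) * ln (real n) < Z (int n) \<omega>"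
        using elim(2) by blast
      then have "0 < ln (real n)" "k \<le> n" by auto
      then show False using k[of n] n(2) by (simp add: pos_divide_less_eq)
    qed
    have "(\<lambda>m. ereal (u 0 + 1 / (real m + 1))) \<longlonglongrightarrow> ereal (u 0)"
    proof (rule tendsto_ereal)
      have "(\<lambda>m. 1 / (real m + 1)) \<longlonglongrightarrow> 0" by real_asymp
      from tendsto_add[OF tendsto_const[of "u 0"] this] show "(\<lambda>m. u 0 + 1 / (real m + 1)) \<longlonglongrightarrow> u 0" by simp
    qed
    then have "?l \<le> ereal (u 0)" by (rule LIMSEQ_le_const) (use 1 in auto)
    moreover have "(\<lambda>m. ereal (u 0 - u 0 / (real m + 2))) \<longlonglongrightarrow> ereal (u 0)"
    proof (rule tendsto_ereal)
      have "(\<lambda>m. 1 / (real m + 2)) \<longlonglongrightarrow> 0" by real_asymp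
      from tendsto_diff[OF tendsto_const[of "u 0"] tendsto_mult[OF tendsto_const[of "u 0"] this]]
      show "(\<lambda>m. u 0 - u 0 / (real m + 2)) \<longlonglongrightarrow> u 0" by simp
    qed
    then have "ereal (u 0) \<le> ?l" by (rule LIMSEQ_le_const2) (use 2 in auto)
    ultimately show ?case by (rule antisym)
  qed
qed

text \<open>The single term at the diagonal gives \<open>u 0 * h j \<le> g j\<close>, which settles
  one direction. For the other, \<open>u\<close> has finite total mass: far jumps carry little mass
  against a bounded \<open>h\<close>, and near jumps from a distant \<open>j\<close> only meet small
  values of \<open>h\<close>.\<close>

lemma potential_c0_plus:
  fixes h :: "int \<Rightarrow> real"
  assumes h: "\<And>k. 0 < h k"
  shows "kernel_apply (\<lambda>j k. u (k - j)) (\<lambda>k. ennreal (h k)) \<in> c0_plus \<longleftrightarrow> (\<lambda>k. ennreal (h k)) \<in> c0_plus"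
proof
  let ?F = "filtercomap abs at_top :: int filter"
  let ?g = "\<lambda>j. \<integral>\<^sup>+y. ennreal (u y) * ennreal (h (j + y)) \<partial>count_space UNIV"
  {
    assume "kernel_apply (\<lambda>j k. u (k - j)) (\<lambda>k. ennreal (h k)) \<in> c0_plus"
    then have g: "(?g \<longlongrightarrow> 0) ?F" unfolding c0_plus_def kernel_apply_shift by simp
    have le: "ennreal (h j) \<le> ennreal (1 / u 0) * ?g j" for j
    proof -
      have "ennreal (u 0) * ennreal (h (j + 0)) \<le> ?g j" by (rule nn_integral_ge_point) simp
      then have "ennreal (1 / u 0) * (ennreal (u 0) * ennreal (h j)) \<le> ennreal (1 / u 0) * ?g j"
        by (intro mult_left_mono) auto
      moreover have "ennreal (1 / u 0) * (ennreal (u 0) * ennreal (h j)) = ennreal (h j)"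
        using u_0_pos h[of j] by (simp add: ennreal_mult[symmetric] less_imp_le)
      ultimately show ?thesis by simp
    qed
    have "((\<lambda>j. ennreal (1 / u 0) * ?g j) \<longlongrightarrow> ennreal (1 / u 0) * 0) ?F"
      using g by (intro ennreal_tendsto_cmult) auto
    then have lim: "((\<lambda>j. ennreal (1 / u 0) * ?g j) \<longlongrightarrow> 0) ?F" by simp
    have "((\<lambda>k. ennreal (h k)) \<longlongrightarrow> 0) ?F"
      by (rule tendsto_sandwich[OF always_eventually always_eventually tendsto_const lim]) (simp, rule allI, rule le)
    then show "(\<lambda>k. ennreal (h k)) \<in> c0_plus" by (simp add: c0_plus_def)
  next
    assume "(\<lambda>k. ennreal (h k)) \<in> c0_plus"
    then have hlim: "((\<lambda>k. ennreal (h k)) \<longlongrightarrow> 0) ?F" by (simp add: c0_plus_def)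
    have far: "\<exists>R. \<forall>k. R \<le> \<bar>k\<bar> \<longrightarrow> h k \<le> \<epsilon>" if "0 < \<epsilon>" for \<epsilon>
    proof -
      have "\<forall>\<^sub>F k in ?F. ennreal (h k) < ennreal \<epsilon>" by (rule order_tendstoD(2)[OF hlim]) (use that in simp)
      then obtain R where "\<And>k. R \<le> \<bar>k\<bar> \<Longrightarrow> ennreal (h k) < ennreal \<epsilon>"
        by (auto simp: eventually_filtercomap_at_top_linorder)
      then show ?thesis using h by (intro exI[of _ R]) (auto simp: ennreal_less_iff less_imp_le)
    qed
    \<comment> \<open>A sequence tending to zero is bounded: at most \<open>1\<close> outside a
      finite window, and at most the sum over the window inside it.\<close>
    obtain H where H: "\<And>k. h k \<le> H" "0 < H"
    proof -
      obtain R where R: "\<And>k. R \<le> \<bar>k\<bar> \<Longrightarrow> h k \<le> 1" using far[of 1] by auto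
      have "h k \<le> 1 + (\<Sum>k\<in>{-R..R}. h k)" for k
      proof (cases "k \<in> {-R..R}")
        case True
        then have "h k \<le> (\<Sum>k\<in>{-R..R}. h k)" using h by (intro member_le_sum) (auto simp: less_imp_le)
        then show ?thesis by simp
      next
        case False
        then have "h k \<le> 1" by (intro R) auto
        moreover have "0 \<le> (\<Sum>k\<in>{-R..R}. h k)" using h by (intro sum_nonneg) (auto simp: less_imp_le)
        ultimately show ?thesis by linarith
      qed
      moreover have "0 < 1 + (\<Sum>k\<in>{-R..R}. h k)" using h by (intro add_pos_nonneg sum_nonneg) (auto simp: less_imp_le)
      ultimately show thesis using that by blast
    qed
    have fin: "?g j < \<infinity>" for j
    proof -
      have "?g j \<le> (\<integral>\<^sup>+y. ennreal (u y) * ennreal H \<partial>count_space UNIV)"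
        using H by (intro nn_integral_mono mult_left_mono ennreal_leI) auto
      also have "\<dots> < \<infinity>" by (simp add: nn_integral_multc u_sum ennreal_mult_less_top)
      finally show ?thesis .
    qed
    let ?t = "\<lambda>T::nat. \<integral>\<^sup>+y. ennreal (u y) * indicator {y. int T < \<bar>y\<bar>} y \<partial>count_space UNIV"
    have tail: "?t \<longlonglongrightarrow>
        (\<integral>\<^sup>+y. 0 \<partial>count_space (UNIV :: int set))"
    proof (rule nn_integral_dominated_convergence[where w = "\<lambda>y. ennreal (u y)"])
      show "(\<integral>\<^sup>+y. ennreal (u y) \<partial>count_space UNIV) < \<infinity>" by (simp add: u_sum)
      show "AE y in count_space UNIV. (\<lambda>T. ennreal (u y) * indicator {y. int T < \<bar>y\<bar>} y) \<longlonglongrightarrow> 0"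
      proof (rule AE_I2)
        fix y :: int
        have "\<forall>\<^sub>F T in sequentially. ennreal (u y) * indicator {y. int T < \<bar>y\<bar>} y = 0"
          unfolding eventually_sequentially by (intro exI[of _ "nat \<bar>y\<bar>"]) auto
        then show "(\<lambda>T. ennreal (u y) * indicator {y. int T < \<bar>y\<bar>} y) \<longlonglongrightarrow> 0" by (rule tendsto_eventually)
      qed
    qed (auto simp: indicator_def)
    have small: "\<forall>\<^sub>F j in ?F. ?g j \<le> ennreal \<epsilon>" if \<epsilon>: "0 < \<epsilon>" for \<epsilon>
    proof -
      \<comment> \<open>Together with the total mass \<open>1 / \<beta>\<close> this bound
        contributes \<open>\<epsilon> / 2\<close>. The tail beyond \<open>T\<close>, below
        \<open>\<epsilon> / (2 * H)\<close>, contributes the other half. For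
        \<open>R + int T \<le> \<bar>j\<bar>\<close> every jump of size at most \<open>T\<close>
        ends where the bound holds.\<close>
      obtain R where R: "\<And>k. R \<le> \<bar>k\<bar> \<Longrightarrow> h k \<le> \<epsilon> * \<beta> / 2" using far[of "\<epsilon> * \<beta> / 2"] \<epsilon> beta by auto
      have "\<forall>\<^sub>F T in sequentially. ?t T < ennreal (\<epsilon> / (2 * H))"
        by (rule order_tendstoD(2)[OF tail]) (use \<epsilon> H in simp)
      then obtain T :: nat where T: "?t T < ennreal (\<epsilon> / (2 * H))"
        by (auto simp: eventually_sequentially)
      have "?g j \<le> ennreal \<epsilon>" if j: "R + int T \<le> \<bar>j\<bar>" for j
      proof -
        have "?g j \<le> (\<integral>\<^sup>+y. ennreal (u y) * ennreal (\<epsilon> * \<beta> / 2) + ennreal (u y) * indicator {y. int T < \<bar>y\<bar>} y * ennreal H \<partial>count_space UNIV)"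
        proof (rule nn_integral_mono)
          fix y
          show "ennreal (u y) * ennreal (h (j + y)) \<le>
              ennreal (u y) * ennreal (\<epsilon> * \<beta> / 2) + ennreal (u y) * indicator {y. int T < \<bar>y\<bar>} y * ennreal H"
          proof (cases "int T < \<bar>y\<bar>")
            case True
            have "ennreal (u y) * ennreal (h (j + y)) \<le> ennreal (u y) * ennreal H"
              using H by (intro mult_left_mono ennreal_leI) auto
            then show ?thesis using True by (simp add: add_increasing)
          next
            case False
            then have "R \<le> \<bar>j + y\<bar>" using j by linarith
            then have "ennreal (u y) * ennreal (h (j + y)) \<le> ennreal (u y) * ennreal (\<epsilon> * \<beta> / 2)"
              by (intro mult_left_mono ennreal_leI R) auto
            then show ?thesis using False by simp
          qed
        qed
        also have "\<dots> = ennreal (1 / \<beta>) * ennreal (\<epsilon> * \<beta> / 2) +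
            ?t T * ennreal H"
          by (subst nn_integral_add) (auto simp: nn_integral_multc u_sum)
        also have "\<dots> \<le> ennreal (1 / \<beta>) * ennreal (\<epsilon> * \<beta> / 2) + ennreal (\<epsilon> / (2 * H)) * ennreal H"
          using T by (intro add_left_mono mult_right_mono) auto
        also have "\<dots> = ennreal \<epsilon>"
          using \<epsilon> H beta by (simp add: ennreal_mult[symmetric] ennreal_plus[symmetric] del: ennreal_plus)
        finally show ?thesis .
      qed
      then show ?thesis by (auto simp: eventually_filtercomap_at_top_linorder)
    qed
    have "(?g \<longlongrightarrow> 0) ?F"
    proof (rule order_tendstoI)
      fix a :: ennreal assume a: "0 < a"
      obtain \<epsilon> where \<epsilon>: "0 < \<epsilon>" "ennreal \<epsilon> < a"
      proof (cases a)
        case (real r)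
        then have "0 < r" using a by simp
        then show ?thesis using that[of "r / 2"] real by (simp add: ennreal_less_iff)
      next
        case top
        then show ?thesis using that[of 1] by simp
      qed
      show "\<forall>\<^sub>F j in ?F. ?g j < a" using small[OF \<epsilon>(1)] by eventually_elim (use \<epsilon> in auto)
    qed auto
    then show "kernel_apply (\<lambda>j k. u (k - j)) (\<lambda>k. ennreal (h k)) \<in> c0_plus"
      using fin unfolding c0_plus_def kernel_apply_shift by simp
  }
qed

end

theorem theorem1p11:
  fixes M :: "'a measure" and X :: "real \<Rightarrow> 'a \<Rightarrow> int" and \<xi> :: "'a \<Rightarrow> real"
    and \<beta> :: real and f :: "int \<Rightarrow> real"
    and p :: "real \<Rightarrow> int \<Rightarrow> int \<Rightarrow> real" and U U' :: "int \<Rightarrow> int \<Rightarrow> real"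
  assumes levy: "levy_process M X"
    and beta: "\<beta> > 0"
    and killing: "independent_exponential_time M X \<beta> \<xi>"
    and p: "p = transition M X \<xi>"
    and U: "U = potential_density p"
    and f_nonneg: "\<forall>k. 0 \<le> f k"
    and f_excessive: "excessive p (\<lambda>k. ennreal (f k))"
    and U': "\<forall>j k. U' j k = U j k + f (- k)"
  shows "(\<forall>\<alpha>>0.
            (\<exists>(N :: (int \<Rightarrow> real) measure) Z. permanental_sequence N Z \<alpha> U') \<and>
            (((\<lambda>k. f (- k)) \<longlongrightarrow> 0) at_top \<longrightarrow>
              (\<forall>(N :: 'b measure) Z. permanental_sequence N Z \<alpha> U' \<longrightarrow>
                (AE \<omega> in N. limsup (\<lambda>n. ereal (Z (int n) \<omega> / ln (real n))) = ereal (U 0 0))))) \<and>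
         (\<forall>h :: int \<Rightarrow> real. (\<forall>k. 0 < h k) \<longrightarrow>
            (kernel_apply U (\<lambda>k. ennreal (h k)) \<in> c0_plus \<longleftrightarrow> (\<lambda>k. ennreal (h k)) \<in> c0_plus))"
proof -
  interpret prob_space M using levy by (simp add: levy_process_def)
  interpret levy M X \<beta> by unfold_locales fact+
  have U_eq: "U = (\<lambda>j k. u (k - j))"
    by (simp add: U p fun_eq_iff potential_density_eq_u[OF killing])
  have K: "U' j k = u (k - j) + f (- k)" for j k by (simp add: U' U_eq)
  have f: "supermedian f"
    using excessive_imp_supermedian[OF killing f_nonneg] f_excessive by (simp add: p)
  show ?thesis
  proof (intro conjI allI impI)
    fix \<alpha> :: real assume \<alpha>: "0 < \<alpha>"
    show "\<exists>(N :: (int \<Rightarrow> real) measure) Z. permanental_sequence N Z \<alpha> U'"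
    proof (rule permanental_sequence_exists[OF \<alpha>])
      fix n and i :: "nat \<Rightarrow> int" assume "inj_on i {..<n}"
      from perturbed_potential_inverse_M_matrix[OF f this]
      show "\<exists>A. inverse_M_matrix n (\<lambda>p q. U' (i p) (i q)) A" by (auto simp: K)
    qed
    fix N :: "'b measure" and Z
    assume "((\<lambda>k. f (- k)) \<longlongrightarrow> 0) at_top" "permanental_sequence N Z \<alpha> U'"
    then show "AE \<omega> in N. limsup (\<lambda>n. ereal (Z (int n) \<omega> / ln (real n))) = ereal (U 0 0)"
      using permanental_limsup[OF _ \<alpha> K f] by (simp add: U_eq)
  next
    fix h :: "int \<Rightarrow> real" assume "\<forall>k. 0 < h k"
    then show "kernel_apply U (\<lambda>k. ennreal (h k)) \<in> c0_plus \<longleftrightarrow> (\<lambda>k. ennreal (h k)) \<in> c0_plus"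
      unfolding U_eq by (intro potential_c0_plus) auto
  qed
qed

end
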